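(* Let $k\ge3$ be a fixed integer, let $R$ be a finite commutative ring, let $P$ and $Q$ be probability distributions on $R$, and let $\hat P=P^{\otimes k}$. Suppose that $(\hat P,Q)$ satisfies (A1) and (A2). Define $$\alpha_{P,Q}=1-\frac{1}{\inf\{|C(T)|:T\in\mathcal T(P,Q)\}},$$ with $\alpha_{P,Q}=1$ if $\mathcal T(P,Q)=\emptyset$. Then, for $m=m(n)$, $$\lim_{n\to\infty}\mathbb P[\mathbf B x=\mathbf b\text{ is satisfiable}]=\begin{cases}1 & \text{if } m\ll n^{\alpha_{P,Q}},\\ 0&\text{if } m\gg n^{\alpha_{P,Q}}.\end{cases}$$ Moreover, if $\alpha_{P,Q}<1$ and $m=\lceil Cn^{\alpha_{P,Q}}\rceil$, then for every fixed $C>0$, $$0<\liminf_{n\to\infty}\mathbb P[\mathbf B x=\mathbf b\text{ is satisfiable}]\le\limsup_{n\to\infty}\mathbb P[\mathbf B x=\mathbf b\text{ is satisfiable}]<1.$$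
   Context: Rings are finite, commutative, with identity. Random system. For $n\ge k$ let $C_m=\{a_1,\dots,a_m\}$ and $V_n=\{v_1,\dots,v_n\}$ be disjoint index sets. Given a distribution $\hat P$ on $R^k$ and a distribution $Q$ on $R$, the random matrix $\mathbf B\in R^{C_m\times V_n}$ is defined as follows: independently for each $a\in C_m$, choose $j_1<\dots<j_k$ (a $k$-subset of $[n]$) uniformly at random, sample $(\sigma_1,\dots,\sigma_k)$ from $\hat P$, set $\mathbf B_{a,v_{j_i}}=\sigma_i$ for $1\le i\le k$, and set all other entries of row $a$ to $0$. The vector $\mathbf b\in R^{C_m}$ is independent of $\mathbf B$ and has i.i.d. entries with distribution $Q$. The system $\mathbf Bx=\mathbf b$ is satisfiable if some $x\in R^{V_n}$ satisfies it. $P^{\otimes k}$ is the $k$-fold product measure. (A1): there exist $(a_1,\dots,a_k)\in\operatorname{supp}(\hat P)$ and $b\in\operatorname{supp}(Q)$ such that $b$ lies in the ideal generated by $a_1,\dots,a_k$. (A2): there is no $\sigma\in R$ such that $\sum_{i=1}^k a_i\sigma=b$ for all $(a_1,\dots,a_k)\in\operatorname{supp}(\hat P)$ and all $b\in\operatorname{supp}(Q)$. Factor graphs. A factor graph $F$ is a finite bipartite graph with vertex classes $V(F)$ (variable vertices) and $C(F)$ (constraint vertices), in which every constraint vertex has degree exactly $k$. A weighted factor graph $(F,w)$ carries a weight $w(cv)\in R$ on every edge $cv$ and a weight $w(c)\in R$ on every constraint vertex $c$. It is satisfiable if there is $x\in R^{V(F)}$ with $\sum_{v\in N(c)}w(cv)x_v=w(c)$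 for every $c\in C(F)$, and unsatisfiable otherwise. $\mathcal T(P,Q)$ is the set of unsatisfiable, connected, acyclic weighted factor graphs with all edge weights in $\operatorname{supp}(P)$ and all constraint vertex weights in $\operatorname{supp}(Q)$. $f(n)\ll g(n)$ means $f(n)/g(n)\to0$, and $f\gg g$ means $g\ll f$; $m=m(n)$ is a sequence of nonnegative integers. *)

theory Defs
  imports "HOL-Probability.Probability" "HOL-Library.Landau_Symbols"
begin

section \<open>The random linear system\<close>

text \<open>
  A vector in $R^k$ is a function of type \<open>nat \<Rightarrow> 'r\<close> of which only the values at the
  indices \<open>i < k\<close> matter; likewise the constraints are \<open>0, \<dots>, m - 1\<close> and the variables
  \<open>0, \<dots>, n - 1\<close>. A distribution on $R^k$ is a \<open>(nat \<Rightarrow> 'r) pmf\<close>. The product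
  distribution \<open>Pi_pmf\<close> puts its default value, here 0, at all indices outside its index set.
\<close>

definition product_dist :: "nat \<Rightarrow> 'r pmf \<Rightarrow> (nat \<Rightarrow> 'r::zero) pmf" where
  "product_dist k P = Pi_pmf {..<k} 0 (\<lambda>_. P)"

text \<open>\<open>sorted_list_of_set J ! i\<close> is the column $j_{i+1}$ of the random $k$-set
  $J = \{j_1 < \dots < j_k\}$. For \<open>n < k\<close> there is no such set and the distribution
  is unspecified.\<close>

definition place_row :: "nat \<Rightarrow> nat set \<Rightarrow> (nat \<Rightarrow> 'r) \<Rightarrow> nat \<Rightarrow> 'r::comm_monoid_add" where
  "place_row k J s = (\<lambda>j. \<Sum>i<k. if j = sorted_list_of_set J ! i then s i else 0)"

definition row_pmf :: "nat \<Rightarrow> (nat \<Rightarrow> 'r) pmf \<Rightarrow> nat \<Rightarrow> (nat \<Rightarrow> 'r::comm_ring_1) pmf" where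
  "row_pmf k Phat n =
     do { J \<leftarrow> pmf_of_set {J. J \<subseteq> {..<n} \<and> card J = k};
          s \<leftarrow> Phat;
          return_pmf (place_row k J s) }"

definition system_pmf ::
  "nat \<Rightarrow> (nat \<Rightarrow> 'r) pmf \<Rightarrow> 'r pmf \<Rightarrow> nat \<Rightarrow> nat
     \<Rightarrow> ((nat \<Rightarrow> nat \<Rightarrow> 'r::comm_ring_1) \<times> (nat \<Rightarrow> 'r)) pmf" where
  "system_pmf k Phat Q m n =
     pair_pmf (Pi_pmf {..<m} (\<lambda>_. 0) (\<lambda>_. row_pmf k Phat n)) (Pi_pmf {..<m} 0 (\<lambda>_. Q))"

definition system_satisfiable ::
  "nat \<Rightarrow> nat \<Rightarrow> (nat \<Rightarrow> nat \<Rightarrow> 'r::comm_ring_1) \<Rightarrow> (nat \<Rightarrow> 'r) \<Rightarrow> bool" where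
  "system_satisfiable m n B b \<longleftrightarrow> (\<exists>x. \<forall>a<m. (\<Sum>v<n. B a v * x v) = b a)"

definition sat_prob ::
  "nat \<Rightarrow> (nat \<Rightarrow> 'r::comm_ring_1) pmf \<Rightarrow> 'r pmf \<Rightarrow> nat \<Rightarrow> nat \<Rightarrow> real" where
  "sat_prob k Phat Q m n =
     measure_pmf.prob (system_pmf k Phat Q m n) {(B, b). system_satisfiable m n B b}"

text \<open>The span of a set in the ring, viewed as a module over itself, is the ideal
  generated by that set.\<close>

definition cond_A1 :: "nat \<Rightarrow> (nat \<Rightarrow> 'r::comm_ring_1) pmf \<Rightarrow> 'r pmf \<Rightarrow> bool" where
  "cond_A1 k Phat Q \<longleftrightarrow>
     (\<exists>a\<in>set_pmf Phat. \<exists>b\<in>set_pmf Q. b \<in> module.span (*) (a ` {..<k}))"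

definition cond_A2 :: "nat \<Rightarrow> (nat \<Rightarrow> 'r::comm_ring_1) pmf \<Rightarrow> 'r pmf \<Rightarrow> bool" where
  "cond_A2 k Phat Q \<longleftrightarrow>
     \<not> (\<exists>s. \<forall>a\<in>set_pmf Phat. \<forall>b\<in>set_pmf Q. (\<Sum>i<k. a i * s) = b)"


section \<open>Weighted factor graphs\<close>

text \<open>
  Both vertex classes are labelled by natural numbers, which loses nothing for finite graphs;
  their disjointness is enforced by the tags \<open>Inl\<close> (constraints) and \<open>Inr\<close> (variables).
  The weight functions are total, but only their values on actual edges and constraints are used.
\<close>

record 'r wfactor_graph =
  constrs :: "nat set"
  vars :: "nat set"
  edges :: "(nat \<times> nat) set"
  edge_weight :: "nat \<Rightarrow> nat \<Rightarrow> 'r"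
  constr_weight :: "nat \<Rightarrow> 'r"

definition nbhd :: "'r wfactor_graph \<Rightarrow> nat \<Rightarrow> nat set" where
  "nbhd F c = {v. (c, v) \<in> edges F}"

definition factor_graph :: "nat \<Rightarrow> 'r wfactor_graph \<Rightarrow> bool" where
  "factor_graph k F \<longleftrightarrow>
     finite (constrs F) \<and> finite (vars F) \<and> edges F \<subseteq> constrs F \<times> vars F \<and>
     (\<forall>c\<in>constrs F. card (nbhd F c) = k)"

definition fg_verts :: "'r wfactor_graph \<Rightarrow> (nat + nat) set" where
  "fg_verts F = Inl ` constrs F \<union> Inr ` vars F"

definition fg_adj :: "'r wfactor_graph \<Rightarrow> (nat + nat) rel" where
  "fg_adj F = {(Inl c, Inr v) | c v. (c, v) \<in> edges F} \<union> {(Inr v, Inl c) | c v. (c, v) \<in> edges F}"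

definition fg_connected :: "'r wfactor_graph \<Rightarrow> bool" where
  "fg_connected F \<longleftrightarrow> (\<forall>x\<in>fg_verts F. \<forall>y\<in>fg_verts F. (x, y) \<in> (fg_adj F)\<^sup>*)"

definition fg_cycle :: "'r wfactor_graph \<Rightarrow> (nat + nat) list \<Rightarrow> bool" where
  "fg_cycle F p \<longleftrightarrow>
     length p \<ge> 3 \<and> distinct p \<and>
     (\<forall>i. Suc i < length p \<longrightarrow> (p ! i, p ! Suc i) \<in> fg_adj F) \<and> (last p, hd p) \<in> fg_adj F"

definition fg_acyclic :: "'r wfactor_graph \<Rightarrow> bool" where
  "fg_acyclic F \<longleftrightarrow> (\<nexists>p. fg_cycle F p)"

definition fg_satisfiable :: "'r::comm_ring_1 wfactor_graph \<Rightarrow> bool" where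
  "fg_satisfiable F \<longleftrightarrow>
     (\<exists>x. \<forall>c\<in>constrs F. (\<Sum>v\<in>nbhd F c. edge_weight F c v * x v) = constr_weight F c)"

definition unsat_trees :: "nat \<Rightarrow> 'r pmf \<Rightarrow> 'r pmf \<Rightarrow> 'r::comm_ring_1 wfactor_graph set" where
  "unsat_trees k P Q =
     {T. factor_graph k T \<and> fg_connected T \<and> fg_acyclic T \<and> \<not> fg_satisfiable T \<and>
         (\<forall>(c, v)\<in>edges T. edge_weight T c v \<in> set_pmf P) \<and>
         (\<forall>c\<in>constrs T. constr_weight T c \<in> set_pmf Q)}"

text \<open>The infimum is that of a nonempty set of natural numbers. It is positive, because a
  factor graph without constraints is satisfiable.\<close>

definition threshold_exp :: "nat \<Rightarrow> 'r pmf \<Rightarrow> 'r::comm_ring_1 pmf \<Rightarrow> real" where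
  "threshold_exp k P Q =
     (if unsat_trees k P Q = {} then 1
      else 1 - 1 / real (INF T\<in>unsat_trees k P Q. card (constrs T)))"


section \<open>Asymptotic comparison\<close>

text \<open>
  For an eventually nonzero \<open>g\<close> this says that \<open>f n / g n\<close> tends to 0. Unlike the quotient,
  which would have the value 0 wherever \<open>g n = 0\<close>, it fails if \<open>g\<close> vanishes infinitely
  often at points where \<open>f\<close> does not.
\<close>

definition much_less :: "(nat \<Rightarrow> real) \<Rightarrow> (nat \<Rightarrow> real) \<Rightarrow> bool" (infix "\<lless>" 50) where
  "f \<lless> g \<longleftrightarrow> f \<in> o(g)"

end

theory Submission
  imports Defs "HOL-Real_Asymp.Real_Asymp"
begin

text \<open>
  If \<open>m \<lless> n\<close>, the factor graph of the random system is acyclic with high probability, because the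
  expected number of cycles of length \<open>2 l\<close> is at most \<open>(2 k\<^sup>2 m / n) ^ l\<close>. An unsatisfiable acyclic
  system has an unsatisfiable component, which is then an unsatisfiable tree. The expected number of
  connected sets of \<open>s\<close> rows is of order \<open>m ^ s / n ^ (s - 1)\<close>; taking for \<open>s\<close> the size of a smallest
  unsatisfiable tree, it tends to 0 below the threshold, and at the threshold the local lemma keeps the
  probability that there is none away from 0. For \<open>s = 1\<close> the local lemma is of no use, since every
  single row is connected. Then the boundedly many rows are pairwise disjoint with high probability,
  and (A1) lets all of them be satisfiable.

  Conversely, the number of copies of a smallest unsatisfiable tree has expectation of the same order,
  and its second moment is controlled by the fact that two copies sharing a row form a connected set.
  Without any unsatisfiable tree the threshold is linear, and a union bound over all assignments
  suffices: if \<open>\<sigma>\<close> is the most frequent value of an assignment, a row has all its variables equal to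
  \<open>\<sigma>\<close> with probability bounded below, and (A2) makes it violated with probability bounded below.
\<close>

section \<open>Product distributions\<close>

text \<open>Everything hinges on one exponent. A forest with \<open>s\<close> constraints of degree
  \<open>k\<close> has at least \<open>(k - 1) s + 1\<close> variables. A tree therefore has at
  least of order \<open>n ^ ((k - 1) s + 1)\<close> placements, each of probability of order
  \<open>1 / n ^ (k s)\<close> on given rows. The result, \<open>1 / n ^ (s - 1)\<close>, matches
  the upper bound for \<open>s\<close> given rows to be connected; hence upper bounds need
  connectivity only, never the shape of a tree. Coefficients are assigned to columns in increasing
  order, so moving the variables of a tree could permute a row. Since the row law is a product,
  every order of supported weights has positive probability, and it suffices to keep the order fixed
  while positions vary. Copies are sought among the first \<open>min m n\<close> rows only. This
  bounds every overlap size uniformly, and loses nothing: below exponent 1, already \<open>n\<close>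
  rows are far above the threshold. The sample space retains the column set of each row, because a
  coefficient 0 is invisible in the matrix while its edge still counts for degree and
  connectivity.\<close>

lemma prob_bind_le:
  assumes "\<And>x. x \<in> set_pmf M \<Longrightarrow> measure_pmf.prob (N x) E \<le> q * indicator F x" "q \<ge> 0"
  shows "measure_pmf.prob (bind_pmf M N) E \<le> q * measure_pmf.prob M F"
proof -
  have "ennreal (measure_pmf.prob (bind_pmf M N) E) = (\<integral>\<^sup>+x. emeasure (N x) E \<partial>M)"
    by (simp add: measure_pmf.emeasure_eq_measure[symmetric])
  also have "\<dots> \<le> (\<integral>\<^sup>+x. ennreal q * indicator F x \<partial>M)"
  proof (rule nn_integral_mono_AE, unfold AE_measure_pmf_iff, rule ballI)
    fix x assume "x \<in> set_pmf M"
    from assms(1)[OF this] show "emeasure (N x) E \<le> ennreal q * indicator F x"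
      by (cases "x \<in> F") (auto simp: measure_pmf.emeasure_eq_measure intro: ennreal_leI antisym)
  qed
  also have "\<dots> = ennreal (q * measure_pmf.prob M F)"
    using assms(2) by (simp add: nn_integral_cmult measure_pmf.emeasure_eq_measure ennreal_mult)
  finally show ?thesis using assms(2) by simp
qed

text \<open>An independent coordinate may be drawn a second time without changing the joint law.
  This replaces conditioning on all other coordinates.\<close>

lemma Pi_pmf_resample:
  assumes "finite A" "a \<in> A"
  shows "Pi_pmf A d p = bind_pmf (Pi_pmf A d p) (\<lambda>f. map_pmf (\<lambda>y. f(a := y)) (p a))"
proof -
  define A' where "A' = A - {a}"
  have A: "A = insert a A'" "finite A'" "a \<notin> A'" using assms by (auto simp: A'_def)
  have "bind_pmf (Pi_pmf A d p) (\<lambda>f. map_pmf (\<lambda>y. f(a := y)) (p a))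
      = bind_pmf (Pi_pmf A' d p) (\<lambda>f. map_pmf (\<lambda>y. f(a := y)) (p a))"
  proof -
    have "fun_upd (f(a := y)) a = fun_upd f a" for f :: "'a \<Rightarrow> 'b" and y by (auto simp: fun_eq_iff)
    thus ?thesis
      unfolding A(1) by (simp add: Pi_pmf_insert'[OF A(2,3)] bind_assoc_pmf bind_return_pmf)
  qed
  also have "\<dots> = Pi_pmf A d p"
    unfolding A(1) Pi_pmf_insert'[OF A(2,3)] map_pmf_def by (subst bind_commute_pmf) simp
  finally show ?thesis ..
qed

lemma prob_Pi_pmf_resample_le:
  assumes "finite A" "a \<in> A" "q \<ge> 0"
    and "\<And>f. f \<in> set_pmf (Pi_pmf A d p) \<Longrightarrow>
           measure_pmf.prob (p a) {y. f(a := y) \<in> E} \<le> q * indicator F f"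
  shows "measure_pmf.prob (Pi_pmf A d p) E \<le> q * measure_pmf.prob (Pi_pmf A d p) F"
  by (subst Pi_pmf_resample[OF assms(1,2)], rule prob_bind_le)
     (use assms(3,4) in \<open>auto simp: vimage_def\<close>)

lemma prob_pair_pmf_Times:
  "measure_pmf.prob (pair_pmf M N) (X \<times> Y) = measure_pmf.prob M X * measure_pmf.prob N Y"
proof -
  have "measure_pmf.prob (pair_pmf M N) (X \<times> Y)
      = measure_pmf.prob (pair_pmf M N) ((X \<inter> set_pmf M) \<times> (Y \<inter> set_pmf N))"
    by (subst measure_Int_set_pmf[symmetric]) (simp add: Times_Int_Times)
  also have "\<dots> = measure_pmf.prob M X * measure_pmf.prob N Y"
    by (subst measure_pmf_prob_product) (auto simp: measure_Int_set_pmf countable_Int2)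
  finally show ?thesis .
qed

text \<open>Measurability with respect to the coordinates in \<open>U\<close>, without
  sigma-algebras. One implication suffices because \<open>f\<close> and \<open>g\<close> can be
  exchanged.\<close>

definition depends_on :: "('a \<Rightarrow> 'b) set \<Rightarrow> 'a set \<Rightarrow> bool" where
  "depends_on E U \<longleftrightarrow> (\<forall>f g. (\<forall>x\<in>U. f x = g x) \<longrightarrow> f \<in> E \<longrightarrow> g \<in> E)"

lemma depends_on_iff:
  "depends_on E U \<Longrightarrow> (\<And>x. x \<in> U \<Longrightarrow> f x = g x) \<Longrightarrow> f \<in> E \<longleftrightarrow> g \<in> E"
  unfolding depends_on_def by metis

text \<open>The product is split into the coordinates inside \<open>U\<close> and those outside;
  \<open>E\<close> reads only the first part and \<open>F\<close> only the second, so the joint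
  event becomes a rectangle.\<close>

lemma prob_Pi_pmf_indep:
  assumes fin: "finite A" and E: "depends_on E U" and F: "depends_on F W" and "U \<inter> W = {}"
  shows "measure_pmf.prob (Pi_pmf A d p) (E \<inter> F) =
           measure_pmf.prob (Pi_pmf A d p) E * measure_pmf.prob (Pi_pmf A d p) F"
proof -
  define M where "M = Pi_pmf (A \<inter> U) d p"
  define N where "N = Pi_pmf (A - U) d p"
  let ?h = "\<lambda>(f,g) x. if x \<in> A \<inter> U then f x else g x"
  have "Pi_pmf ((A \<inter> U) \<union> (A - U)) d p = map_pmf ?h (pair_pmf M N)"
    unfolding M_def N_def by (rule Pi_pmf_union) (use fin in auto)
  hence M: "Pi_pmf A d p = map_pmf ?h (pair_pmf M N)" by (simp only: Int_Diff_Un)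
  \<comment> \<open>\<open>U\<close> may contain coordinates outside \<open>A\<close>. There the
    glued function reads from \<open>g\<close>, which agrees with \<open>f\<close> only because both
    have the default value \<open>d\<close> on the support.\<close>
  have hE: "?h z \<in> E \<longleftrightarrow> fst z \<in> E" if "z \<in> set_pmf (pair_pmf M N)" for z
  proof -
    obtain f g where z: "z = (f, g)" by force
    have "f x = d" if "x \<notin> A" for x using \<open>z \<in> _\<close> fin that unfolding z M_def
      by (auto simp: set_Pi_pmf PiE_dflt_def)
    moreover have "g x = d" if "x \<notin> A" for x using \<open>z \<in> _\<close> fin that unfolding z N_def
      by (auto simp: set_Pi_pmf PiE_dflt_def)
    ultimately have "?h z x = fst z x" if "x \<in> U" for x unfolding z using that by auto
    thus ?thesis by (rule depends_on_iff[OF E])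
  qed
  have hF: "?h z \<in> F \<longleftrightarrow> snd z \<in> F" for z
  proof -
    have "?h z x = snd z x" if "x \<in> W" for x using assms(4) that by (auto simp: case_prod_unfold)
    thus ?thesis by (rule depends_on_iff[OF F])
  qed
  have eq: "measure_pmf.prob (Pi_pmf A d p) G = measure_pmf.prob (pair_pmf M N) (X \<times> Y)"
    if "\<And>z. z \<in> set_pmf (pair_pmf M N) \<Longrightarrow> ?h z \<in> G \<longleftrightarrow> z \<in> X \<times> Y" for G X Y
  proof -
    have "measure_pmf.prob (Pi_pmf A d p) G = measure_pmf.prob (pair_pmf M N) (?h -` G)"
      unfolding M by simp
    also have "\<dots> = measure_pmf.prob (pair_pmf M N) (X \<times> Y)"
      by (rule measure_pmf.finite_measure_eq_AE) (use that in \<open>auto simp: AE_measure_pmf_iff\<close>)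
    finally show ?thesis .
  qed
  have "measure_pmf.prob (Pi_pmf A d p) (E \<inter> F) = measure_pmf.prob (pair_pmf M N) (E \<times> F)"
    by (rule eq) (use hE hF in \<open>auto simp: mem_Times_iff\<close>)
  moreover have "measure_pmf.prob (Pi_pmf A d p) E = measure_pmf.prob (pair_pmf M N) (E \<times> UNIV)"
    by (rule eq) (use hE in \<open>auto simp: mem_Times_iff\<close>)
  moreover have "measure_pmf.prob (Pi_pmf A d p) F = measure_pmf.prob (pair_pmf M N) (UNIV \<times> F)"
    by (rule eq) (use hF in \<open>auto simp: mem_Times_iff\<close>)
  ultimately show ?thesis by (simp add: prob_pair_pmf_Times)
qed

lemma prob_Pi_pmf_cylinder:
  assumes "finite A" "U \<subseteq> A"
  shows "measure_pmf.prob (Pi_pmf A d p) {f. \<forall>a\<in>U. f a \<in> E a} = (\<Prod>a\<in>U. measure_pmf.prob (p a) (E a))"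
proof -
  have "{f. \<forall>a\<in>U. f a \<in> E a} = Pi A (\<lambda>a. if a \<in> U then E a else UNIV)"
    using assms(2) by (auto simp: Pi_def)
  hence "measure_pmf.prob (Pi_pmf A d p) {f. \<forall>a\<in>U. f a \<in> E a} =
     (\<Prod>a\<in>A. if a \<in> U then measure_pmf.prob (p a) (E a) else 1)"
    by (simp add: measure_Pi_pmf_Pi assms(1) if_distrib cong: if_cong)
  also have "\<dots> = (\<Prod>a\<in>U. measure_pmf.prob (p a) (E a))"
    using assms by (simp add: prod.If_cases Int_absorb1)
  finally show ?thesis .
qed

text \<open>Merges the matrix and the right-hand side, which are drawn separately, into one family
  of independent rows.\<close>

lemma Pi_pmf_pair:
  assumes "finite A"
  shows "Pi_pmf A (d, e) (\<lambda>x. pair_pmf (p x) (q x)) =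
    map_pmf (\<lambda>(f, g) x. (f x, g x)) (pair_pmf (Pi_pmf A d p) (Pi_pmf A e q))"
  using assms
proof (induction A rule: finite_induct)
  case (insert a A)
  let ?r = "\<lambda>x y f g. return_pmf ((\<lambda>z. (f z, g z))(a := (x, y)))"
  have "Pi_pmf (insert a A) (d, e) (\<lambda>x. pair_pmf (p x) (q x)) =
    bind_pmf (p a) (\<lambda>x. bind_pmf (q a) (\<lambda>y.
      bind_pmf (Pi_pmf A d p) (\<lambda>f. bind_pmf (Pi_pmf A e q) (?r x y f))))"
    by (simp only: Pi_pmf_insert'[OF insert.hyps] insert.IH)
       (simp add: pair_pmf_def map_pmf_def bind_assoc_pmf bind_return_pmf)
  also have "\<dots> = bind_pmf (p a) (\<lambda>x. bind_pmf (Pi_pmf A d p) (\<lambda>f.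
      bind_pmf (q a) (\<lambda>y. bind_pmf (Pi_pmf A e q) (?r x y f))))"
    by (subst bind_commute_pmf) simp
  also have "?r = (\<lambda>x y f g. return_pmf (\<lambda>z. ((f(a := x)) z, (g(a := y)) z)))"
    by (auto simp: fun_eq_iff)
  finally show ?case
    by (simp only: Pi_pmf_insert'[OF insert.hyps])
       (simp add: pair_pmf_def map_pmf_def bind_assoc_pmf bind_return_pmf)
qed (simp add: pair_return_pmf map_pmf_def bind_return_pmf)

section \<open>The second moment method and the local lemma\<close>

text \<open>For the number \<open>X\<close> of events that occur, \<open>(1 - t X)^2 \<ge> 0\<close>
  gives \<open>2 t X - t^2 X^2 \<le> 1\<close> where \<open>X > 0\<close>, and the left side is 0
  where \<open>X = 0\<close>. Taking expectations with \<open>t = S1 / B\<close>, the optimal choice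
  for the bound \<open>B\<close> on the second moment, gives the claim.\<close>

lemma second_moment_bound:
  fixes M :: "'w pmf" and A :: "'i \<Rightarrow> 'w set"
  assumes "finite I"
  defines "S1 \<equiv> \<Sum>i\<in>I. measure_pmf.prob M (A i)"
    and "S2 \<equiv> \<Sum>i\<in>I. \<Sum>j\<in>I. measure_pmf.prob M (A i \<inter> A j)"
  assumes "S2 \<le> B" "B > 0"
  shows "S1\<^sup>2 / B \<le> measure_pmf.prob M (\<Union>i\<in>I. A i)"
proof -
  define t where "t = S1 / B"
  let ?X = "\<lambda>w. \<Sum>i\<in>I. indicator (A i) w :: real"
  have int: "integrable (measure_pmf M) (indicator C :: 'w \<Rightarrow> real)" for C
    by (simp add: measure_pmf.emeasure_eq_measure)
  have XX: "(?X w)\<^sup>2 = (\<Sum>i\<in>I. \<Sum>j\<in>I. indicator (A i \<inter> A j) w)" for w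
    by (simp add: power2_eq_square sum_product indicator_inter_arith)
  have "2 * t * ?X w - t\<^sup>2 * (?X w)\<^sup>2 \<le> indicator (\<Union>i\<in>I. A i) w" for w
  proof (cases "w \<in> (\<Union>i\<in>I. A i)")
    case True
    have "0 \<le> (1 - t * ?X w)\<^sup>2" by simp
    also have "\<dots> = 1 - (2 * t * ?X w - t\<^sup>2 * (?X w)\<^sup>2)" by (simp add: power2_eq_square algebra_simps)
    finally show ?thesis using True by simp
  next
    case False
    hence "?X w = 0" by (auto intro!: sum.neutral simp: indicator_def)
    thus ?thesis by simp
  qed
  hence "measure_pmf.expectation M (\<lambda>w. 2 * t * ?X w - t\<^sup>2 * (\<Sum>i\<in>I. \<Sum>j\<in>I. indicator (A i \<inter> A j) w))
      \<le> measure_pmf.expectation M (indicator (\<Union>i\<in>I. A i))"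
    unfolding XX by (intro integral_mono Bochner_Integration.integrable_diff integrable_mult_right
        Bochner_Integration.integrable_sum int) auto
  also have "measure_pmf.expectation M (\<lambda>w. 2 * t * ?X w - t\<^sup>2 * (\<Sum>i\<in>I. \<Sum>j\<in>I. indicator (A i \<inter> A j) w))
     = 2 * t * S1 - t\<^sup>2 * S2"
    unfolding S1_def S2_def
    by (subst Bochner_Integration.integral_diff) (auto intro!: integrable_mult_right
        Bochner_Integration.integrable_sum int simp: Bochner_Integration.integral_sum int)
  finally have "2 * t * S1 - t\<^sup>2 * S2 \<le> measure_pmf.prob M (\<Union>i\<in>I. A i)" by simp
  moreover have "t\<^sup>2 * S2 \<le> t\<^sup>2 * B" using assms(4) by (simp add: mult_left_mono)
  moreover have "2 * t * S1 - t\<^sup>2 * B = S1\<^sup>2 / B" using assms(5) by (simp add: t_def power2_eq_square field_simps)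
  ultimately show ?thesis by linarith
qed

text \<open>By induction on the conditioning set, an event has conditional probability at most
  \<open>2 q\<close> given that any other events fail; the chain rule then yields one factor
  \<open>1 - 2 q\<close> per event.\<close>

lemma lovasz_local_symmetric:
  fixes M :: "'w pmf" and A :: "'i \<Rightarrow> 'w set"
  assumes fin: "finite I" and q: "\<And>i. i \<in> I \<Longrightarrow> measure_pmf.prob M (A i) \<le> q"
    and d: "\<And>i. i \<in> I \<Longrightarrow> real (card {j \<in> I. nb i j}) \<le> d"
    and indep: "\<And>i S. i \<in> I \<Longrightarrow> S \<subseteq> {j \<in> I. \<not> nb i j} \<Longrightarrow>
       measure_pmf.prob M (A i \<inter> (\<Inter>j\<in>S. - A j)) = measure_pmf.prob M (A i) * measure_pmf.prob M (\<Inter>j\<in>S. - A j)"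
    and "4 * q * d \<le> 1" "0 \<le> q" "q \<le> 1/2"
  shows "(1 - 2 * q) ^ card I \<le> measure_pmf.prob M (\<Inter>i\<in>I. - A i)"
proof -
  let ?P = "measure_pmf.prob M" and ?N = "\<lambda>S. \<Inter>j\<in>S. - A j"
  have main: "?P (A i \<inter> ?N S) \<le> 2 * q * ?P (?N S)" if "S \<subseteq> I" "i \<in> I" for i S
    using that
  proof (induction "card S" arbitrary: S i rule: less_induct)
    case less
    have finS: "finite S" using less.prems fin finite_subset by blast
    define S1 where "S1 = {j \<in> S. nb i j}"
    define S2 where "S2 = S - S1"
    have S: "S1 \<subseteq> S" "S2 \<subseteq> I" "S2 \<subseteq> {j \<in> I. \<not> nb i j}" "finite S1" "finite S2" "S = S1 \<union> S2"
      using less.prems finS by (auto simp: S1_def S2_def)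
    have "?P (A i \<inter> ?N S) \<le> ?P (A i \<inter> ?N S2)"
      by (rule measure_pmf.finite_measure_mono) (use S in auto)
    also have "\<dots> = ?P (A i) * ?P (?N S2)" by (rule indep) (use less.prems S in auto)
    also have "\<dots> \<le> q * ?P (?N S2)" using q[OF less.prems(2)] by (simp add: mult_right_mono)
    finally have 1: "?P (A i \<inter> ?N S) \<le> q * ?P (?N S2)" .
    \<comment> \<open>Adding the failure of the at most \<open>d\<close> neighbours costs at most a
      factor 2: each of them has conditional probability at most \<open>2 q\<close> by induction,
      and \<open>2 q d \<le> 1/2\<close>.\<close>
    have 2: "?P (?N S2) \<le> 2 * ?P (?N S)"
    proof (cases "S1 = {}")
      case True
      hence "S2 = S" by (simp add: S2_def)
      thus ?thesis by simp
    next
      case False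
      hence "card S2 < card S" using finS S(1) by (intro psubset_card_mono) (auto simp: S2_def)
      hence IH: "?P (A j \<inter> ?N S2) \<le> 2 * q * ?P (?N S2)" if "j \<in> S1" for j
        using less.hyps[OF _ S(2), of j] that S(1) less.prems(1) by blast
      have "?P (?N S2) \<le> ?P (?N S \<union> (\<Union>j\<in>S1. A j \<inter> ?N S2))"
        by (rule measure_pmf.finite_measure_mono) (use S in auto)
      also have "\<dots> \<le> ?P (?N S) + ?P (\<Union>j\<in>S1. A j \<inter> ?N S2)"
        by (rule measure_subadditive) auto
      also have "?P (\<Union>j\<in>S1. A j \<inter> ?N S2) \<le> (\<Sum>j\<in>S1. ?P (A j \<inter> ?N S2))"
        by (rule measure_UNION_le) (use S in auto)
      also have "\<dots> \<le> (\<Sum>j\<in>S1. 2 * q * ?P (?N S2))" by (rule sum_mono[OF IH])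
      also have "\<dots> = real (card S1) * (2 * q * ?P (?N S2))" by simp
      also have "\<dots> \<le> d * (2 * q * ?P (?N S2))"
      proof (rule mult_right_mono)
        have "card S1 \<le> card {j \<in> I. nb i j}"
          by (rule card_mono) (use fin less.prems in \<open>auto simp: S1_def\<close>)
        thus "real (card S1) \<le> d" using d[OF less.prems(2)] by linarith
      qed (use assms in auto)
      also have "\<dots> = (4 * q * d) * (?P (?N S2) / 2)" by simp
      also have "\<dots> \<le> 1 * (?P (?N S2) / 2)" by (rule mult_right_mono) (use assms in auto)
      finally show ?thesis by linarith
    qed
    have "q * ?P (?N S2) \<le> q * (2 * ?P (?N S))" by (rule mult_left_mono[OF 2]) (use assms in auto)
    with 1 show ?case by simp
  qed
  have "(1 - 2 * q) ^ card S \<le> ?P (?N S)" if "S \<subseteq> I" for S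
    using finite_subset[OF that fin] that
  proof (induction S rule: finite_induct)
    case (insert i S)
    have "?P (?N S) \<le> ?P (A i \<inter> ?N S) + ?P (?N (insert i S))"
    proof -
      have "?P (?N S) \<le> ?P ((A i \<inter> ?N S) \<union> ?N (insert i S))"
        by (rule measure_pmf.finite_measure_mono) auto
      also have "\<dots> \<le> ?P (A i \<inter> ?N S) + ?P (?N (insert i S))" by (rule measure_subadditive) auto
      finally show ?thesis .
    qed
    moreover have "?P (A i \<inter> ?N S) \<le> 2 * q * ?P (?N S)" using main insert by auto
    ultimately have "(1 - 2 * q) * ?P (?N S) \<le> ?P (?N (insert i S))" by (simp add: algebra_simps)
    moreover have "(1 - 2 * q) * (1 - 2 * q) ^ card S \<le> (1 - 2 * q) * ?P (?N S)"
      using insert assms by (intro mult_left_mono) auto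
    ultimately show ?case using insert by simp
  qed simp
  thus ?thesis by simp
qed

section \<open>Uniformly random \<open>k\<close>-subsets\<close>

definition ksubsets :: "nat \<Rightarrow> nat \<Rightarrow> nat set set" where
  "ksubsets k n = {J. J \<subseteq> {..<n} \<and> card J = k}"

lemma finite_ksubsets [simp]: "finite (ksubsets k n)"
  unfolding ksubsets_def by (rule finite_subset[of _ "Pow {..<n}"]) auto

lemma card_ksubsets: "card (ksubsets k n) = n choose k"
  unfolding ksubsets_def by (simp add: n_subsets)

lemma ksubsets_nonempty: "k \<le> n \<Longrightarrow> ksubsets k n \<noteq> {}"
  using card_ksubsets[of k n] by (metis card.empty binomial_eq_0_iff not_le)

lemma card_ksubsets_superset:
  assumes "W \<subseteq> {..<n}" "card W \<le> k"
  shows "card {J \<in> ksubsets k n. W \<subseteq> J} = (n - card W) choose (k - card W)"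
proof -
  have finW: "finite W" using assms finite_subset by blast
  have fin: "finite J" if "J \<subseteq> {..<n}" for J using that finite_subset by blast
  have "bij_betw (\<lambda>J. J - W) {J \<in> ksubsets k n. W \<subseteq> J} {L. L \<subseteq> {..<n} - W \<and> card L = k - card W}"
  proof (rule bij_betwI[where g = "\<lambda>L. L \<union> W"])
    show "(\<lambda>L. L \<union> W) \<in> {L. L \<subseteq> {..<n} - W \<and> card L = k - card W} \<rightarrow> {J \<in> ksubsets k n. W \<subseteq> J}"
    proof
      fix L assume L: "L \<in> {L. L \<subseteq> {..<n} - W \<and> card L = k - card W}"
      hence "card (L \<union> W) = card L + card W" using finW by (intro card_Un_disjoint) (auto intro: fin)
      thus "L \<union> W \<in> {J \<in> ksubsets k n. W \<subseteq> J}" using L assms by (auto simp: ksubsets_def)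
    qed
  qed (use assms finW in \<open>auto simp: ksubsets_def card_Diff_subset\<close>)
  hence "card {J \<in> ksubsets k n. W \<subseteq> J} = card {L. L \<subseteq> {..<n} - W \<and> card L = k - card W}"
    by (rule bij_betw_same_card)
  also have "\<dots> = (n - card W) choose (k - card W)"
    by (subst n_subsets) (use assms finW in \<open>auto simp: card_Diff_subset\<close>)
  finally show ?thesis .
qed

lemma prob_ksubsets_mem:
  assumes "k \<le> n" "k \<ge> 1" "v < n"
  shows "measure_pmf.prob (pmf_of_set (ksubsets k n)) {J. v \<in> J} = k / n"
proof -
  have "ksubsets k n \<inter> {J. v \<in> J} = {J \<in> ksubsets k n. {v} \<subseteq> J}" by auto
  hence eq: "measure_pmf.prob (pmf_of_set (ksubsets k n)) {J. v \<in> J} = real ((n-1) choose (k-1)) / real (n choose k)"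
    using assms card_ksubsets_superset[of "{v}" n k]
    by (simp add: measure_pmf_of_set ksubsets_nonempty card_ksubsets)
  moreover have "real k * real (n choose k) = real n * real ((n-1) choose (k-1))"
    using times_binomial_minus1_eq[of k n] assms by (metis of_nat_mult less_eq_Suc_le One_nat_def)
  moreover have "real (n choose k) > 0" using assms by (simp add: zero_less_binomial)
  ultimately show ?thesis using assms unfolding eq
    by (subst frac_eq_eq) (auto simp: mult.commute)
qed

lemma prob_ksubsets_mem2:
  assumes "k \<le> n" "k \<ge> 2" "v < n" "w < n" "v \<noteq> w"
  shows "measure_pmf.prob (pmf_of_set (ksubsets k n)) {J. v \<in> J \<and> w \<in> J} \<le> 2 * (real k)\<^sup>2 / (real n)\<^sup>2"
proof -
  have "ksubsets k n \<inter> {J. v \<in> J \<and> w \<in> J} = {J \<in> ksubsets k n. {v, w} \<subseteq> J}" by auto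
  hence eq: "measure_pmf.prob (pmf_of_set (ksubsets k n)) {J. v \<in> J \<and> w \<in> J} = real ((n-2) choose (k-2)) / real (n choose k)"
    using assms card_ksubsets_superset[of "{v,w}" n k]
    by (simp add: numeral_2_eq_2 measure_pmf_of_set ksubsets_nonempty card_ksubsets)
  have 1: "real k * real (n choose k) = real n * real ((n-1) choose (k-1))"
    using times_binomial_minus1_eq[of k n] assms by (metis of_nat_mult less_le_trans zero_less_numeral)
  have 2: "real (k-1) * real ((n-1) choose (k-1)) = real (n-1) * real ((n-2) choose (k-2))"
    using times_binomial_minus1_eq[of "k-1" "n-1"] assms
    by (metis (no_types, lifting) diff_diff_left le_simps(3) of_nat_mult one_add_one zero_less_diff Suc_1)
  have 3: "real (n choose k) > 0" using assms by (simp add: zero_less_binomial)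
  have "real ((n-2) choose (k-2)) = real (k-1) * (real k * real (n choose k) / real n) / real (n-1)"
    using 1 2 assms by (simp add: field_simps)
  hence "real ((n-2) choose (k-2)) / real (n choose k) = real k * real (k-1) / (real n * real (n-1))"
    using 3 assms by (simp add: field_simps)
  \<comment> \<open>The exact value has \<open>n (n - 1)\<close> in the denominator;
    \<open>n - 1 \<ge> n / 2\<close> is the source of the factor 2.\<close>
  also have "\<dots> \<le> (real k)\<^sup>2 / (real n * (real n / 2))"
    unfolding power2_eq_square using assms by (intro frac_le mult_mono) auto
  finally show ?thesis unfolding eq by (simp add: power2_eq_square mult_ac)
qed

text \<open>The ratio of binomials is a ratio of falling factorials. Each of the \<open>k\<close>
  factors above is at least \<open>l - k\<close>, which is at least half of
  \<open>l \<ge> n / r\<close> since \<open>l \<ge> 2 k\<close>, and each factor below is at most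
  \<open>n\<close>.\<close>

lemma prob_ksubsets_subset:
  assumes "k \<le> n" "L \<subseteq> {..<n}" "2 * r * k \<le> n" "n \<le> r * card L" "r > 0"
  shows "(1 / (2 * real r)) ^ k \<le> measure_pmf.prob (pmf_of_set (ksubsets k n)) {J. J \<subseteq> L}"
proof -
  have finL: "finite L" using assms finite_subset by blast
  define l where "l = card L"
  have ln: "l \<le> n" unfolding l_def using card_mono[OF _ assms(2)] by simp
  have nl: "real n \<le> real r * real l" using assms(4) unfolding l_def by (metis of_nat_le_iff of_nat_mult)
  have nk: "2 * real r * real k \<le> real n" using assms(3) by (metis of_nat_le_iff of_nat_mult of_nat_numeral)
  have "2 * real r * real k \<le> real r * real l" using nl nk by linarith
  hence kl: "2 * real k \<le> real l" using assms(5) by (simp add: mult.assoc mult.left_commute[of 2])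
  have *: "real n / (2 * real r) \<le> real l - real k"
  proof -
    have "real n \<le> real r * real l" by fact
    also have "\<dots> \<le> real r * (2 * (real l - real k))" by (rule mult_left_mono) (use kl in auto)
    finally show ?thesis using assms(5) by (simp add: field_simps)
  qed
  have "ksubsets k n \<inter> {J. J \<subseteq> L} = {J. J \<subseteq> L \<and> card J = k}"
    using assms(2) by (auto simp: ksubsets_def)
  hence eq: "measure_pmf.prob (pmf_of_set (ksubsets k n)) {J. J \<subseteq> L} = real (l choose k) / real (n choose k)"
    using assms finL by (simp add: measure_pmf_of_set ksubsets_nonempty card_ksubsets n_subsets l_def)
  have "(1 / (2 * real r)) ^ k * real (n choose k) \<le> real (l choose k)"
  proof -
    have "real (n choose k) * fact k \<le> real n ^ k"
      using binomial_fact_pow[of n k] by (metis of_nat_fact of_nat_le_iff of_nat_mult of_nat_power)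
    hence "(1 / (2 * real r)) ^ k * (real (n choose k) * fact k) \<le> (1 / (2 * real r)) ^ k * real n ^ k"
      by (intro mult_left_mono) auto
    also have "\<dots> = (real n / (2 * real r)) ^ k" by (simp add: power_mult_distrib[symmetric])
    also have "\<dots> \<le> (real l - real k) ^ k" by (rule power_mono[OF *]) simp
    also have "\<dots> = (\<Prod>i = 0..<k. real l - real k)" by simp
    also have "\<dots> \<le> (\<Prod>i = 0..<k. real l - real i)" using kl by (intro prod_mono) auto
    also have "\<dots> = real (l choose k) * fact k"
      by (simp add: binomial_gbinomial gbinomial_prod_rev)
    finally have "((1 / (2 * real r)) ^ k * real (n choose k)) * fact k \<le> real (l choose k) * fact k"
      by (simp only: mult.assoc)
    thus ?thesis by (rule mult_right_le_imp_le) simp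
  qed
  moreover have "real (n choose k) > 0" using assms by (simp add: zero_less_binomial)
  ultimately show ?thesis unfolding eq by (subst pos_le_divide_eq)
qed

section \<open>Trees and components of factor graphs\<close>

text \<open>The forest bound on the number of edges; a symmetric relation contains every edge twice,
  hence the factor 2. The first vertex of a longest path has degree at most 1: a neighbour off the
  path would extend it, and one further along would close a cycle. That vertex is removed.\<close>

lemma acyclic_card_edges:
  fixes E :: "'a rel"
  assumes "finite W" "W \<noteq> {}" "E \<subseteq> W \<times> W" "sym E" "\<And>x. (x, x) \<notin> E"
    and "\<And>p. \<lbrakk>length p \<ge> 3; distinct p; \<And>i. Suc i < length p \<Longrightarrow> (p ! i, p ! Suc i) \<in> E;
               (last p, hd p) \<in> E\<rbrakk> \<Longrightarrow> False"
  shows "card E + 2 \<le> 2 * card W"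
  using assms
proof (induction "card W" arbitrary: W E rule: less_induct)
  case less
  note W = less.prems(1,2) and E = less.prems(3) and symE = less.prems(4)
    and irr = less.prems(5) and nocyc = less.prems(6)
  define path where "path p \<longleftrightarrow> p \<noteq> [] \<and> distinct p \<and> set p \<subseteq> W \<and>
    (\<forall>i. Suc i < length p \<longrightarrow> (p ! i, p ! Suc i) \<in> E)" for p
  obtain w where "w \<in> W" using W by auto
  hence "path [w]" by (auto simp: path_def)
  moreover have "\<forall>p. path p \<longrightarrow> length p < Suc (card W)"
    using W(1) by (auto simp: path_def less_Suc_eq_le distinct_card[symmetric] intro!: card_mono)
  ultimately obtain p where p: "path p" and max: "\<And>q. path q \<Longrightarrow> length q \<le> length p"
    using ex_has_greatest_nat[of path "[w]" length] by blast
  define x where "x = hd p"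
  have pne: "p \<noteq> []" and dp: "distinct p" and pE: "\<And>i. Suc i < length p \<Longrightarrow> (p ! i, p ! Suc i) \<in> E"
    and pW: "set p \<subseteq> W" using p by (auto simp: path_def)
  have x0: "x = p ! 0" using pne by (simp add: x_def hd_conv_nth)
  have xW: "x \<in> W" using pne pW by (auto simp: x_def)
  have nbr: "y = p ! 1" if xy: "(x, y) \<in> E" for y
  proof -
    have yW: "y \<in> W" using E xy by auto
    have yx: "(y, x) \<in> E" using symE xy by (auto dest: symD)
    have "y \<in> set p"
    proof (rule ccontr)
      assume "y \<notin> set p"
      hence "path (y # p)" using p yW yx x0 unfolding path_def
        by (auto simp: nth_Cons split: nat.splits)
      from max[OF this] show False by simp
    qed
    then obtain j where j: "j < length p" "y = p ! j" by (auto simp: in_set_conv_nth)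
    have "j \<noteq> 0" using j x0 irr xy by (metis)
    moreover have "\<not> j \<ge> 2"
    proof
      assume "j \<ge> 2"
      let ?q = "take (Suc j) p"
      show False
      proof (rule nocyc[of ?q])
        show "(?q ! i, ?q ! Suc i) \<in> E" if "Suc i < length ?q" for i using that pE j by auto
        have "last ?q = y" using j by (simp add: take_Suc_conv_app_nth)
        moreover have "hd ?q = x" using pne by (simp add: x_def hd_take)
        ultimately show "(last ?q, hd ?q) \<in> E" using yx by simp
      qed (use j dp \<open>j \<ge> 2\<close> in auto)
    qed
    ultimately have "j = 1" by linarith
    thus ?thesis using j by simp
  qed
  define E' where "E' = E \<inter> (W - {x}) \<times> (W - {x})"
  have finE: "finite E" using E W(1) finite_subset by blast
  \<comment> \<open>If the path is a single vertex, \<open>p ! 1\<close> is unspecified, but then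
    \<open>x\<close> has no neighbour and the inclusion still holds.\<close>
  have sub: "E \<subseteq> E' \<union> {(x, p ! 1), (p ! 1, x)}"
    using nbr E symE unfolding E'_def by (auto dest: symD)
  show ?case
  proof (cases "W = {x}")
    case True
    hence "E = {}" using E irr by auto
    thus ?thesis using True by simp
  next
    case False
    have "card E \<le> card (E' \<union> {(x, p ! 1), (p ! 1, x)})"
      by (rule card_mono[OF _ sub]) (use finE in \<open>auto simp: E'_def\<close>)
    also have "\<dots> \<le> card E' + card {(x, p ! 1), (p ! 1, x)}" by (rule card_Un_le)
    also have "card {(x, p ! 1), (p ! 1, x)} \<le> 2" by (simp add: card_insert_le_m1)
    finally have "card E \<le> card E' + 2" by simp
    moreover have "card E' + 2 \<le> 2 * card (W - {x})"
    proof (rule less.hyps)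
      show "card (W - {x}) < card W" by (rule card_Diff1_less[OF W(1) xW])
      show "W - {x} \<noteq> {}" using False xW by auto
      show "sym E'" using symE by (auto simp: sym_def E'_def)
      show False if "length q \<ge> 3" "distinct q" "\<And>i. Suc i < length q \<Longrightarrow> (q ! i, q ! Suc i) \<in> E'"
        "(last q, hd q) \<in> E'" for q
        using nocyc[of q] that by (auto simp: E'_def)
    qed (use W irr in \<open>auto simp: E'_def\<close>)
    moreover have "card (W - {x}) + 1 = card W" using W xW by (metis Suc_eq_plus1 card_Suc_Diff1)
    ultimately show ?thesis by linarith
  qed
qed

lemma sym_fg_adj: "sym (fg_adj F)"
  by (auto simp: sym_def fg_adj_def)

text \<open>The forest bound for a bipartite graph with \<open>k |C|\<close> edges. It supplies the
  exponent \<open>s - 1\<close> in the lower bound for copies of a tree.\<close>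

lemma unsat_tree_card_vars:
  assumes "T \<in> unsat_trees k P Q"
  shows "constrs T \<noteq> {}" "k * card (constrs T) + 1 \<le> card (constrs T) + card (vars T)"
proof -
  have T: "factor_graph k T" "fg_acyclic T" "\<not> fg_satisfiable T"
    using assms by (auto simp: unsat_trees_def)
  show ne: "constrs T \<noteq> {}" using T(3) by (auto simp: fg_satisfiable_def)
  have fin: "finite (constrs T)" "finite (vars T)" and sub: "edges T \<subseteq> constrs T \<times> vars T"
    and deg: "\<forall>c\<in>constrs T. card (nbhd T c) = k" using T(1) by (auto simp: factor_graph_def)
  have finE: "finite (edges T)" using fin sub finite_subset by blast
  have "edges T = Sigma (constrs T) (nbhd T)" using sub by (auto simp: nbhd_def)
  moreover have "finite (nbhd T c)" for c
    by (rule finite_subset[of _ "vars T"]) (use fin sub in \<open>auto simp: nbhd_def\<close>)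
  ultimately have cE: "card (edges T) = k * card (constrs T)" using fin deg by simp
  let ?A = "(\<lambda>(c, v). (Inl c, Inr v)) ` edges T :: (nat + nat) rel"
  let ?B = "(\<lambda>(c, v). (Inr v, Inl c)) ` edges T :: (nat + nat) rel"
  have adj: "fg_adj T = ?A \<union> ?B" by (fastforce simp: fg_adj_def)
  have "card (fg_adj T) = card ?A + card ?B"
    unfolding adj by (rule card_Un_disjoint) (use finE in auto)
  also have "card ?A = card (edges T)" by (rule card_image) (auto simp: inj_on_def)
  also have "card ?B = card (edges T)" by (rule card_image) (auto simp: inj_on_def)
  finally have cA: "card (fg_adj T) = 2 * (k * card (constrs T))" by (simp add: cE)
  have "card (fg_verts T) = card (Inl ` constrs T :: (nat + nat) set) + card (Inr ` vars T :: (nat + nat) set)"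
    unfolding fg_verts_def by (rule card_Un_disjoint) (use fin in auto)
  hence cV: "card (fg_verts T) = card (constrs T) + card (vars T)" by (simp add: card_image)
  have "card (fg_adj T) + 2 \<le> 2 * card (fg_verts T)"
  proof (rule acyclic_card_edges[OF _ _ _ sym_fg_adj])
    show "finite (fg_verts T)" using fin by (simp add: fg_verts_def)
    show "fg_verts T \<noteq> {}" using ne by (simp add: fg_verts_def)
    show "fg_adj T \<subseteq> fg_verts T \<times> fg_verts T" using sub by (auto simp: fg_adj_def fg_verts_def)
    show "(x, x) \<notin> fg_adj T" for x by (auto simp: fg_adj_def)
    show False if "length p \<ge> 3" "distinct p" "\<And>i. Suc i < length p \<Longrightarrow> (p ! i, p ! Suc i) \<in> fg_adj T"
        "(last p, hd p) \<in> fg_adj T" for p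
      using that T(2) unfolding fg_acyclic_def fg_cycle_def by blast
  qed
  thus "k * card (constrs T) + 1 \<le> card (constrs T) + card (vars T)" unfolding cA cV by simp
qed

section \<open>Connected sets of rows\<close>

definition row_adj :: "(nat \<Rightarrow> nat set) \<Rightarrow> nat set \<Rightarrow> nat rel" where
  "row_adj J U = {(a, b). a \<in> U \<and> b \<in> U \<and> J a \<inter> J b \<noteq> {}}"

definition conn :: "(nat \<Rightarrow> nat set) \<Rightarrow> nat set \<Rightarrow> bool" where
  "conn J U \<longleftrightarrow> (\<forall>a\<in>U. \<forall>b\<in>U. (a, b) \<in> (row_adj J U)\<^sup>*)"

text \<open>Read from its end, the list is an order of exposure in which each new row meets a column
  already seen. This is the form of connectivity whose probability can be bounded row by
  row.\<close>

fun linked :: "(nat \<Rightarrow> nat set) \<Rightarrow> nat list \<Rightarrow> bool" where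
  "linked J [] \<longleftrightarrow> True"
| "linked J (a # l) \<longleftrightarrow> (l = [] \<or> J a \<inter> (\<Union>b\<in>set l. J b) \<noteq> {}) \<and> linked J l"

lemma sym_row_adj: "sym (row_adj J U)"
  by (auto simp: sym_def row_adj_def)

lemma row_adj_mono: "U \<subseteq> U' \<Longrightarrow> row_adj J U \<subseteq> row_adj J U'"
  by (auto simp: row_adj_def)

lemma connI:
  assumes "\<And>b. b \<in> U \<Longrightarrow> (a, b) \<in> (row_adj J U)\<^sup>*"
  shows "conn J U"
  unfolding conn_def
proof (intro ballI)
  fix b c assume "b \<in> U" "c \<in> U"
  hence "(a, b) \<in> (row_adj J U)\<^sup>*" "(a, c) \<in> (row_adj J U)\<^sup>*" using assms by auto
  moreover have "sym ((row_adj J U)\<^sup>*)" by (rule sym_rtrancl[OF sym_row_adj])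
  ultimately show "(b, c) \<in> (row_adj J U)\<^sup>*" by (metis rtrancl_trans symD)
qed

lemma conn_Un:
  assumes "conn J U" "conn J V" "U \<inter> V \<noteq> {}"
  shows "conn J (U \<union> V)"
proof -
  obtain a where a: "a \<in> U" "a \<in> V" using assms(3) by auto
  show ?thesis
  proof (rule connI)
    fix b assume "b \<in> U \<union> V"
    hence "(a, b) \<in> (row_adj J U)\<^sup>* \<or> (a, b) \<in> (row_adj J V)\<^sup>*"
      using assms a by (auto simp: conn_def)
    thus "(a, b) \<in> (row_adj J (U \<union> V))\<^sup>*"
      by (metis row_adj_mono rtrancl_mono subsetD sup_ge1 sup_ge2)
  qed
qed

text \<open>A list not yet exhausting \<open>U\<close> can be prolonged, since a path inside
  \<open>U\<close> to a row off the list must leave the list somewhere. Any length up to the size of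
  \<open>U\<close> is reached, so large connected sets reduce to lists of a fixed length.\<close>

lemma conn_obtain_linked:
  assumes "finite U" "conn J U" "t \<le> card U"
  shows "\<exists>l. distinct l \<and> linked J l \<and> set l \<subseteq> U \<and> length l = t"
  using assms(3)
proof (induction t)
  case (Suc t)
  then obtain l where l: "distinct l" "linked J l" "set l \<subseteq> U" "length l = t" by auto
  have "card (set l) < card U" using Suc.prems l by (simp add: distinct_card)
  then obtain b0 where b0: "b0 \<in> U" "b0 \<notin> set l"
    using card_mono[of "set l" U] by (metis List.finite_set not_le subsetI)
  show ?case
  proof (cases "l = []")
    case True
    hence "distinct [b0] \<and> linked J [b0] \<and> set [b0] \<subseteq> U \<and> length [b0] = Suc t" using b0 l by auto
    thus ?thesis by blast
  next
    case False
    then obtain a where a: "a \<in> set l" by (cases l) auto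
    have "\<exists>b\<in>U - set l. \<exists>c\<in>set l. J b \<inter> J c \<noteq> {}"
    proof (rule ccontr)
      assume no: "\<not> ?thesis"
      have "(a, b0) \<in> (row_adj J U)\<^sup>*" using assms(2) a b0 l by (auto simp: conn_def)
      hence "b0 \<in> set l"
      proof (induction rule: rtrancl_induct)
        case (step y z)
        thus ?case using no unfolding row_adj_def by blast
      qed (rule a)
      thus False using b0 by simp
    qed
    then obtain b where b: "b \<in> U" "b \<notin> set l" "J b \<inter> (\<Union>c\<in>set l. J c) \<noteq> {}" by blast
    have "distinct (b # l) \<and> linked J (b # l) \<and> set (b # l) \<subseteq> U \<and> length (b # l) = Suc t"
      using b l by auto
    thus ?thesis by blast
  qed
qed auto

text \<open>Row \<open>a\<close> is a triple of column set, coefficient tuple and right-hand side.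
  Edges come from the column set and not from nonzero entries, so that degrees remain
  \<open>k\<close> even if 0 is in the support of \<open>P\<close>.\<close>

definition fgraph :: "nat \<Rightarrow> (nat \<Rightarrow> nat set \<times> (nat \<Rightarrow> 'r) \<times> 'r) \<Rightarrow> nat set \<Rightarrow> 'r::comm_ring_1 wfactor_graph" where
  "fgraph k w U = \<lparr>constrs = U, vars = (\<Union>a\<in>U. fst (w a)), edges = {(a, v). a \<in> U \<and> v \<in> fst (w a)},
     edge_weight = (\<lambda>a. place_row k (fst (w a)) (fst (snd (w a)))),
     constr_weight = (\<lambda>a. snd (snd (w a)))\<rparr>"

lemma fgraph_sel [simp]:
  "constrs (fgraph k w U) = U" "vars (fgraph k w U) = (\<Union>a\<in>U. fst (w a))"
  "edges (fgraph k w U) = {(a, v). a \<in> U \<and> v \<in> fst (w a)}"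
  "edge_weight (fgraph k w U) = (\<lambda>a. place_row k (fst (w a)) (fst (snd (w a))))"
  "constr_weight (fgraph k w U) = (\<lambda>a. snd (snd (w a)))"
  by (simp_all add: fgraph_def)

lemma nbhd_fgraph: "a \<in> U \<Longrightarrow> nbhd (fgraph k w U) a = fst (w a)"
  by (auto simp: nbhd_def)

lemma fg_satisfiable_fgraph:
  "fg_satisfiable (fgraph k w U) \<longleftrightarrow>
     (\<exists>x. \<forall>a\<in>U. (\<Sum>v\<in>fst (w a). place_row k (fst (w a)) (fst (snd (w a))) v * x v) = snd (snd (w a)))"
  by (simp add: fg_satisfiable_def nbhd_fgraph)

lemma place_row_nth:
  assumes "finite J" "card J = k" "i < k"
  shows "place_row k J s (sorted_list_of_set J ! i) = s i"
proof -
  have "place_row k J s (sorted_list_of_set J ! i) = (\<Sum>j<k. if i = j then s j else 0)"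
    unfolding place_row_def using assms
    by (intro sum.cong) (auto simp: nth_eq_iff_index_eq)
  also have "\<dots> = s i" using assms by simp
  finally show ?thesis .
qed

lemma place_row_outside:
  assumes "finite J" "card J = k" "v \<notin> J"
  shows "place_row k J s v = 0"
  unfolding place_row_def using assms
  by (intro sum.neutral) (auto, metis nth_mem length_sorted_list_of_set set_sorted_list_of_set)

lemma obtain_sorted_index:
  assumes "finite J" "card J = k" "v \<in> J"
  obtains i where "i < k" "v = sorted_list_of_set J ! i"
  using assms by (metis in_set_conv_nth length_sorted_list_of_set set_sorted_list_of_set)

lemma fg_adj_fgraph_mono: "K \<subseteq> U \<Longrightarrow> fg_adj (fgraph k w K) \<subseteq> fg_adj (fgraph k w U)"
  by (auto simp: fg_adj_def)

lemma fg_acyclic_mono: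
  assumes "fg_adj F \<subseteq> fg_adj G" "fg_acyclic G"
  shows "fg_acyclic F"
  using assms unfolding fg_acyclic_def fg_cycle_def by blast

text \<open>Different components share no variable, so solutions of all components could be glued to
  a solution of the whole.\<close>

lemma obtain_unsat_component:
  assumes "\<not> fg_satisfiable (fgraph k w U)"
  obtains K where "K \<subseteq> U" "conn (\<lambda>a. fst (w a)) K" "\<not> fg_satisfiable (fgraph k w K)"
proof -
  define J where "J = (\<lambda>a. fst (w a))"
  define comp where "comp a = (row_adj J U)\<^sup>* `` {a}" for a
  have compU: "comp a \<subseteq> U" if "a \<in> U" for a
  proof
    fix b assume "b \<in> comp a"
    hence "(a, b) \<in> (row_adj J U)\<^sup>*" by (simp add: comp_def)
    thus "b \<in> U" using that by (induction rule: rtrancl_induct) (auto simp: row_adj_def)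
  qed
  have conn_comp: "conn J (comp a)" for a
  proof (rule connI[of _ a])
    fix b assume "b \<in> comp a"
    hence "(a, b) \<in> (row_adj J U)\<^sup>*" by (simp add: comp_def)
    thus "(a, b) \<in> (row_adj J (comp a))\<^sup>*"
    proof (induction rule: rtrancl_induct)
      case (step y z)
      have "y \<in> comp a" "z \<in> comp a" using step by (auto simp: comp_def)
      hence "(y, z) \<in> row_adj J (comp a)" using step by (auto simp: row_adj_def)
      thus ?case using step by auto
    qed simp
  qed
  have "\<exists>a\<in>U. \<not> fg_satisfiable (fgraph k w (comp a))"
  proof (rule ccontr)
    assume "\<not> ?thesis"
    hence sat: "\<exists>x. \<forall>b\<in>comp a. (\<Sum>v\<in>J b. place_row k (J b) (fst (snd (w b))) v * x v) = snd (snd (w b))"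
      if "a \<in> U" for a using that by (simp add: fg_satisfiable_fgraph J_def)
    \<comment> \<open>The chosen solution is a function of the component itself, so that rows of the
      same component use the same one.\<close>
    define X where "X K = (SOME x. \<forall>b\<in>K. (\<Sum>v\<in>J b. place_row k (J b) (fst (snd (w b))) v * x v) = snd (snd (w b)))" for K
    have X: "(\<Sum>v\<in>J a. place_row k (J a) (fst (snd (w a))) v * X (comp a) v) = snd (snd (w a))" if "a \<in> U" for a
      using someI_ex[OF sat[OF that]] unfolding X_def by (auto simp: comp_def)
    \<comment> \<open>A variable takes its value from the component of some row containing it; all
      such rows lie in the same component, so the choice does not matter.\<close>
    define x where "x v = X (comp (SOME a. a \<in> U \<and> v \<in> J a)) v" for v
    have xX: "x v = X (comp a) v" if "a \<in> U" "v \<in> J a" for a v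
    proof -
      define b where "b = (SOME a. a \<in> U \<and> v \<in> J a)"
      have b: "b \<in> U" "v \<in> J b" using someI[of "\<lambda>a. a \<in> U \<and> v \<in> J a" a] that by (auto simp: b_def)
      have "(a, b) \<in> (row_adj J U)\<^sup>*" "(b, a) \<in> (row_adj J U)\<^sup>*"
        using b that by (auto simp: row_adj_def intro!: r_into_rtrancl)
      hence "comp a = comp b" unfolding comp_def by (auto intro: rtrancl_trans)
      thus ?thesis by (simp add: x_def b_def)
    qed
    have "fg_satisfiable (fgraph k w U)"
      unfolding fg_satisfiable_fgraph
    proof (intro exI[of _ x] ballI)
      fix a assume a: "a \<in> U"
      show "(\<Sum>v\<in>fst (w a). place_row k (fst (w a)) (fst (snd (w a))) v * x v) = snd (snd (w a))"
        unfolding X[OF a, symmetric] J_def using xX[OF a] by (intro sum.cong) (auto simp: J_def)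
    qed
    thus False using assms by simp
  qed
  thus ?thesis using that compU conn_comp unfolding J_def by blast
qed

text \<open>Only columns that occur in a row count as variables, so there are no isolated ones and
  every vertex is at distance at most 1 from a row.\<close>

lemma conn_fg_connected:
  assumes "conn (\<lambda>a. fst (w a)) K"
  shows "fg_connected (fgraph k w K)"
proof -
  let ?J = "\<lambda>a. fst (w a)" and ?E = "fg_adj (fgraph k w K)"
  have cc: "(Inl a, Inl b) \<in> ?E\<^sup>*" if "a \<in> K" "b \<in> K" for a b
  proof -
    have "(a, b) \<in> (row_adj ?J K)\<^sup>*" using assms that by (auto simp: conn_def)
    thus ?thesis
    proof (induction rule: rtrancl_induct)
      case (step y z)
      then obtain v where "v \<in> ?J y" "v \<in> ?J z" "y \<in> K" "z \<in> K" by (auto simp: row_adj_def)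
      hence "(Inl y, Inr v) \<in> ?E" "(Inr v, Inl z) \<in> ?E" by (auto simp: fg_adj_def)
      thus ?case using step.IH by (meson rtrancl.rtrancl_into_rtrancl)
    qed simp
  qed
  have near: "\<exists>a\<in>K. (x, Inl a) \<in> ?E\<^sup>* \<and> (Inl a, x) \<in> ?E\<^sup>*" if x: "x \<in> fg_verts (fgraph k w K)" for x
  proof (cases x)
    case (Inl a)
    thus ?thesis using x by (auto simp: fg_verts_def)
  next
    case (Inr v)
    then obtain a where "a \<in> K" "v \<in> ?J a" using x by (auto simp: fg_verts_def)
    hence "(Inl a, Inr v) \<in> ?E" "(Inr v, Inl a) \<in> ?E" by (auto simp: fg_adj_def)
    thus ?thesis using \<open>a \<in> K\<close> Inr by blast
  qed
  show ?thesis unfolding fg_connected_def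
  proof (intro ballI)
    fix x y assume "x \<in> fg_verts (fgraph k w K)" "y \<in> fg_verts (fgraph k w K)"
    then obtain a b where "a \<in> K" "b \<in> K" "(x, Inl a) \<in> ?E\<^sup>*" "(Inl b, y) \<in> ?E\<^sup>*" using near by meson
    thus "(x, y) \<in> ?E\<^sup>*" using cc by (meson rtrancl_trans)
  qed
qed

lemma obtain_unsat_tree:
  assumes unsat: "\<not> fg_satisfiable (fgraph k w U)" and acyc: "fg_acyclic (fgraph k w U)"
    and fin: "finite U" "\<And>a. a \<in> U \<Longrightarrow> finite (fst (w a))" "\<And>a. a \<in> U \<Longrightarrow> card (fst (w a)) = k"
    and P: "\<And>a i. a \<in> U \<Longrightarrow> i < k \<Longrightarrow> fst (snd (w a)) i \<in> set_pmf P"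
    and Q: "\<And>a. a \<in> U \<Longrightarrow> snd (snd (w a)) \<in> set_pmf Q"
  obtains K where "K \<subseteq> U" "conn (\<lambda>a. fst (w a)) K" "fgraph k w K \<in> unsat_trees k P Q"
proof -
  obtain K where K: "K \<subseteq> U" "conn (\<lambda>a. fst (w a)) K" "\<not> fg_satisfiable (fgraph k w K)"
    using obtain_unsat_component[OF unsat] by blast
  have "factor_graph k (fgraph k w K)"
    unfolding factor_graph_def using K fin finite_subset[OF K(1) fin(1)] by (auto simp: nbhd_fgraph)
  moreover have "fg_connected (fgraph k w K)" by (rule conn_fg_connected[OF K(2)])
  moreover have "fg_acyclic (fgraph k w K)"
    by (rule fg_acyclic_mono[OF fg_adj_fgraph_mono[OF K(1)] acyc])
  moreover have "place_row k (fst (w a)) (fst (snd (w a))) v \<in> set_pmf P" if av: "a \<in> K" "v \<in> fst (w a)" for a v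
  proof -
    have a: "a \<in> U" using K av by auto
    obtain i where "i < k" "v = sorted_list_of_set (fst (w a)) ! i"
      using obtain_sorted_index[OF fin(2,3)[OF a] av(2)] by blast
    thus ?thesis using P[OF a] by (simp add: place_row_nth[OF fin(2,3)[OF a]])
  qed
  ultimately have "fgraph k w K \<in> unsat_trees k P Q"
    using K Q unfolding unsat_trees_def by auto
  thus ?thesis using that K by blast
qed

text \<open>A cycle alternates between variables and rows. Rotated so as to begin with a variable,
  it has its variables at the even and its rows at the odd positions; indices modulo
  \<open>l\<close> absorb the closing edge.\<close>

lemma fg_cycle_fgraph_obtain:
  assumes "fg_cycle (fgraph k w U) p"
  obtains l as vs where "l \<ge> 2" "length as = l" "length vs = l" "distinct as" "distinct vs" "set as \<subseteq> U"
    "set vs \<subseteq> (\<Union>a\<in>U. fst (w a))"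
    "\<And>i. i < l \<Longrightarrow> vs ! i \<in> fst (w (as ! i)) \<and> vs ! (Suc i mod l) \<in> fst (w (as ! i))"
proof -
  let ?E = "fg_adj (fgraph k w U)"
  define cyc where "cyc p \<longleftrightarrow> length p \<ge> 3 \<and> distinct p \<and>
    (\<forall>i<length p. (p ! i, p ! (Suc i mod length p)) \<in> ?E)" for p
  have "cyc p"
    unfolding cyc_def
  proof (intro conjI allI impI)
    fix i assume "i < length p"
    show "(p ! i, p ! (Suc i mod length p)) \<in> ?E"
    proof (cases "Suc i < length p")
      case True
      thus ?thesis using assms by (auto simp: fg_cycle_def)
    next
      case False
      hence "Suc i = length p" using \<open>i < length p\<close> by simp
      moreover from this have "last p = p ! i" "hd p = p ! 0"
        by (metis diff_Suc_1 last_conv_nth length_0_conv nat.distinct(1), metis hd_conv_nth length_0_conv nat.distinct(1))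
      ultimately show ?thesis using assms by (simp add: fg_cycle_def)
    qed
  qed (use assms in \<open>auto simp: fg_cycle_def\<close>)
  have rot: "cyc (rotate1 q)" if "cyc q" for q
    unfolding cyc_def
  proof (intro conjI allI impI)
    fix i assume "i < length (rotate1 q)"
    hence i: "i < length q" "Suc i mod length q < length q" by (simp, intro mod_less_divisor) auto
    hence "rotate1 q ! i = q ! (Suc i mod length q)"
      "rotate1 q ! (Suc i mod length (rotate1 q)) = q ! (Suc (Suc i mod length q) mod length q)"
      using nth_rotate1[OF i(1)] nth_rotate1[OF i(2)] by simp_all
    moreover note i
    ultimately show "(rotate1 q ! i, rotate1 q ! (Suc i mod length (rotate1 q))) \<in> ?E"
      using that by (simp add: cyc_def)
  qed (use that in \<open>auto simp: cyc_def\<close>)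
  have alt: "isl x \<longleftrightarrow> \<not> isl y" if "(x, y) \<in> ?E" for x y using that by (auto simp: fg_adj_def)
  have "\<exists>q. cyc q \<and> \<not> isl (q ! 0)"
  proof (cases "isl (p ! 0)")
    case True
    have "length p \<ge> 3" using \<open>cyc p\<close> by (simp add: cyc_def)
    hence "Suc 0 mod length p = 1" "0 < length p" by auto
    hence "(p ! 0, p ! 1) \<in> ?E" "rotate1 p ! 0 = p ! 1"
      using \<open>cyc p\<close> nth_rotate1[of 0 p] unfolding cyc_def by (metis, metis)
    hence "\<not> isl (rotate1 p ! 0)" using True alt by auto
    thus ?thesis using rot[OF \<open>cyc p\<close>] by blast
  next
    case False
    thus ?thesis using \<open>cyc p\<close> by blast
  qed
  then obtain q where q: "cyc q" "\<not> isl (q ! 0)" by blast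
  define L where "L = length q"
  have L3: "L \<ge> 3" and dq: "distinct q" and qE: "\<And>i. i < L \<Longrightarrow> (q ! i, q ! (Suc i mod L)) \<in> ?E"
    using q by (auto simp: cyc_def L_def)
  have par: "isl (q ! i) \<longleftrightarrow> odd i" if "i < L" for i
    using that
  proof (induction i)
    case (Suc i)
    thus ?case using alt[OF qE[of i]] by simp
  qed (use q in auto)
  \<comment> \<open>The last vertex is adjacent to the first, hence a row, so its index is odd and
    the length is even. With length at least 3 this gives \<open>l \<ge> 2\<close>.\<close>
  have "isl (q ! (L - 1))" using alt[OF qE[of "L - 1"]] q(2) L3 by simp
  hence "odd (L - 1)" using par[of "L - 1"] L3 by simp
  then obtain l where l: "L = 2 * l" using L3 by (metis dvd_def even_diff_nat odd_one odd_even_add le_trans one_le_numeral)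
  define as where "as = map (\<lambda>i. projl (q ! (2 * i + 1))) [0..<l]"
  define vs where "vs = map (\<lambda>i. projr (q ! (2 * i))) [0..<l]"
  have qa: "q ! (2 * i + 1) = Inl (as ! i)" and qv: "q ! (2 * i) = Inr (vs ! i)" if "i < l" for i
    using par[of "2 * i + 1"] par[of "2 * i"] that l by (auto simp: as_def vs_def)
  have e1: "vs ! i \<in> fst (w (as ! i)) \<and> as ! i \<in> U" if "i < l" for i
  proof -
    have "(q ! (2 * i), q ! (2 * i + 1)) \<in> ?E" using qE[of "2 * i"] that l by simp
    thus ?thesis unfolding qa[OF that] qv[OF that] by (auto simp: fg_adj_def)
  qed
  have e2: "vs ! (Suc i mod l) \<in> fst (w (as ! i))" if "i < l" for i
  proof -
    have "Suc (2 * i + 1) mod L = 2 * (Suc i mod l)" unfolding l by (simp add: mult_mod_right)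
    hence "(q ! (2 * i + 1), q ! (2 * (Suc i mod l))) \<in> ?E" using qE[of "2 * i + 1"] that l by simp
    moreover have "Suc i mod l < l" using that by (intro mod_less_divisor) auto
    ultimately show ?thesis unfolding qa[OF that] qv[OF \<open>Suc i mod l < l\<close>] by (auto simp: fg_adj_def)
  qed
  have inj: "i = j" if "q ! i = q ! j" "i < L" "j < L" for i j
    using that dq by (simp add: L_def nth_eq_iff_index_eq)
  show ?thesis
  proof (rule that[of l as vs])
    show "2 \<le> l" using L3 l by simp
    show la: "length as = l" and lv: "length vs = l" by (simp_all add: as_def vs_def)
    show "distinct as" unfolding distinct_conv_nth la
    proof (intro allI impI)
      fix i j assume "i < l" "j < l" "i \<noteq> j"
      thus "as ! i \<noteq> as ! j" using inj[of "2 * i + 1" "2 * j + 1"] qa[of i] qa[of j] l by auto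
    qed
    show "distinct vs" unfolding distinct_conv_nth lv
    proof (intro allI impI)
      fix i j assume "i < l" "j < l" "i \<noteq> j"
      thus "vs ! i \<noteq> vs ! j" using inj[of "2 * i" "2 * j"] qv[of i] qv[of j] l by auto
    qed
    show "set as \<subseteq> U" using e1 la by (auto simp: in_set_conv_nth)
    show "set vs \<subseteq> (\<Union>a\<in>U. fst (w a))" using e1 lv by (fastforce simp: in_set_conv_nth)
  qed (use e1 e2 in auto)
qed

section \<open>First moment bounds\<close>

lemma linked_cong: "(\<And>b. b \<in> set l \<Longrightarrow> J b = J' b) \<Longrightarrow> linked J l \<longleftrightarrow> linked J' l"
  by (induction l) auto

lemma conn_cong: 
  assumes "\<And>b. b \<in> U \<Longrightarrow> J b = J' b"
  shows "conn J U \<longleftrightarrow> conn J' U"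
proof -
  have "row_adj J U = row_adj J' U" using assms by (auto simp: row_adj_def)
  thus ?thesis by (simp add: conn_def)
qed

lemma geometric_tail_le:
  fixes r :: real
  assumes "0 \<le> r" "r \<le> 1/2"
  shows "(\<Sum>l=2..<M. r ^ l) \<le> 2 * r\<^sup>2"
proof -
  have "(1 - r) * (\<Sum>l=2..<2 + N. r ^ l) = r\<^sup>2 - r ^ (2 + N)" for N
  proof (induction N)
    case (Suc N)
    have "(\<Sum>l=2..<2 + Suc N. r ^ l) = (\<Sum>l=2..<2 + N. r ^ l) + r ^ (2 + N)"
      unfolding add_Suc_right by (rule sum.atLeastLessThan_Suc) simp
    thus ?case using Suc by (simp only: distrib_left) (simp add: algebra_simps)
  qed simp
  note geo = this[of "M - 2"]
  define S where "S = (\<Sum>l=2..<2 + (M - 2). r ^ l)"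
  have "(\<Sum>l=2..<M. r ^ l) \<le> S" unfolding S_def by (rule sum_mono2) (use assms in auto)
  moreover have "(1 - r) * S \<le> r\<^sup>2"
    using geo zero_le_power[OF assms(1), of "2 + (M - 2)"] unfolding S_def by linarith
  moreover have "0 \<le> S" unfolding S_def by (rule sum_nonneg) (use assms in auto)
  hence "1/2 * S \<le> (1 - r) * S" by (rule mult_right_mono[rotated]) (use assms in auto)
  ultimately show ?thesis by linarith
qed

locale random_system =
  fixes k m n :: nat and P Q :: "'r::{finite,comm_ring_1} pmf"
  assumes k2: "2 \<le> k" and kn: "k \<le> n"
begin

text \<open>This keeps the column set and the tuple separately instead of their image under
  \<open>place_row\<close>, from which columns with coefficient 0 cannot be recovered.\<close>

definition entry :: "(nat set \<times> (nat \<Rightarrow> 'r) \<times> 'r) pmf" where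
  "entry = pair_pmf (pmf_of_set (ksubsets k n)) (pair_pmf (product_dist k P) Q)"

definition rows :: "(nat \<Rightarrow> nat set \<times> (nat \<Rightarrow> 'r) \<times> 'r) pmf" where
  "rows = Pi_pmf {..<m} ({}, (\<lambda>_. 0), 0) (\<lambda>_. entry)"

abbreviation "Pr \<equiv> measure_pmf.prob rows"

abbreviation cols :: "(nat \<Rightarrow> nat set \<times> (nat \<Rightarrow> 'r) \<times> 'r) \<Rightarrow> nat \<Rightarrow> nat set" where
  "cols w \<equiv> \<lambda>a. fst (w a)"

lemma n_pos: "0 < n" using k2 kn by simp

lemma set_entry:
  assumes "y \<in> set_pmf entry"
  shows "fst y \<in> ksubsets k n" "\<And>i. i < k \<Longrightarrow> fst (snd y) i \<in> set_pmf P" "snd (snd y) \<in> set_pmf Q"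
  using assms by (auto simp: entry_def ksubsets_nonempty[OF kn] product_dist_def set_Pi_pmf PiE_dflt_def)

lemma set_rows:
  assumes "w \<in> set_pmf rows" "a < m"
  shows "fst (w a) \<subseteq> {..<n}" "card (fst (w a)) = k" "finite (fst (w a))"
    "\<And>i. i < k \<Longrightarrow> fst (snd (w a)) i \<in> set_pmf P" "snd (snd (w a)) \<in> set_pmf Q"
proof -
  have "w a \<in> set_pmf entry" using assms by (auto simp: rows_def set_Pi_pmf PiE_dflt_def)
  from set_entry[OF this] show "fst (w a) \<subseteq> {..<n}" "card (fst (w a)) = k"
    "\<And>i. i < k \<Longrightarrow> fst (snd (w a)) i \<in> set_pmf P" "snd (snd (w a)) \<in> set_pmf Q"
    by (auto simp: ksubsets_def)
  thus "finite (fst (w a))" using finite_subset by blast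
qed

lemma prob_entry_fst: "measure_pmf.prob entry {y. fst y \<in> X} = measure_pmf.prob (pmf_of_set (ksubsets k n)) X"
proof -
  have "{y. fst y \<in> X} = X \<times> (UNIV :: ((nat \<Rightarrow> 'r) \<times> 'r) set)" by auto
  thus ?thesis unfolding entry_def by (simp only: prob_pair_pmf_Times) simp
qed

lemma Pr_mono_AE: "(\<And>w. w \<in> set_pmf rows \<Longrightarrow> w \<in> A \<Longrightarrow> w \<in> B) \<Longrightarrow> Pr A \<le> Pr B"
  by (rule measure_pmf.finite_measure_mono_AE) (auto simp: AE_measure_pmf_iff)

text \<open>The given model is an image of \<open>rows\<close>, so that all events can be studied
  where the column sets are still visible.\<close>

lemma system_pmf_eq:
  "system_pmf k (product_dist k P) Q m n =
     map_pmf (\<lambda>w. (\<lambda>a. place_row k (fst (w a)) (fst (snd (w a))), \<lambda>a. snd (snd (w a)))) rows"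
proof -
  let ?R = "row_pmf k (product_dist k P) n"
  let ?h = "\<lambda>y. (place_row k (fst y) (fst (snd y)), snd (snd y))"
  let ?zip = "\<lambda>(f, g) x. (f x, g x)" and ?unzip = "\<lambda>u. (\<lambda>x. fst (u x), \<lambda>x. snd (u x))"
  have row: "pair_pmf ?R Q = map_pmf ?h entry"
    unfolding row_pmf_def entry_def ksubsets_def
    by (simp add: pair_pmf_def map_pmf_def bind_assoc_pmf bind_return_pmf)
  \<comment> \<open>The default row has an empty column set, whose sorted list has unspecified
    entries, but zero coefficients make its image the zero row whatever they are.\<close>
  have 0: "?h ({}, \<lambda>_. 0, 0) = (\<lambda>_. 0, 0)" by (simp add: place_row_def)
  have "system_pmf k (product_dist k P) Q m n =
      map_pmf ?unzip (map_pmf ?zip (system_pmf k (product_dist k P) Q m n))"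
    by (simp add: pmf.map_comp o_def case_prod_unfold)
  also have "map_pmf ?zip (system_pmf k (product_dist k P) Q m n) =
      Pi_pmf {..<m} (\<lambda>_. 0, 0) (\<lambda>_. map_pmf ?h entry)"
    unfolding system_pmf_def row[symmetric] by (subst Pi_pmf_pair) simp_all
  also have "\<dots> = map_pmf (\<lambda>w. ?h \<circ> w) rows"
    unfolding rows_def by (rule Pi_pmf_map) (use 0 in auto)
  finally show ?thesis by (simp add: pmf.map_comp o_def)
qed

lemma sat_prob_eq:
  "sat_prob k (product_dist k P) Q m n = Pr {w. fg_satisfiable (fgraph k w {..<m})}"
proof -
  have "sat_prob k (product_dist k P) Q m n =
    Pr {w. system_satisfiable m n (\<lambda>a. place_row k (fst (w a)) (fst (snd (w a)))) (\<lambda>a. snd (snd (w a)))}"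
    unfolding sat_prob_def system_pmf_eq by (simp add: vimage_def)
  also have "\<dots> = Pr {w. fg_satisfiable (fgraph k w {..<m})}"
  proof (rule measure_pmf.finite_measure_eq_AE, unfold AE_measure_pmf_iff, intro ballI)
    fix w assume w: "w \<in> set_pmf rows"
    have "(\<Sum>v<n. place_row k (fst (w a)) (fst (snd (w a))) v * x v) =
       (\<Sum>v\<in>fst (w a). place_row k (fst (w a)) (fst (snd (w a))) v * x v)" if "a < m" for a x
      by (rule sum.mono_neutral_right) (use set_rows(1)[OF w that] in \<open>auto simp: place_row_outside[OF set_rows(3,2)[OF w that]]\<close>)
    thus "(w \<in> {w. system_satisfiable m n (\<lambda>a. place_row k (fst (w a)) (fst (snd (w a)))) (\<lambda>a. snd (snd (w a)))}) =
         (w \<in> {w. fg_satisfiable (fgraph k w {..<m})})"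
      by (auto simp: system_satisfiable_def fg_satisfiable_fgraph)
  qed auto
  finally show ?thesis .
qed

lemma unsat_cases:
  assumes w: "w \<in> set_pmf rows" and "\<not> fg_satisfiable (fgraph k w {..<m})" "fg_acyclic (fgraph k w {..<m})"
  obtains K where "K \<subseteq> {..<m}" "conn (cols w) K" "fgraph k w K \<in> unsat_trees k P Q"
  using obtain_unsat_tree[OF assms(2,3), of P Q] set_rows[OF w] by auto

lemma prob_hit:
  assumes "finite U"
  shows "measure_pmf.prob entry {y. fst y \<inter> U \<noteq> {}} \<le> real k * real (card U) / real n"
proof -
  have "measure_pmf.prob entry {y. fst y \<inter> U \<noteq> {}} = measure_pmf.prob (pmf_of_set (ksubsets k n)) {J. J \<inter> U \<noteq> {}}"
    using prob_entry_fst[of "{J. J \<inter> U \<noteq> {}}"] by simp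
  also have "\<dots> \<le> measure_pmf.prob (pmf_of_set (ksubsets k n)) (\<Union>v\<in>U \<inter> {..<n}. {J. v \<in> J})"
  proof (rule measure_pmf.finite_measure_mono_AE, unfold AE_measure_pmf_iff, intro ballI impI)
    fix J assume "J \<in> set_pmf (pmf_of_set (ksubsets k n))" and J: "J \<in> {J. J \<inter> U \<noteq> {}}"
    hence "J \<in> ksubsets k n" by (simp add: ksubsets_nonempty[OF kn])
    thus "J \<in> (\<Union>v\<in>U \<inter> {..<n}. {J. v \<in> J})" using J by (auto simp: ksubsets_def)
  qed simp
  also have "\<dots> \<le> (\<Sum>v\<in>U \<inter> {..<n}. measure_pmf.prob (pmf_of_set (ksubsets k n)) {J. v \<in> J})"
    by (rule measure_UNION_le) auto
  also have "\<dots> = (\<Sum>v\<in>U \<inter> {..<n}. real k / real n)"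
    by (intro sum.cong refl prob_ksubsets_mem) (use k2 kn in auto)
  also have "\<dots> = real k * real (card (U \<inter> {..<n})) / real n" by simp
  also have "\<dots> \<le> real k * real (card U) / real n"
    by (intro divide_right_mono mult_left_mono) (use assms in \<open>auto intro!: card_mono\<close>)
  finally show ?thesis .
qed

text \<open>Rows are exposed from the end of the list. The new row must hit one of at most
  \<open>k s\<close> columns already seen, which has probability at most \<open>k (k s) / n\<close>;
  the row exposed before all others is free, hence the exponent.\<close>

lemma Pr_linked:
  assumes "distinct l" "set l \<subseteq> {..<m}" "l \<noteq> []" "length l \<le> s"
  shows "Pr {w. linked (cols w) l} \<le> ((real k)\<^sup>2 * real s / real n) ^ (length l - 1)"
  using assms
proof (induction l)
  case (Cons a l)
  let ?q = "(real k)\<^sup>2 * real s / real n"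
  show ?case
  proof (cases "l = []")
    case False
    have "Pr {w. linked (cols w) (a # l)} \<le> ?q * Pr {w. linked (cols w) l}"
      unfolding rows_def
    proof (rule prob_Pi_pmf_resample_le)
      fix f assume f: "f \<in> set_pmf (Pi_pmf {..<m} ({}, (\<lambda>_. 0), 0) (\<lambda>_. entry))"
      let ?U = "\<Union>b\<in>set l. fst (f b)"
      have upd: "fst ((f(a := y)) b) = fst (f b)" if "b \<in> set l" for b y using Cons.prems that by auto
      have lc: "linked (cols (f(a := y))) l \<longleftrightarrow> linked (cols f) l" for y
        by (rule linked_cong) (use upd in auto)
      have UU: "(\<Union>b\<in>set l. fst ((f(a := y)) b)) = ?U" for y using upd by auto
      have eq: "{y. f(a := y) \<in> {w. linked (cols w) (a # l)}} = (if linked (cols f) l then {y. fst y \<inter> ?U \<noteq> {}} else {})"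
        using lc UU False by (simp del: fun_upd_apply) (simp)
      show "measure_pmf.prob entry {y. f(a := y) \<in> {w. linked (cols w) (a # l)}}
          \<le> ?q * indicator {w. linked (cols w) l} f"
      proof (cases "linked (cols f) l")
        case True
        have fr: "f \<in> set_pmf rows" using f by (simp add: rows_def)
        have "finite ?U" using Cons.prems set_rows(3)[OF fr] by auto
        have "card ?U \<le> (\<Sum>b\<in>set l. card (fst (f b)))" by (rule card_UN_le) simp
        also have "\<dots> = (\<Sum>b\<in>set l. k)" by (rule sum.cong) (use Cons.prems set_rows(2)[OF fr] in auto)
        also have "\<dots> \<le> k * s" using Cons.prems by (simp add: distinct_card)
        finally have "real (card ?U) \<le> real k * real s" by (metis of_nat_le_iff of_nat_mult)
        hence "real k * real (card ?U) / real n \<le> real k * (real k * real s) / real n"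
          by (intro divide_right_mono mult_left_mono) auto
        with prob_hit[OF \<open>finite ?U\<close>] show ?thesis unfolding eq using True
          by (simp add: power2_eq_square mult.assoc)
      next
        case False
        thus ?thesis unfolding eq by simp
      qed
    qed (use Cons.prems in auto)
    also have "\<dots> \<le> ?q * ?q ^ (length l - 1)"
      using Cons False by (intro mult_left_mono) auto
    also have "\<dots> = ?q ^ (length (a # l) - 1)"
      using False by (cases l) auto
    finally show ?thesis .
  qed simp
qed simp

text \<open>A connected set can be ordered as a linked list, and it has at most \<open>s ^ s\<close>
  orderings.\<close>

lemma Pr_conn:
  assumes "U \<subseteq> {..<m}" "U \<noteq> {}" "card U \<le> s"
  shows "Pr {w. conn (cols w) U} \<le> real s ^ s * ((real k)\<^sup>2 * real s / real n) ^ (card U - 1)"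
proof -
  have fin: "finite U" using assms finite_subset by blast
  hence cU: "card U \<ge> 1" using assms by (simp add: Suc_leI card_gt_0_iff)
  let ?L = "{l. distinct l \<and> set l \<subseteq> U \<and> length l = card U}"
  have subL: "?L \<subseteq> {l. set l \<subseteq> U \<and> length l = card U}" by auto
  hence finL: "finite ?L" using finite_lists_length_eq[OF fin] finite_subset by blast
  have "card ?L \<le> card U ^ card U"
    using card_mono[OF finite_lists_length_eq[OF fin] subL] card_lists_length_eq[OF fin] by simp
  also have "\<dots> \<le> s ^ card U" using assms by (simp add: power_mono)
  also have "\<dots> \<le> s ^ s" using assms cU by (intro power_increasing) auto
  finally have cL: "real (card ?L) \<le> real s ^ s" by (metis of_nat_le_iff of_nat_power)
  have "Pr {w. conn (cols w) U} \<le> Pr (\<Union>l\<in>?L. {w. linked (cols w) l})"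
  proof (rule measure_pmf.finite_measure_mono)
    show "{w. conn (cols w) U} \<subseteq> (\<Union>l\<in>?L. {w. linked (cols w) l})"
      using conn_obtain_linked[OF fin _ order_refl] by fastforce
  qed simp
  also have "\<dots> \<le> (\<Sum>l\<in>?L. Pr {w. linked (cols w) l})"
    by (rule measure_UNION_le[OF finL]) simp
  also have "\<dots> \<le> (\<Sum>l\<in>?L. ((real k)\<^sup>2 * real s / real n) ^ (card U - 1))"
  proof (rule sum_mono)
    fix l assume l: "l \<in> ?L"
    hence "l \<noteq> []" using cU by auto
    with l show "Pr {w. linked (cols w) l} \<le> ((real k)\<^sup>2 * real s / real n) ^ (card U - 1)"
      using Pr_linked[of l s] assms by auto
  qed
  also have "\<dots> = real (card ?L) * ((real k)\<^sup>2 * real s / real n) ^ (card U - 1)" by simp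
  also have "\<dots> \<le> real s ^ s * ((real k)\<^sup>2 * real s / real n) ^ (card U - 1)"
    by (rule mult_right_mono[OF cL]) simp
  finally show ?thesis .
qed

text \<open>Every connected set of at least \<open>s\<close> rows contains a linked list of exactly
  \<open>s\<close>, so one union bound over lists of length \<open>s\<close> covers all larger sets
  as well.\<close>

lemma Pr_large_conn:
  assumes "s \<ge> 1"
  shows "Pr {w. \<exists>K\<subseteq>{..<m}. conn (cols w) K \<and> s \<le> card K}
           \<le> real m ^ s * ((real k)\<^sup>2 * real s / real n) ^ (s - 1)"
proof -
  let ?L = "{l. distinct l \<and> set l \<subseteq> {..<m} \<and> length l = s}"
  have subL: "?L \<subseteq> {l. set l \<subseteq> {..<m} \<and> length l = s}" by auto
  hence finL: "finite ?L" using finite_lists_length_eq[of "{..<m}"] finite_subset by blast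
  have "card ?L \<le> m ^ s"
    using card_mono[OF finite_lists_length_eq subL] card_lists_length_eq[of "{..<m}" s] by simp
  hence cL: "real (card ?L) \<le> real m ^ s" by (metis of_nat_le_iff of_nat_power)
  have "Pr {w. \<exists>K\<subseteq>{..<m}. conn (cols w) K \<and> s \<le> card K} \<le> Pr (\<Union>l\<in>?L. {w. linked (cols w) l})"
  proof (rule measure_pmf.finite_measure_mono)
    show "{w. \<exists>K\<subseteq>{..<m}. conn (cols w) K \<and> s \<le> card K} \<subseteq> (\<Union>l\<in>?L. {w. linked (cols w) l})"
    proof safe
      fix w K assume K: "K \<subseteq> {..<m}" "conn (cols w) K" "s \<le> card K"
      hence "finite K" using finite_subset by blast
      from conn_obtain_linked[OF this K(2,3)] K(1) show "w \<in> (\<Union>l\<in>?L. {w. linked (cols w) l})" by blast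
    qed
  qed simp
  also have "\<dots> \<le> (\<Sum>l\<in>?L. Pr {w. linked (cols w) l})"
    by (rule measure_UNION_le[OF finL]) simp
  also have "\<dots> \<le> (\<Sum>l\<in>?L. ((real k)\<^sup>2 * real s / real n) ^ (s - 1))"
  proof (rule sum_mono)
    fix l assume l: "l \<in> ?L"
    hence "l \<noteq> []" using assms by auto
    with l show "Pr {w. linked (cols w) l} \<le> ((real k)\<^sup>2 * real s / real n) ^ (s - 1)"
      using Pr_linked[of l s] by auto
  qed
  also have "\<dots> = real (card ?L) * ((real k)\<^sup>2 * real s / real n) ^ (s - 1)" by simp
  also have "\<dots> \<le> real m ^ s * ((real k)\<^sup>2 * real s / real n) ^ (s - 1)"
    by (rule mult_right_mono[OF cL]) simp
  finally show ?thesis .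
qed

text \<open>The \<open>l\<close> rows are distinct, hence independent, and each has to contain two
  prescribed different columns.\<close>

lemma Pr_cycle_fixed:
  assumes "l \<ge> 2" "length as = l" "length vs = l" "distinct as" "distinct vs"
    "set as \<subseteq> {..<m}" "set vs \<subseteq> {..<n}"
  shows "Pr {w. \<forall>i<l. vs ! i \<in> cols w (as ! i) \<and> vs ! (Suc i mod l) \<in> cols w (as ! i)}
           \<le> (2 * (real k)\<^sup>2 / (real n)\<^sup>2) ^ l"
proof -
  \<comment> \<open>The requirement is indexed by the row and not by its position, as the cylinder
    formula demands; distinctness of \<open>as\<close> leaves one condition per row.\<close>
  define E where "E a = {y :: nat set \<times> (nat \<Rightarrow> 'r) \<times> 'r. \<forall>i<l. as ! i = a \<longrightarrow> vs ! i \<in> fst y \<and> vs ! (Suc i mod l) \<in> fst y}" for a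
  have E: "E (as ! i) = {y. fst y \<in> {J. vs ! i \<in> J \<and> vs ! (Suc i mod l) \<in> J}}" if "i < l" for i
    using that assms unfolding E_def by (auto simp: nth_eq_iff_index_eq)
  have "{w. \<forall>i<l. vs ! i \<in> cols w (as ! i) \<and> vs ! (Suc i mod l) \<in> cols w (as ! i)} = {w. \<forall>a\<in>set as. w a \<in> E a}"
    using assms(2) by (fastforce simp: E_def in_set_conv_nth)
  hence "Pr {w. \<forall>i<l. vs ! i \<in> cols w (as ! i) \<and> vs ! (Suc i mod l) \<in> cols w (as ! i)} =
      (\<Prod>a\<in>set as. measure_pmf.prob entry (E a))"
    unfolding rows_def by (simp only: prob_Pi_pmf_cylinder[OF finite_lessThan assms(6)])
  also have "\<dots> = (\<Prod>i<l. measure_pmf.prob entry (E (as ! i)))"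
    using assms by (intro prod.reindex_bij_betw[symmetric]) (simp add: bij_betw_nth)
  also have "\<dots> \<le> (\<Prod>i<l. 2 * (real k)\<^sup>2 / (real n)\<^sup>2)"
  proof (rule prod_mono, safe)
    fix i assume i: "i < l"
    have i': "Suc i mod l < l" using i by (intro mod_less_divisor) auto
    \<comment> \<open>This needs \<open>l \<ge> 2\<close>: for \<open>l = 1\<close> both prescribed
      columns would coincide and the bound of order \<open>1 / n^2\<close> would fail.\<close>
    have "Suc i mod l \<noteq> i"
    proof (cases "Suc i = l")
      case False
      thus ?thesis using i by simp
    qed (use assms(1) in auto)
    hence ne: "vs ! i \<noteq> vs ! (Suc i mod l)" using i i' assms by (simp add: nth_eq_iff_index_eq)
    have "vs ! i < n" "vs ! (Suc i mod l) < n" using assms(3,7) i i' by (auto simp: subset_iff)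
    thus "measure_pmf.prob entry (E (as ! i)) \<le> 2 * (real k)\<^sup>2 / (real n)\<^sup>2"
      unfolding E[OF i] prob_entry_fst by (rule prob_ksubsets_mem2[OF kn k2 _ _ ne])
  qed simp
  finally show ?thesis by simp
qed

text \<open>There are at most \<open>m ^ l n ^ l\<close> choices of rows and variables for a cycle
  of length \<open>2 l\<close>. The sparsity assumption makes the ratio of the resulting geometric
  series at most 1/2, so its first term, \<open>l = 2\<close>, dominates.\<close>

lemma Pr_not_acyclic:
  assumes "4 * k\<^sup>2 * m \<le> n"
  shows "Pr {w. \<not> fg_acyclic (fgraph k w {..<m})} \<le> 2 * (2 * (real k)\<^sup>2 * real m / real n)\<^sup>2"
proof -
  define ev where "ev l as vs = {w :: nat \<Rightarrow> nat set \<times> (nat \<Rightarrow> 'r) \<times> 'r. \<forall>i<l. vs ! i \<in> cols w (as ! i) \<and> vs ! (Suc i mod l) \<in> cols w (as ! i)}" for l as vs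
  define A where "A l = {as. distinct as \<and> set as \<subseteq> {..<m} \<and> length as = l}" for l
  define V where "V l = {vs. distinct vs \<and> set vs \<subseteq> {..<n} \<and> length vs = l}" for l
  let ?r = "2 * (real k)\<^sup>2 * real m / real n"
  have subA: "A l \<subseteq> {as. set as \<subseteq> {..<m} \<and> length as = l}" for l by (auto simp: A_def)
  have finA: "finite (A l)" for l by (rule finite_subset[OF subA finite_lists_length_eq]) simp
  have subV: "V l \<subseteq> {as. set as \<subseteq> {..<n} \<and> length as = l}" for l by (auto simp: V_def)
  have finV: "finite (V l)" for l by (rule finite_subset[OF subV finite_lists_length_eq]) simp
  have "card (A l) \<le> m ^ l" for l
    using card_mono[OF finite_lists_length_eq subA[of l]] card_lists_length_eq[of "{..<m}" l] by simp
  hence cA: "real (card (A l)) \<le> real m ^ l" for l by (metis of_nat_le_iff of_nat_power)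
  have "card (V l) \<le> n ^ l" for l
    using card_mono[OF finite_lists_length_eq subV[of l]] card_lists_length_eq[of "{..<n}" l] by simp
  hence cV: "real (card (V l)) \<le> real n ^ l" for l by (metis of_nat_le_iff of_nat_power)
  have "Pr {w. \<not> fg_acyclic (fgraph k w {..<m})} \<le> Pr (\<Union>l\<in>{2..<Suc m}. \<Union>z\<in>A l \<times> V l. ev l (fst z) (snd z))"
  proof (rule Pr_mono_AE)
    fix w assume w: "w \<in> set_pmf rows" "w \<in> {w. \<not> fg_acyclic (fgraph k w {..<m})}"
    then obtain p where "fg_cycle (fgraph k w {..<m}) p" by (auto simp: fg_acyclic_def)
    then obtain l as vs where l: "l \<ge> 2" "length as = l" "length vs = l" "distinct as" "distinct vs"
      "set as \<subseteq> {..<m}" "set vs \<subseteq> (\<Union>a\<in>{..<m}. fst (w a))"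
      "\<And>i. i < l \<Longrightarrow> vs ! i \<in> fst (w (as ! i)) \<and> vs ! (Suc i mod l) \<in> fst (w (as ! i))"
      using fg_cycle_fgraph_obtain[of k w "{..<m}" p] by blast
    have "l \<le> m" using l card_mono[of "{..<m}" "set as"] by (simp add: distinct_card)
    moreover have "set vs \<subseteq> {..<n}" using l(7) set_rows(1)[OF w(1)] by fastforce
    ultimately show "w \<in> (\<Union>l\<in>{2..<Suc m}. \<Union>z\<in>A l \<times> V l. ev l (fst z) (snd z))"
      using l by (intro UN_I[of l] UN_I[of "(as, vs)"]) (auto simp: A_def V_def ev_def)
  qed
  also have "\<dots> \<le> (\<Sum>l\<in>{2..<Suc m}. Pr (\<Union>z\<in>A l \<times> V l. ev l (fst z) (snd z)))"
    by (rule measure_UNION_le) auto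
  also have "\<dots> \<le> (\<Sum>l\<in>{2..<Suc m}. ?r ^ l)"
  proof (rule sum_mono)
    fix l assume l: "l \<in> {2..<Suc m}"
    have "Pr (\<Union>z\<in>A l \<times> V l. ev l (fst z) (snd z)) \<le> (\<Sum>z\<in>A l \<times> V l. Pr (ev l (fst z) (snd z)))"
      by (rule measure_UNION_le) (use finA finV in auto)
    also have "\<dots> \<le> (\<Sum>z\<in>A l \<times> V l. (2 * (real k)\<^sup>2 / (real n)\<^sup>2) ^ l)"
      unfolding ev_def by (intro sum_mono Pr_cycle_fixed) (use l in \<open>auto simp: A_def V_def\<close>)
    also have "\<dots> = (real (card (A l)) * real (card (V l))) * (2 * (real k)\<^sup>2 / (real n)\<^sup>2) ^ l"
      by (simp add: card_cartesian_product)
    also have "\<dots> \<le> (real m ^ l * real n ^ l) * (2 * (real k)\<^sup>2 / (real n)\<^sup>2) ^ l"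
      by (intro mult_right_mono mult_mono cA cV) auto
    also have "\<dots> = ?r ^ l"
      unfolding power_mult_distrib[symmetric] using n_pos by (simp add: field_simps power2_eq_square)
    finally show "Pr (\<Union>z\<in>A l \<times> V l. ev l (fst z) (snd z)) \<le> ?r ^ l" .
  qed
  also have "\<dots> \<le> 2 * ?r\<^sup>2"
  proof (rule geometric_tail_le)
    have "real (4 * k\<^sup>2 * m) \<le> real n" using assms by (simp only: of_nat_le_iff)
    thus "?r \<le> 1/2" using n_pos by (simp add: field_simps)
  qed simp
  finally show ?thesis .
qed

lemma Pr_sat_ge_acyclic:
  assumes "4 * k\<^sup>2 * m \<le> n" "unsat_trees k P Q = {}"
  shows "1 - 2 * (2 * (real k)\<^sup>2 * real m / real n)\<^sup>2 \<le> sat_prob k (product_dist k P) Q m n"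
proof -
  have "Pr (- {w. \<not> fg_acyclic (fgraph k w {..<m})}) \<le> sat_prob k (product_dist k P) Q m n"
    unfolding sat_prob_eq
  proof (rule Pr_mono_AE)
    fix w assume "w \<in> set_pmf rows" "w \<in> - {w. \<not> fg_acyclic (fgraph k w {..<m})}"
    thus "w \<in> {w. fg_satisfiable (fgraph k w {..<m})}"
      using unsat_cases[of w] assms(2) by auto
  qed
  moreover have "Pr (- {w. \<not> fg_acyclic (fgraph k w {..<m})}) = 1 - Pr {w. \<not> fg_acyclic (fgraph k w {..<m})}"
    using measure_pmf.prob_compl[of "{w. \<not> fg_acyclic (fgraph k w {..<m})}" rows] by (simp add: Compl_eq_Diff_UNIV)
  ultimately show ?thesis using Pr_not_acyclic[OF assms(1)] by linarith
qed

text \<open>In an acyclic unsatisfiable system some connected set of rows forms an unsatisfiable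
  tree, and such a set has at least \<open>s\<close> rows.\<close>

lemma Pr_sat_ge_no_conn:
  assumes "4 * k\<^sup>2 * m \<le> n" "\<And>T. T \<in> unsat_trees k P Q \<Longrightarrow> s \<le> card (constrs T)"
  shows "Pr (- {w. \<exists>K\<subseteq>{..<m}. conn (cols w) K \<and> s \<le> card K}) - 2 * (2 * (real k)\<^sup>2 * real m / real n)\<^sup>2
           \<le> sat_prob k (product_dist k P) Q m n"
proof -
  have "Pr (- {w. \<exists>K\<subseteq>{..<m}. conn (cols w) K \<and> s \<le> card K})
      \<le> Pr ({w. fg_satisfiable (fgraph k w {..<m})} \<union> {w. \<not> fg_acyclic (fgraph k w {..<m})})"
  proof (rule Pr_mono_AE)
    fix w assume w: "w \<in> set_pmf rows" "w \<in> - {w. \<exists>K\<subseteq>{..<m}. conn (cols w) K \<and> s \<le> card K}"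
    show "w \<in> {w. fg_satisfiable (fgraph k w {..<m})} \<union> {w. \<not> fg_acyclic (fgraph k w {..<m})}"
    proof (rule ccontr)
      assume "\<not> ?thesis"
      then obtain K where "K \<subseteq> {..<m}" "conn (cols w) K" "fgraph k w K \<in> unsat_trees k P Q"
        using unsat_cases[OF w(1)] by auto
      thus False using w(2) assms(2)[of "fgraph k w K"] by auto
    qed
  qed
  also have "\<dots> \<le> sat_prob k (product_dist k P) Q m n + Pr {w. \<not> fg_acyclic (fgraph k w {..<m})}"
    unfolding sat_prob_eq by (rule measure_subadditive) auto
  finally show ?thesis using Pr_not_acyclic[OF assms(1)] by linarith
qed

end

section \<open>Lower bounds by the local lemma, and the dense regime\<close>

lemma linked_conn: "linked J l \<Longrightarrow> conn J (set l)"
proof (induction l)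
  case (Cons a l)
  show ?case
  proof (cases "l = []")
    case False
    then obtain b where b: "b \<in> set l" "J a \<inter> J b \<noteq> {}" using Cons.prems by auto
    have "conn J {a, b}"
      by (rule connI[of _ a]) (use b in \<open>auto simp: row_adj_def intro: r_into_rtrancl\<close>)
    hence "conn J ({a, b} \<union> set l)" using Cons b by (intro conn_Un) auto
    moreover have "{a, b} \<union> set l = set (a # l)" using b by auto
    ultimately show ?thesis by simp
  qed (simp add: conn_def)
qed (simp add: conn_def)

lemma place_row_sum:
  assumes "finite J" "card J = k"
  shows "(\<Sum>v\<in>J. place_row k J s v * g v) = (\<Sum>i<k. s i * g (sorted_list_of_set J ! i) :: 'r::comm_ring_1)"
proof -
  have "bij_betw ((!) (sorted_list_of_set J)) {..<k} J"
    using bij_betw_nth[of "sorted_list_of_set J" "{..<k}" J] assms by simp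
  hence "(\<Sum>v\<in>J. place_row k J s v * g v) =
      (\<Sum>i<k. place_row k J s (sorted_list_of_set J ! i) * g (sorted_list_of_set J ! i))"
    by (rule sum.reindex_bij_betw[symmetric])
  also have "\<dots> = (\<Sum>i<k. s i * g (sorted_list_of_set J ! i))"
    by (rule sum.cong) (simp_all add: place_row_nth[OF assms])
  finally show ?thesis .
qed

lemma binomial_le_power: "n choose r \<le> n ^ r"
proof -
  have "n choose r \<le> (n choose r) * fact r" by simp
  also have "\<dots> \<le> n ^ r" by (rule binomial_fact_pow)
  finally show ?thesis .
qed

text \<open>The values taken by the linear form with coefficients \<open>a\<close> are a submodule
  containing the generators. Thus (A1) says that a single row with these coefficients and right-hand
  side \<open>b\<close> has a solution \<open>c\<close>.\<close>

lemma span_image_lincomb: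
  fixes a :: "nat \<Rightarrow> 'r::comm_ring_1"
  assumes "b \<in> module.span (*) (a ` {..<k})"
  shows "\<exists>c. (\<Sum>i<k. a i * c i) = b"
proof -
  have scale: "(\<Sum>i<k. a i * (e * c i)) = e * (\<Sum>i<k. a i * c i)" for e c
    by (simp add: sum_distrib_left mult.left_commute)
  have unit: "(\<Sum>i<k. a i * (if i = j then 1 else 0)) = a j" if "j < k" for j
  proof -
    have "(\<Sum>i<k. a i * (if i = j then 1 else 0)) = (\<Sum>i<k. if i = j then a i else 0)"
      by (rule sum.cong) auto
    thus ?thesis using that by simp
  qed
  interpret R: module "(*) :: 'r \<Rightarrow> 'r \<Rightarrow> 'r"
    by unfold_locales (simp_all add: algebra_simps)
  have "R.subspace {b. \<exists>c. (\<Sum>i<k. a i * c i) = b}"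
  proof (rule R.subspaceI)
    show "0 \<in> {b. \<exists>c. (\<Sum>i<k. a i * c i) = b}" by (auto intro!: exI[of _ "\<lambda>_. 0"])
    fix x y assume "x \<in> {b. \<exists>c. (\<Sum>i<k. a i * c i) = b}" "y \<in> {b. \<exists>c. (\<Sum>i<k. a i * c i) = b}"
    then obtain c d where "x = (\<Sum>i<k. a i * c i)" "y = (\<Sum>i<k. a i * d i)" by auto
    hence "(\<Sum>i<k. a i * (c i + d i)) = x + y" by (simp add: distrib_left sum.distrib)
    thus "x + y \<in> {b. \<exists>c. (\<Sum>i<k. a i * c i) = b}" by (auto intro!: exI[of _ "\<lambda>i. c i + d i"])
  next
    fix e x assume "x \<in> {b. \<exists>c. (\<Sum>i<k. a i * c i) = b}"
    then obtain c where "x = (\<Sum>i<k. a i * c i)" by auto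
    thus "e * x \<in> {b. \<exists>c. (\<Sum>i<k. a i * c i) = b}" by (simp only: mem_Collect_eq) (rule exI, rule scale)
  qed
  moreover have "a ` {..<k} \<subseteq> {b. \<exists>c. (\<Sum>i<k. a i * c i) = b}"
  proof safe
    fix j assume "j < k"
    show "\<exists>c. (\<Sum>i<k. a i * c i) = a j" by (rule exI, rule unit) fact
  qed
  ultimately have "R.span (a ` {..<k}) \<subseteq> {b. \<exists>c. (\<Sum>i<k. a i * c i) = b}"
    by (intro R.span_minimal)
  thus ?thesis using assms by blast
qed

text \<open>For each constant assignment \<open>s\<close>, (A2) gives a possible row that it
  violates. As the ring is finite, the minimum \<open>\<rho>\<close> of their probabilities is
  positive.\<close>

lemma cond_A2_uniform:
  fixes Q :: "'r::{finite,comm_ring_1} pmf"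
  assumes "cond_A2 k Phat Q"
  shows "\<exists>\<rho>>0. \<rho> \<le> 1 \<and> (\<forall>s. \<exists>a b. \<rho> \<le> pmf Phat a * pmf Q b \<and> (\<Sum>i<k. a i * s) \<noteq> b)"
proof -
  have "\<forall>s. \<exists>z. fst z \<in> set_pmf Phat \<and> snd z \<in> set_pmf Q \<and> (\<Sum>i<k. fst z i * s) \<noteq> snd z"
    using assms unfolding cond_A2_def by (metis fst_conv snd_conv)
  then obtain z where z: "\<And>s. fst (z s) \<in> set_pmf Phat \<and> snd (z s) \<in> set_pmf Q \<and> (\<Sum>i<k. fst (z s) i * s) \<noteq> snd (z s)"
    by metis
  define p where "p s = pmf Phat (fst (z s)) * pmf Q (snd (z s))" for s
  have "p s > 0" for s using z[of s] by (auto simp: p_def pmf_positive)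
  hence "Min (range p) > 0" by simp
  moreover have "p s \<le> 1" for s by (simp add: p_def mult_le_one pmf_le_1)
  hence "Min (range p) \<le> 1" by (meson Min_le finite finite_imageI order_trans rangeI)
  moreover have "\<exists>a b. Min (range p) \<le> pmf Phat a * pmf Q b \<and> (\<Sum>i<k. a i * s) \<noteq> b" for s
  proof (intro exI conjI)
    show "Min (range p) \<le> pmf Phat (fst (z s)) * pmf Q (snd (z s))"
      unfolding p_def[symmetric] by simp
  qed (use z in auto)
  ultimately show ?thesis by blast
qed

context random_system begin

lemma depends_on_conn: "depends_on {w. conn (cols w) U} U"
  unfolding depends_on_def
proof (intro allI impI)
  fix f g :: "nat \<Rightarrow> nat set \<times> (nat \<Rightarrow> 'r) \<times> 'r"
  assume "\<forall>x\<in>U. f x = g x" "f \<in> {w. conn (cols w) U}"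
  thus "g \<in> {w. conn (cols w) U}" using conn_cong[of U "cols f" "cols g"] by simp
qed

text \<open>The local lemma is applied to the events that an \<open>s\<close>-set of rows is
  connected. Events on disjoint sets are independent, and an \<open>s\<close>-set meets at most
  \<open>s m ^ (s - 1)\<close> of them. The product of this degree with \<open>q\<close> is of order
  \<open>(m / n) ^ (s - 1)\<close>, small in a sparse system only if
  \<open>s \<ge> 2\<close>.\<close>

lemma Pr_no_large_conn_ge:
  assumes s: "s \<ge> 1"
  defines "q \<equiv> real s ^ s * ((real k)\<^sup>2 * real s / real n) ^ (s - 1)"
  assumes qd: "4 * q * (real s * real m ^ (s - 1)) \<le> 1" and q4: "q \<le> 1/4"
  shows "exp (- 4 * q * real m ^ s) \<le> Pr (- {w. \<exists>K\<subseteq>{..<m}. conn (cols w) K \<and> s \<le> card K})"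
proof -
  define A where "A U = {w :: nat \<Rightarrow> nat set \<times> (nat \<Rightarrow> 'r) \<times> 'r. conn (cols w) U}" for U
  have q0: "0 \<le> q" by (simp add: q_def)
  have "(1 - 2 * q) ^ card (ksubsets s m) \<le> Pr (\<Inter>U\<in>ksubsets s m. - A U)"
  proof (rule lovasz_local_symmetric[where nb = "\<lambda>U V. U \<inter> V \<noteq> {}"])
    fix U assume U: "U \<in> ksubsets s m"
    hence U': "U \<subseteq> {..<m}" "card U = s" "finite U" using finite_subset by (auto simp: ksubsets_def)
    show "Pr (A U) \<le> q" unfolding A_def q_def using Pr_conn[of U s] U' s by (cases "U = {}") auto
    have "card {V \<in> ksubsets s m. U \<inter> V \<noteq> {}} \<le> card (\<Union>u\<in>U. {V \<in> ksubsets s m. {u} \<subseteq> V})"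
      by (rule card_mono) (use U' in auto)
    also have "\<dots> \<le> (\<Sum>u\<in>U. card {V \<in> ksubsets s m. {u} \<subseteq> V})"
      by (rule card_UN_le) (rule U')
    also have "\<dots> \<le> (\<Sum>u\<in>U. m ^ (s - 1))"
    proof (rule sum_mono)
      fix u assume "u \<in> U"
      hence "card {V \<in> ksubsets s m. {u} \<subseteq> V} = (m - 1) choose (s - 1)"
        using card_ksubsets_superset[of "{u}" m s] U' s by auto
      also have "\<dots> \<le> (m - 1) ^ (s - 1)" by (rule binomial_le_power)
      also have "\<dots> \<le> m ^ (s - 1)" by (rule power_mono) auto
      finally show "card {V \<in> ksubsets s m. {u} \<subseteq> V} \<le> m ^ (s - 1)" .
    qed
    finally have "card {V \<in> ksubsets s m. U \<inter> V \<noteq> {}} \<le> s * m ^ (s - 1)" using U' by simp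
    thus "real (card {V \<in> ksubsets s m. U \<inter> V \<noteq> {}}) \<le> real s * real m ^ (s - 1)"
      by (metis of_nat_le_iff of_nat_mult of_nat_power)
  next
    fix U S assume U: "U \<in> ksubsets s m" and S: "S \<subseteq> {V \<in> ksubsets s m. \<not> U \<inter> V \<noteq> {}}"
    show "Pr (A U \<inter> (\<Inter>V\<in>S. - A V)) = Pr (A U) * Pr (\<Inter>V\<in>S. - A V)"
      unfolding rows_def
    proof (rule prob_Pi_pmf_indep)
      show "depends_on (A U) U" unfolding A_def by (rule depends_on_conn)
      show "depends_on (\<Inter>V\<in>S. - A V) (\<Union>S)" unfolding depends_on_def
      proof (intro allI impI)
        fix f g :: "nat \<Rightarrow> nat set \<times> (nat \<Rightarrow> 'r) \<times> 'r"
        assume fg: "\<forall>x\<in>\<Union>S. f x = g x" and f: "f \<in> (\<Inter>V\<in>S. - A V)"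
        have "f \<in> A V \<longleftrightarrow> g \<in> A V" if "V \<in> S" for V
          by (rule depends_on_iff[OF depends_on_conn[of V, folded A_def]]) (use fg that in auto)
        thus "g \<in> (\<Inter>V\<in>S. - A V)" using f by auto
      qed
      show "U \<inter> \<Union>S = {}" using S by auto
    qed simp
  qed (use qd q4 q0 in auto)
  also have "\<dots> \<le> Pr (- {w. \<exists>K\<subseteq>{..<m}. conn (cols w) K \<and> s \<le> card K})"
  proof (rule measure_pmf.finite_measure_mono, safe)
    fix w K assume w: "w \<in> (\<Inter>U\<in>ksubsets s m. - A U)" and K: "K \<subseteq> {..<m}" "conn (cols w) K" "s \<le> card K"
    have "finite K" using K finite_subset by blast
    from conn_obtain_linked[OF this K(2,3)] obtain l where
      l: "distinct l" "linked (cols w) l" "set l \<subseteq> K" "length l = s" by blast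
    hence "set l \<in> ksubsets s m" using K by (auto simp: ksubsets_def distinct_card)
    moreover have "w \<in> A (set l)" using linked_conn[OF l(2)] by (simp add: A_def)
    ultimately show False using w by auto
  qed simp
  finally have 1: "(1 - 2 * q) ^ card (ksubsets s m) \<le> Pr (- {w. \<exists>K\<subseteq>{..<m}. conn (cols w) K \<and> s \<le> card K})" .
  have "card (ksubsets s m) \<le> m ^ s" unfolding card_ksubsets by (rule binomial_le_power)
  hence "(1 - 2 * q) ^ (m ^ s) \<le> (1 - 2 * q) ^ card (ksubsets s m)"
    by (rule power_decreasing) (use q0 q4 in auto)
  moreover have "exp (- 4 * q * real m ^ s) \<le> (1 - 2 * q) ^ (m ^ s)"
  proof -
    \<comment> \<open>This is \<open>ln (1 - x) \<ge> - x - 2 x^2\<close> at \<open>x = 2 q\<close>;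
      the quadratic term \<open>8 q^2\<close> is at most \<open>2 q\<close> because
      \<open>q \<le> 1/4\<close>, so that \<open>4 q\<close> suffices in the exponent.\<close>
    have "- (2 * q) - 2 * (2 * q)\<^sup>2 \<le> ln (1 - 2 * q)"
      by (rule ln_one_minus_pos_lower_bound) (use q0 q4 in auto)
    moreover have "2 * (2 * q)\<^sup>2 \<le> 2 * q" using mult_left_mono[OF q4 q0] by (simp add: power2_eq_square)
    ultimately have "- 4 * q \<le> ln (1 - 2 * q)" by linarith
    hence "exp (- 4 * q) \<le> 1 - 2 * q" using q4 by (subst (asm) ln_ge_iff) auto
    hence "exp (- 4 * q) ^ (m ^ s) \<le> (1 - 2 * q) ^ (m ^ s)" by (rule power_mono) simp
    thus ?thesis by (simp add: exp_of_nat_mult[symmetric] mult_ac)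
  qed
  ultimately show ?thesis using 1 by linarith
qed

lemma prob_entry_ge:
  assumes "d \<le> measure_pmf.prob (pmf_of_set (ksubsets k n)) X"
  shows "d * (pmf (product_dist k P) a * pmf Q b) \<le>
     measure_pmf.prob entry {y. fst y \<in> X \<and> fst (snd y) = a \<and> snd (snd y) = b}"
proof -
  have "{y. fst y \<in> X \<and> fst (snd y) = a \<and> snd (snd y) = b} = X \<times> ({a} \<times> {b})" by auto
  thus ?thesis unfolding entry_def using assms
    by (simp only: prob_pair_pmf_Times) (simp add: pmf.rep_eq mult_right_mono)
qed

text \<open>All rows carry the solvable pair from (A1) with probability at least the
  \<open>m\<close>-th power. If moreover no two rows share a column, every nonempty connected set is
  a single row, and these can be solved separately. The subtracted term bounds the probability that
  two rows meet.\<close>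

lemma sat_prob_ge_disjoint_rows:
  assumes ab: "a \<in> set_pmf (product_dist k P)" "b \<in> set_pmf Q" "b \<in> module.span (*) (a ` {..<k})"
  shows "(pmf (product_dist k P) a * pmf Q b) ^ m - (real m)\<^sup>2 * ((real k)\<^sup>2 * 2 / real n)
           \<le> sat_prob k (product_dist k P) Q m n"
proof -
  let ?d = "pmf (product_dist k P) a * pmf Q b"
  let ?E = "{y. fst y \<in> UNIV \<and> fst (snd y) = a \<and> snd (snd y) = b}"
  let ?B = "{w. \<exists>K\<subseteq>{..<m}. conn (cols w) K \<and> 2 \<le> card K}"
  obtain c where c: "(\<Sum>i<k. a i * c i) = b" using span_image_lincomb[OF ab(3)] by blast
  have "?d \<le> measure_pmf.prob entry ?E"
    using prob_entry_ge[of 1 UNIV a b] by simp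
  hence "?d ^ m \<le> (\<Prod>i<m. measure_pmf.prob entry ?E)" by (simp add: power_mono)
  also have "\<dots> = Pr {w. \<forall>i\<in>{..<m}. w i \<in> ?E}"
    unfolding rows_def by (rule prob_Pi_pmf_cylinder[symmetric]) auto
  also have "\<dots> \<le> Pr ({w. fg_satisfiable (fgraph k w {..<m})} \<union> ?B)"
  proof (rule Pr_mono_AE)
    fix w assume w: "w \<in> set_pmf rows" "w \<in> {w. \<forall>i\<in>{..<m}. w i \<in> ?E}"
    show "w \<in> {w. fg_satisfiable (fgraph k w {..<m})} \<union> ?B"
    proof (rule ccontr)
      assume no: "\<not> ?thesis"
      then obtain K where K: "K \<subseteq> {..<m}" "conn (cols w) K" "\<not> fg_satisfiable (fgraph k w K)"
        using obtain_unsat_component[of k w "{..<m}"] by auto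
      have finK: "finite K" using K finite_subset by blast
      have "card K < 2" using K no by auto
      moreover have "K \<noteq> {}" using K(3) by (auto simp: fg_satisfiable_fgraph)
      ultimately have "card K = 1" using finK card_gt_0_iff[of K] by linarith
      then obtain i where i: "K = {i}" by (auto simp: card_1_singleton_iff)
      hence im: "i < m" using K by auto
      let ?L = "sorted_list_of_set (fst (w i))"
      have dist: "distinct ?L" "length ?L = k" using set_rows(2)[OF w(1) im] by auto
      \<comment> \<open>The value \<open>c j\<close> is put on the \<open>j\<close>-th smallest
        column of the row.\<close>
      define x where "x v = c (inv_into {..<k} ((!) ?L) v)" for v
      have inj: "inj_on ((!) ?L) {..<k}" using dist by (auto simp: inj_on_def nth_eq_iff_index_eq)
      have "(\<Sum>v\<in>fst (w i). place_row k (fst (w i)) (fst (snd (w i))) v * x v) = (\<Sum>j<k. a j * x (?L ! j))"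
        unfolding place_row_sum[OF set_rows(3,2)[OF w(1) im]] using w(2) im by auto
      also have "\<dots> = b" unfolding c[symmetric] x_def
        by (rule sum.cong) (auto simp: inv_into_f_f[OF inj])
      finally show False using K(3) i w(2) im by (auto simp: fg_satisfiable_fgraph)
    qed
  qed
  also have "\<dots> \<le> sat_prob k (product_dist k P) Q m n + Pr ?B"
    unfolding sat_prob_eq by (rule measure_subadditive) auto
  finally show ?thesis using Pr_large_conn[of 2] by simp
qed

text \<open>A fixed assignment is violated by a random row with probability at least
  \<open>\<rho>\<close> times the probability that all \<open>k\<close> columns carry its most
  frequent value, so it survives \<open>m\<close> independent rows with exponentially small
  probability.\<close>

lemma sat_prob_le_union_bound:
  assumes \<rho>: "0 < \<rho>" "\<And>s. \<exists>a b. \<rho> \<le> pmf (product_dist k P) a * pmf Q b \<and> (\<Sum>i<k. a i * s) \<noteq> b"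
    and n: "2 * CARD('r) * k \<le> n"
  shows "sat_prob k (product_dist k P) Q m n \<le>
           real CARD('r) ^ n * (1 - (1 / (2 * real CARD('r))) ^ k * \<rho>) ^ m"
proof -
  let ?r = "CARD('r)"
  let ?\<delta> = "(1 / (2 * real CARD('r))) ^ k * \<rho>"
  have r0: "?r > 0" by simp
  define G where "G x = {y. (\<Sum>v\<in>fst y. place_row k (fst y) (fst (snd y)) v * x v) = (snd (snd y) :: 'r)}" for x
  \<comment> \<open>Assignments are made undefined outside the \<open>n\<close> variables; this
    leaves a finite set of the right cardinality.\<close>
  let ?X = "PiE {..<n} (\<lambda>_. UNIV :: 'r set)"
  have G: "measure_pmf.prob entry (G x) \<le> 1 - ?\<delta>" for x
  proof -
    \<comment> \<open>Pigeonhole: the classes of variables with equal value partition the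
      \<open>n\<close> variables, so one of them has at least \<open>n / r\<close> elements.\<close>
    have "\<exists>s. n \<le> ?r * card {v\<in>{..<n}. x v = s}"
    proof (rule ccontr)
      assume "\<not> ?thesis"
      hence "(\<Sum>s\<in>(UNIV :: 'r set). ?r * card {v\<in>{..<n}. x v = s}) < (\<Sum>s\<in>(UNIV :: 'r set). n)"
        by (intro sum_strict_mono) (auto simp: not_le)
      moreover have "(\<Sum>s\<in>(UNIV :: 'r set). card {v\<in>{..<n}. x v = s}) = n"
      proof -
        have "(\<Sum>s\<in>(UNIV :: 'r set). card {v\<in>{..<n}. x v = s}) = card (\<Union>s\<in>(UNIV :: 'r set). {v\<in>{..<n}. x v = s})"
          by (rule card_UN_disjoint[symmetric]) auto
        also have "(\<Union>s\<in>(UNIV :: 'r set). {v\<in>{..<n}. x v = s}) = {..<n}" by auto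
        finally show ?thesis by simp
      qed
      ultimately show False by (simp add: sum_distrib_left[symmetric])
    qed
    then obtain s where s: "n \<le> ?r * card {v\<in>{..<n}. x v = s}" by blast
    obtain a b where ab: "\<rho> \<le> pmf (product_dist k P) a * pmf Q b" "(\<Sum>i<k. a i * s) \<noteq> b"
      using \<rho>(2) by blast
    let ?L = "{v\<in>{..<n}. x v = s}"
    let ?E = "{y. fst y \<in> {J. J \<subseteq> ?L} \<and> fst (snd y) = a \<and> snd (snd y) = b}"
    have "(1 / (2 * real ?r)) ^ k * \<rho> \<le> (1 / (2 * real ?r)) ^ k * (pmf (product_dist k P) a * pmf Q b)"
      by (rule mult_left_mono[OF ab(1)]) simp
    also have "\<dots> \<le> measure_pmf.prob entry ?E"
      by (rule prob_entry_ge, rule prob_ksubsets_subset) (use kn n s r0 in auto)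
    also have "\<dots> \<le> measure_pmf.prob entry (- G x)"
    proof (rule measure_pmf.finite_measure_mono_AE, unfold AE_measure_pmf_iff, intro ballI impI)
      fix y assume y: "y \<in> set_pmf entry" "y \<in> ?E"
      hence J: "fst y \<subseteq> {..<n}" "card (fst y) = k" using set_entry(1)[OF y(1)] by (auto simp: ksubsets_def)
      hence fin: "finite (fst y)" using finite_subset by blast
      have "sorted_list_of_set (fst y) ! i \<in> fst y" if "i < k" for i
        using that J fin by (metis nth_mem length_sorted_list_of_set set_sorted_list_of_set)
      hence "(\<Sum>v\<in>fst y. place_row k (fst y) (fst (snd y)) v * x v) = (\<Sum>i<k. a i * s)"
        unfolding place_row_sum[OF fin J(2)] using y(2) by (intro sum.cong) auto
      thus "y \<in> - G x" using ab(2) y(2) by (auto simp: G_def)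
    qed simp
    also have "\<dots> = 1 - measure_pmf.prob entry (G x)"
      using measure_pmf.prob_compl[of "G x" entry] by (simp add: Compl_eq_Diff_UNIV)
    finally show ?thesis by simp
  qed
  have \<delta>: "0 \<le> 1 - ?\<delta>" using G[of undefined] measure_nonneg order_trans by blast
  have "sat_prob k (product_dist k P) Q m n \<le> Pr (\<Union>x\<in>?X. {w. \<forall>a\<in>{..<m}. w a \<in> G x})"
    unfolding sat_prob_eq
  proof (rule Pr_mono_AE)
    fix w assume w: "w \<in> set_pmf rows" "w \<in> {w. fg_satisfiable (fgraph k w {..<m})}"
    then obtain x where x: "\<And>a. a < m \<Longrightarrow>
       (\<Sum>v\<in>fst (w a). place_row k (fst (w a)) (fst (snd (w a))) v * x v) = snd (snd (w a))"
      by (auto simp: fg_satisfiable_fgraph)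
    have "w a \<in> G (restrict x {..<n})" if "a < m" for a
    proof -
      have "(\<Sum>v\<in>fst (w a). place_row k (fst (w a)) (fst (snd (w a))) v * restrict x {..<n} v) =
        (\<Sum>v\<in>fst (w a). place_row k (fst (w a)) (fst (snd (w a))) v * x v)"
        by (rule sum.cong) (use set_rows(1)[OF w(1) that] in auto)
      thus ?thesis using x[OF that] by (simp add: G_def)
    qed
    thus "w \<in> (\<Union>x\<in>?X. {w. \<forall>a\<in>{..<m}. w a \<in> G x})"
      by (intro UN_I[of "restrict x {..<n}"]) auto
  qed
  also have "\<dots> \<le> (\<Sum>x\<in>?X. Pr {w. \<forall>a\<in>{..<m}. w a \<in> G x})"
    by (rule measure_UNION_le) (auto intro: finite_PiE)
  also have "\<dots> \<le> (\<Sum>x\<in>?X. (1 - ?\<delta>) ^ m)"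
  proof (rule sum_mono)
    fix x
    have "Pr {w. \<forall>a\<in>{..<m}. w a \<in> G x} = measure_pmf.prob entry (G x) ^ m"
      unfolding rows_def by (subst prob_Pi_pmf_cylinder) auto
    also have "\<dots> \<le> (1 - ?\<delta>) ^ m" by (rule power_mono[OF G]) simp
    finally show "Pr {w. \<forall>a\<in>{..<m}. w a \<in> G x} \<le> (1 - ?\<delta>) ^ m" .
  qed
  also have "\<dots> = real (card ?X) * (1 - ?\<delta>) ^ m" by simp
  also have "card ?X = ?r ^ n" by (simp add: card_PiE)
  finally show ?thesis by simp
qed

end

section \<open>Copies of an unsatisfiable tree\<close>

lemma sorted_list_of_set_strict_image:
  fixes f :: "nat \<Rightarrow> nat"
  assumes "finite A" "\<And>x y. x \<in> A \<Longrightarrow> y \<in> A \<Longrightarrow> x < y \<Longrightarrow> f x < f y"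
  shows "sorted_list_of_set (f ` A) = map f (sorted_list_of_set A)"
proof -
  have inj: "inj_on f A" using assms(2) by (metis inj_onI linorder_neqE_nat less_irrefl)
  have "sorted (map f (sorted_list_of_set A))"
    unfolding sorted_map
    by (rule sorted_wrt_mono_rel[OF _ sorted_sorted_list_of_set])
       (use assms in \<open>auto simp: le_less\<close>)
  moreover have "distinct (map f (sorted_list_of_set A))" using inj assms(1) by (simp add: distinct_map)
  ultimately show ?thesis
    using sorted_list_of_set.idem_if_sorted_distinct[of "map f (sorted_list_of_set A)"] assms(1) by simp
qed

text \<open>The variables of a copy of \<open>T\<close> are confined to consecutive blocks of length \<open>h\<close>, one for each
  variable of \<open>T\<close> and in the same order. Then the weights of a row do not depend on the positions
  within the blocks, and different positions give different copies.\<close>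

definition embed :: "'r wfactor_graph \<Rightarrow> nat \<Rightarrow> (nat \<Rightarrow> nat) \<Rightarrow> nat \<Rightarrow> nat" where
  "embed T h g v = card {u \<in> vars T. u < v} * h + g v"

text \<open>The value 0 beyond \<open>k\<close> is the default value of the product distribution,
  without which the tuple would lie outside its support.\<close>

definition tree_row :: "nat \<Rightarrow> 'r::zero wfactor_graph \<Rightarrow> nat \<Rightarrow> nat \<Rightarrow> 'r" where
  "tree_row k T c j = (if j < k then edge_weight T c (sorted_list_of_set (nbhd T c) ! j) else 0)"

definition tree_entry ::
  "nat \<Rightarrow> 'r::zero wfactor_graph \<Rightarrow> nat \<Rightarrow> (nat \<Rightarrow> nat) \<Rightarrow> nat \<Rightarrow> nat set \<times> (nat \<Rightarrow> 'r) \<times> 'r" where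
  "tree_entry k T h g i = (let c = sorted_list_of_set (constrs T) ! i in
     (embed T h g ` nbhd T c, tree_row k T c, constr_weight T c))"

text \<open>The row \<open>l ! i\<close> plays the part of the \<open>i\<close>-th constraint. One
  event covers all positions \<open>g\<close> inside the blocks; extensional functions make distinct
  positions countable.\<close>

definition copies ::
  "nat \<Rightarrow> 'r::zero wfactor_graph \<Rightarrow> nat \<Rightarrow> nat list \<Rightarrow> (nat \<Rightarrow> nat set \<times> (nat \<Rightarrow> 'r) \<times> 'r) set" where
  "copies k T h l = {w. \<exists>g\<in>vars T \<rightarrow>\<^sub>E {..<h}. \<forall>i<length l. w (l ! i) = tree_entry k T h g i}"

lemma embed_less:
  assumes "finite (vars T)" "u \<in> vars T" "u < v" "g u < h"
  shows "embed T h g u < embed T h g v"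
proof -
  have "card {x \<in> vars T. x < u} < card {x \<in> vars T. x < v}"
    by (rule psubset_card_mono) (use assms in auto)
  hence "Suc (card {x \<in> vars T. x < u}) * h \<le> card {x \<in> vars T. x < v} * h"
    by (intro mult_right_mono) auto
  thus ?thesis using assms(4) unfolding embed_def by simp
qed

lemma embed_bound:
  assumes "finite (vars T)" "v \<in> vars T" "g v < h"
  shows "embed T h g v < card (vars T) * h"
proof -
  have "card {x \<in> vars T. x < v} < card (vars T)"
    by (rule psubset_card_mono) (use assms in auto)
  hence "Suc (card {x \<in> vars T. x < v}) * h \<le> card (vars T) * h"
    by (intro mult_right_mono) auto
  thus ?thesis using assms(3) unfolding embed_def by simp
qed

locale factor_tree =
  fixes k :: nat and T :: "'r::{finite,comm_ring_1} wfactor_graph" and P Q :: "'r pmf"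
  assumes T: "T \<in> unsat_trees k P Q" and k1: "1 \<le> k"
begin

abbreviation "s \<equiv> card (constrs T)"
abbreviation "cs \<equiv> sorted_list_of_set (constrs T)"

lemma fin: "finite (constrs T)" "finite (vars T)" "finite (nbhd T c)"
  and edges_sub: "edges T \<subseteq> constrs T \<times> vars T"
  and nbhd_sub: "nbhd T c \<subseteq> vars T"
  and card_nbhd: "c \<in> constrs T \<Longrightarrow> card (nbhd T c) = k"
proof -
  show *: "finite (constrs T)" "finite (vars T)" "edges T \<subseteq> constrs T \<times> vars T"
    "c \<in> constrs T \<Longrightarrow> card (nbhd T c) = k"
    using T by (auto simp: unsat_trees_def factor_graph_def)
  show "nbhd T c \<subseteq> vars T" using *(3) by (auto simp: nbhd_def)
  thus "finite (nbhd T c)" using *(2) finite_subset by blast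
qed

lemma s_pos: "1 \<le> s"
  using unsat_tree_card_vars(1)[OF T] fin(1) by (simp add: Suc_le_eq card_gt_0_iff)

lemma card_vars_ge: "k * s + 1 \<le> s + card (vars T)"
  using unsat_tree_card_vars(2)[OF T] .

lemma card_vars_pos: "1 \<le> card (vars T)"
proof -
  have "s \<le> k * s" using k1 by simp
  thus ?thesis using card_vars_ge by linarith
qed

lemma length_cs: "length cs = s" and set_cs: "set cs = constrs T"
  using fin by auto

lemma cs_mem: "i < s \<Longrightarrow> cs ! i \<in> constrs T"
  using length_cs set_cs nth_mem by metis

lemma obtain_cs:
  assumes "c \<in> constrs T"
  obtains i where "i < s" "c = cs ! i"
  using assms length_cs set_cs by (metis in_set_conv_nth)

lemma embed_nbhd:
  assumes "g \<in> vars T \<rightarrow>\<^sub>E {..<h}"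
  shows "inj_on (embed T h g) (vars T)"
    "sorted_list_of_set (embed T h g ` nbhd T c) = map (embed T h g) (sorted_list_of_set (nbhd T c))"
    "c \<in> constrs T \<Longrightarrow> card (embed T h g ` nbhd T c) = k"
proof -
  have less: "embed T h g u < embed T h g v" if "u \<in> vars T" "u < v" for u v
    using embed_less[OF fin(2) that] assms that by (auto simp: PiE_def Pi_def)
  show inj: "inj_on (embed T h g) (vars T)"
    using less by (metis inj_onI linorder_neqE_nat less_irrefl)
  show "sorted_list_of_set (embed T h g ` nbhd T c) = map (embed T h g) (sorted_list_of_set (nbhd T c))"
    by (rule sorted_list_of_set_strict_image[OF fin(3)]) (use less nbhd_sub in auto)
  show "card (embed T h g ` nbhd T c) = k" if "c \<in> constrs T"
    using card_nbhd[OF that] inj_on_subset[OF inj nbhd_sub] by (simp add: card_image)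
qed

text \<open>A solution of the system, composed with the embedding of the variables, would solve
  \<open>T\<close>. Because the embedding is increasing, the \<open>j\<close>-th column of a row is
  the image of the \<open>j\<close>-th neighbour.\<close>

lemma copies_unsat:
  assumes w: "w \<in> copies k T h l" and l: "length l = s" "set l \<subseteq> U"
  shows "\<not> fg_satisfiable (fgraph k w U)"
proof
  assume "fg_satisfiable (fgraph k w U)"
  then obtain x where x: "\<And>a. a \<in> U \<Longrightarrow>
     (\<Sum>v\<in>fst (w a). place_row k (fst (w a)) (fst (snd (w a))) v * x v) = snd (snd (w a))"
    by (auto simp: fg_satisfiable_fgraph)
  obtain g where g: "g \<in> vars T \<rightarrow>\<^sub>E {..<h}" "\<And>i. i < s \<Longrightarrow> w (l ! i) = tree_entry k T h g i"
    using w l by (auto simp: copies_def)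
  let ?e = "embed T h g"
  have "fg_satisfiable T" unfolding fg_satisfiable_def
  proof (intro exI[of _ "\<lambda>v. x (?e v)"] ballI)
    fix c assume c: "c \<in> constrs T"
    then obtain i where i: "i < s" "c = cs ! i" by (rule obtain_cs)
    let ?J = "?e ` nbhd T c" and ?L = "sorted_list_of_set (nbhd T c)"
    have L: "length ?L = k" "distinct ?L" "set ?L = nbhd T c" using card_nbhd[OF c] fin(3) by auto
    have w: "w (l ! i) = (?J, tree_row k T c, constr_weight T c)"
      using g(2)[OF i(1)] i(2) by (simp add: tree_entry_def Let_def)
    have "l ! i \<in> U" using l i by auto
    hence "constr_weight T c = (\<Sum>v\<in>?J. place_row k ?J (tree_row k T c) v * x v)"
      using x[of "l ! i"] unfolding w by simp
    also have "\<dots> = (\<Sum>j<k. tree_row k T c j * x (sorted_list_of_set ?J ! j))"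
      by (rule place_row_sum) (use fin(3) embed_nbhd(3)[OF g(1) c] in auto)
    also have "\<dots> = (\<Sum>j<k. edge_weight T c (?L ! j) * x (?e (?L ! j)))"
      unfolding embed_nbhd(2)[OF g(1)] using L by (intro sum.cong) (auto simp: tree_row_def)
    also have "\<dots> = (\<Sum>v\<in>nbhd T c. edge_weight T c v * x (?e v))"
      by (rule sum.reindex_bij_betw[of "(!) ?L"]) (use L in \<open>simp add: bij_betw_nth\<close>)
    finally show "(\<Sum>v\<in>nbhd T c. edge_weight T c v * x (?e v)) = constr_weight T c" ..
  qed
  thus False using T by (simp add: unsat_trees_def)
qed

text \<open>A path in \<open>T\<close> between two constraints is followed in the rows.\<close>

lemma copies_conn:
  assumes w: "w \<in> copies k T h l" and l: "length l = s"
  shows "conn (\<lambda>a. fst (w a)) (set l)"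
  unfolding conn_def
proof (intro ballI)
  fix a b assume ab: "a \<in> set l" "b \<in> set l"
  let ?R = "row_adj (\<lambda>a. fst (w a)) (set l)"
  obtain g where g: "\<And>i. i < s \<Longrightarrow> w (l ! i) = tree_entry k T h g i"
    using w l by (auto simp: copies_def)
  have fw: "fst (w (l ! i)) = embed T h g ` nbhd T (cs ! i)" if "i < s" for i
    using g[OF that] by (simp add: tree_entry_def Let_def)
  obtain i where i: "i < s" "a = l ! i" using ab l by (auto simp: in_set_conv_nth)
  obtain j where j: "j < s" "b = l ! j" using ab l by (auto simp: in_set_conv_nth)
  have dist: "p = q" if "cs ! p = cs ! q" "p < s" "q < s" for p q
    using that length_cs by (simp add: nth_eq_iff_index_eq)
  have "(Inl (cs ! i), Inl (cs ! j)) \<in> (fg_adj T)\<^sup>*"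
    using T cs_mem i j unfolding unsat_trees_def fg_connected_def fg_verts_def by blast
  \<comment> \<open>At a variable vertex the path stands in no row, so the invariant is strengthened
    there: every row whose constraint contains the variable has been reached.\<close>
  hence "case Inl (cs ! j) of Inl c \<Rightarrow> (\<forall>q<s. c = cs ! q \<longrightarrow> (a, l ! q) \<in> ?R\<^sup>*)
      | Inr v \<Rightarrow> (\<forall>q<s. v \<in> nbhd T (cs ! q) \<longrightarrow> (a, l ! q) \<in> ?R\<^sup>*)"
  proof (induction rule: rtrancl_induct)
    case base
    show ?case using i dist by auto
  next
    case (step y z)
    from step.hyps(2) consider c v where "y = Inl c" "z = Inr v" "(c, v) \<in> edges T"
      | c v where "y = Inr v" "z = Inl c" "(c, v) \<in> edges T"
      by (auto simp: fg_adj_def)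
    thus ?case
    proof cases
      case 1
      then obtain p where p: "p < s" "c = cs ! p" using edges_sub obtain_cs by blast
      hence ap: "(a, l ! p) \<in> ?R\<^sup>*" using step.IH 1 by auto
      have "(l ! p, l ! q) \<in> ?R" if q: "q < s" "v \<in> nbhd T (cs ! q)" for q
      proof -
        have "embed T h g v \<in> fst (w (l ! p)) \<inter> fst (w (l ! q))"
          unfolding fw[OF p(1)] fw[OF q(1)] using q 1 p by (auto simp: nbhd_def)
        thus ?thesis using p q l by (auto simp: row_adj_def)
      qed
      thus ?thesis using 1 ap by (auto intro: rtrancl_into_rtrancl)
    next
      case 2
      thus ?thesis using step.IH by (auto simp: nbhd_def)
    qed
  qed
  thus "(a, b) \<in> ?R\<^sup>*" using j by simp
qed

lemma depends_on_copies: "depends_on (copies k T h l) (set l)"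
  unfolding depends_on_def copies_def by auto

text \<open>Sorting the column sets recovers the embedding pointwise on each neighbourhood, and by
  connectedness every variable belongs to some neighbourhood. Thus the events for different
  \<open>g\<close> are disjoint and their probabilities add up.\<close>

lemma disjoint_copies:
  assumes "g \<in> vars T \<rightarrow>\<^sub>E {..<h}" "g' \<in> vars T \<rightarrow>\<^sub>E {..<h}"
    "\<And>i. i < s \<Longrightarrow> tree_entry k T h g i = tree_entry k T h g' i"
  shows "g = g'"
proof (rule PiE_ext[OF assms(1,2)])
  fix v assume v: "v \<in> vars T"
  obtain c0 where c0: "c0 \<in> constrs T" using s_pos by (metis all_not_in_conv card.empty not_one_le_zero)
  have "(Inr v, Inl c0) \<in> (fg_adj T)\<^sup>*"
    using T v c0 unfolding unsat_trees_def fg_connected_def fg_verts_def by blast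
  then obtain z where "(Inr v, z) \<in> fg_adj T" by (metis Inl_Inr_False converse_rtranclE)
  then obtain c where c: "(c, v) \<in> edges T" by (auto simp: fg_adj_def)
  hence cT: "c \<in> constrs T" using edges_sub by auto
  then obtain i where i: "i < s" "c = cs ! i" by (rule obtain_cs)
  have "embed T h g ` nbhd T c = embed T h g' ` nbhd T c"
    using assms(3)[OF i(1)] i(2) by (simp add: tree_entry_def Let_def)
  hence "map (embed T h g) (sorted_list_of_set (nbhd T c)) = map (embed T h g') (sorted_list_of_set (nbhd T c))"
    using embed_nbhd(2)[OF assms(1), of c] embed_nbhd(2)[OF assms(2), of c] by simp
  moreover have "v \<in> set (sorted_list_of_set (nbhd T c))" using c fin(3) by (simp add: nbhd_def)
  ultimately have "embed T h g v = embed T h g' v" by (simp add: map_eq_conv)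
  thus "g v = g' v" by (simp add: embed_def)
qed

text \<open>The product form of the row law is used here: weights that are possible one by one are
  possible jointly, in whatever order the columns put them.\<close>

lemma tree_row_in_set_pmf: "c \<in> constrs T \<Longrightarrow> tree_row k T c \<in> set_pmf (product_dist k P)"
proof -
  assume c: "c \<in> constrs T"
  have "edge_weight T c (sorted_list_of_set (nbhd T c) ! j) \<in> set_pmf P" if "j < k" for j
  proof -
    have "sorted_list_of_set (nbhd T c) ! j \<in> nbhd T c"
      using that card_nbhd[OF c] fin(3) by (metis nth_mem length_sorted_list_of_set set_sorted_list_of_set)
    thus ?thesis using T unfolding unsat_trees_def nbhd_def by auto
  qed
  thus ?thesis by (auto simp: product_dist_def set_Pi_pmf PiE_dflt_def tree_row_def)
qed

text \<open>The numerator is the probability that the rows carry the prescribed weights. The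
  denominator is the loss from confining each of the \<open>N\<close> variables to a block of length
  at least \<open>n / (2 N)\<close>.\<close>

definition copy_const :: real where
  "copy_const = (\<Prod>i<s. pmf (product_dist k P) (tree_row k T (cs ! i)) * pmf Q (constr_weight T (cs ! i)))
     / (2 * real (card (vars T))) ^ card (vars T)"

lemma copy_const_pos: "0 < copy_const"
proof -
  have "0 < pmf (product_dist k P) (tree_row k T (cs ! i)) * pmf Q (constr_weight T (cs ! i))" if "i < s" for i
    using tree_row_in_set_pmf[OF cs_mem[OF that]] T cs_mem[OF that]
    by (auto simp: pmf_positive unsat_trees_def intro!: mult_pos_pos)
  thus ?thesis unfolding copy_const_def using card_vars_pos by (auto intro!: divide_pos_pos prod_pos)
qed

end

locale tree_in_random_system = random_system k m n P Q + factor_tree k T P Q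
  for k m n :: nat and T :: "'r::{finite,comm_ring_1} wfactor_graph" and P Q :: "'r pmf" +
  assumes large: "card (vars T) \<le> n"
begin

text \<open>Each of the \<open>h ^ N\<close> positions, with \<open>N\<close> the number of
  variables of \<open>T\<close>, gives a disjoint event, in which \<open>s\<close> column sets are
  prescribed exactly at a cost of at most \<open>n ^ k\<close> each.\<close>

lemma Pr_copies_ge:
  assumes l: "distinct l" "set l \<subseteq> {..<m}" "length l = s"
  shows "copy_const / real n ^ (s - 1) \<le> Pr (copies k T (n div card (vars T)) l)"
proof -
  define h where "h = n div card (vars T)"
  let ?N = "card (vars T)"
  have hN: "?N * h \<le> n" by (simp add: h_def)
  define ev where "ev g = {w. \<forall>i<s. w (l ! i) = tree_entry k T h g i}" for g
  let ?G = "vars T \<rightarrow>\<^sub>E {..<h}"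
  let ?W = "\<lambda>i. pmf (product_dist k P) (tree_row k T (cs ! i)) * pmf Q (constr_weight T (cs ! i))"
  have finG: "finite ?G" using fin(2) by (auto intro: finite_PiE)
  have ev: "Pr (ev g) = (\<Prod>i<s. ?W i / real (n choose k))" if g: "g \<in> ?G" for g
  proof -
    define E where "E a = {y. \<forall>i<s. l ! i = a \<longrightarrow> y = tree_entry k T h g i}" for a
    have E: "E (l ! i) = {tree_entry k T h g i}" if "i < s" for i
      using that l by (auto simp: E_def nth_eq_iff_index_eq)
    have "ev g = {w. \<forall>a\<in>set l. w a \<in> E a}" using l(3) by (fastforce simp: ev_def E_def in_set_conv_nth)
    hence "Pr (ev g) = (\<Prod>a\<in>set l. measure_pmf.prob entry (E a))"
      unfolding rows_def by (simp only: prob_Pi_pmf_cylinder[OF finite_lessThan l(2)])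
    also have "\<dots> = (\<Prod>i<s. measure_pmf.prob entry (E (l ! i)))"
      using l by (intro prod.reindex_bij_betw[symmetric]) (simp add: bij_betw_nth)
    also have "\<dots> = (\<Prod>i<s. ?W i / real (n choose k))"
    proof (rule prod.cong[OF refl])
      fix i assume i: "i \<in> {..<s}"
      hence c: "cs ! i \<in> constrs T" using cs_mem by simp
      have "embed T h g v < n" if "v \<in> nbhd T (cs ! i)" for v
      proof -
        have "v \<in> vars T" using nbhd_sub that by auto
        thus ?thesis using embed_bound[OF fin(2), of v g h] g hN by (auto simp: PiE_def Pi_def)
      qed
      hence "embed T h g ` nbhd T (cs ! i) \<in> ksubsets k n"
        using embed_nbhd(3)[OF g c] by (auto simp: ksubsets_def)
      hence "pmf entry (tree_entry k T h g i) = ?W i / real (n choose k)"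
        by (simp add: tree_entry_def Let_def entry_def pmf_pair ksubsets_nonempty[OF kn] card_ksubsets)
      thus "measure_pmf.prob entry (E (l ! i)) = ?W i / real (n choose k)"
        using E i by (simp add: pmf.rep_eq)
    qed
    finally show ?thesis .
  qed
  have "Pr (copies k T h l) = Pr (\<Union>g\<in>?G. ev g)"
    by (rule arg_cong[of _ _ Pr]) (auto simp: copies_def ev_def l(3))
  also have "\<dots> = (\<Sum>g\<in>?G. Pr (ev g))"
  proof (rule measure_pmf.finite_measure_finite_Union[OF finG])
    show "disjoint_family_on ev ?G" unfolding disjoint_family_on_def
    proof (intro ballI impI)
      fix g g' assume gg: "g \<in> ?G" "g' \<in> ?G" "g \<noteq> g'"
      show "ev g \<inter> ev g' = {}"
      proof (rule ccontr)
        assume "ev g \<inter> ev g' \<noteq> {}"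
        then obtain w where w: "\<And>i. i < s \<Longrightarrow> w (l ! i) = tree_entry k T h g i"
          "\<And>i. i < s \<Longrightarrow> w (l ! i) = tree_entry k T h g' i" unfolding ev_def by blast
        have "g = g'" by (rule disjoint_copies[OF gg(1,2)]) (metis w)
        thus False using gg by simp
      qed
    qed
  qed simp
  also have "\<dots> = (\<Sum>g\<in>?G. \<Prod>i<s. ?W i / real (n choose k))" by (rule sum.cong[OF refl ev])
  also have "\<dots> = real h ^ ?N * (\<Prod>i<s. ?W i / real (n choose k))"
    using fin(2) by (simp add: card_PiE)
  also have "\<dots> = real h ^ ?N * ((\<Prod>i<s. ?W i) / real (n choose k) ^ s)" by (simp add: prod_dividef)
  finally have eq: "Pr (copies k T h l) = real h ^ ?N * ((\<Prod>i<s. ?W i) / real (n choose k) ^ s)" .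
  have N0: "0 < real ?N" "0 < ?N" using card_vars_pos by auto
  have n0: "0 < real n" using n_pos by simp
  have Cnk: "0 < real (n choose k)" using kn by (simp add: zero_less_binomial)
  have W0: "0 \<le> (\<Prod>i<s. ?W i)" by (intro prod_nonneg) auto
  \<comment> \<open>As \<open>n\<close> is at least the number of variables,
    \<open>h \<ge> 1\<close>, and rounding down in \<open>h\<close> loses at most a factor
    2.\<close>
  have h2: "real n / (2 * real ?N) \<le> real h"
  proof -
    have "h \<ge> 1" using large N0 by (simp add: h_def div_greater_zero_iff Suc_le_eq)
    have "n < ?N * (h + 1)" unfolding h_def using dividend_less_times_div[OF N0(2), of n] by simp
    also have "\<dots> \<le> ?N * (2 * h)" using \<open>h \<ge> 1\<close> by (intro mult_left_mono) auto
    finally have "real n \<le> real (?N * (2 * h))" by (simp only: of_nat_le_iff)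
    thus ?thesis using N0 by (simp add: field_simps)
  qed
  \<comment> \<open>The forest bound enters here: \<open>k s \<le> N + (s - 1)\<close>, so the
    choice of positions compensates all but \<open>s - 1\<close> powers of \<open>n\<close>.\<close>
  have "real n ^ (k * s) \<le> real n ^ (?N + (s - 1))"
    using n_pos card_vars_ge s_pos by (intro power_increasing) auto
  hence *: "real n ^ (k * s) \<le> real n ^ ?N * real n ^ (s - 1)" by (simp add: power_add)
  have nk: "real (n choose k) ^ s \<le> real n ^ (k * s)"
  proof -
    have "real (n choose k) \<le> real n ^ k" using binomial_le_power by (metis of_nat_le_iff of_nat_power)
    hence "real (n choose k) ^ s \<le> (real n ^ k) ^ s" by (intro power_mono) auto
    thus ?thesis by (simp add: power_mult)
  qed
  have "copy_const / real n ^ (s - 1) = (real n / (2 * real ?N)) ^ ?N * ((\<Prod>i<s. ?W i) / (real n ^ ?N * real n ^ (s - 1)))"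
    unfolding copy_const_def using n0 by (simp add: power_divide)
  also have "\<dots> \<le> real h ^ ?N * ((\<Prod>i<s. ?W i) / real (n choose k) ^ s)"
    by (intro mult_mono power_mono h2 divide_left_mono order_trans[OF nk *] W0 divide_nonneg_nonneg mult_pos_pos)
       (use n0 Cnk in auto)
  finally have "copy_const / real n ^ (s - 1) \<le> Pr (copies k T h l)" unfolding eq .
  thus ?thesis unfolding h_def .
qed

end

section \<open>Overlapping copies and the second moment\<close>

text \<open>A list \<open>l'\<close> is determined by the sorted list \<open>w\<close> of its
  \<open>t\<close> new elements and by the positions of its entries in \<open>l @ w\<close>, which
  has length at most \<open>2 s\<close>.\<close>

lemma card_overlapping_lists_le:
  assumes "length l = s"
  shows "card {l'. set l' \<subseteq> {..<M} \<and> length l' = s \<and> card (set l' - set l) = t} \<le> M ^ t * (2 * s) ^ s"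
proof -
  let ?W = "{w. set w \<subseteq> {..<M} \<and> length w = t}" and ?C = "{c. set c \<subseteq> {..<2 * s} \<and> length c = s}"
  let ?f = "\<lambda>(w, c). map ((!) (l @ w)) c"
  have fin: "finite (?W \<times> ?C)" by (intro finite_cartesian_product finite_lists_length_eq) auto
  have "{l'. set l' \<subseteq> {..<M} \<and> length l' = s \<and> card (set l' - set l) = t} \<subseteq> ?f ` (?W \<times> ?C)"
  proof safe
    fix l' assume l': "set l' \<subseteq> {..<M}" "s = length l'" "t = card (set l' - set l)"
    define w where "w = sorted_list_of_set (set l' - set l)"
    have w: "set w = set l' - set l" "length w = t" using l' by (auto simp: w_def)
    have "t \<le> s" using l' card_mono[of "set l'" "set l' - set l"] card_length[of l'] by auto
    have "\<forall>x\<in>set l'. \<exists>i<2 * s. (l @ w) ! i = x"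
    proof
      fix x assume "x \<in> set l'"
      hence "x \<in> set (l @ w)" using w by auto
      then obtain i where i: "i < length (l @ w)" "(l @ w) ! i = x" by (metis in_set_conv_nth)
      have "i < 2 * s" using i(1) assms w(2) \<open>t \<le> s\<close> by simp
      thus "\<exists>i<2 * s. (l @ w) ! i = x" using i(2) by blast
    qed
    then obtain f where f: "\<And>x. x \<in> set l' \<Longrightarrow> f x < 2 * s \<and> (l @ w) ! f x = x" by metis
    have "l' = ?f (w, map f l')" using f by (simp add: map_idI)
    moreover have "(w, map f l') \<in> ?W \<times> ?C" using f w l' by auto
    ultimately show "l' \<in> ?f ` ({w. set w \<subseteq> {..<M} \<and> length w = card (set l' - set l)} \<times> {c. set c \<subseteq> {..<2 * length l'} \<and> length c = length l'})"
      unfolding l'(2,3) by (rule image_eqI)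
  qed
  hence "card {l'. set l' \<subseteq> {..<M} \<and> length l' = s \<and> card (set l' - set l) = t} \<le> card (?f ` (?W \<times> ?C))"
    using fin by (intro card_mono) auto
  also have "\<dots> \<le> card (?W \<times> ?C)" by (rule card_image_le[OF fin])
  also have "\<dots> = M ^ t * (2 * s) ^ s" by (simp add: card_cartesian_product card_lists_length_eq)
  finally show ?thesis .
qed

text \<open>The falling factorial has \<open>s\<close> factors, each at least
  \<open>M - s + 1\<close>, and \<open>s (M - s + 1) - M = (s - 1) (M - s) \<ge> 0\<close>.\<close>

lemma card_distinct_lists_ge:
  assumes "1 \<le> s" "s \<le> M"
  shows "(real M / real s) ^ s \<le> real (card {l. length l = s \<and> distinct l \<and> set l \<subseteq> {..<M}})"
proof -
  have "real M \<le> real s * real (M - s + 1)"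
  proof -
    have "0 \<le> (real s - 1) * (real M - real s)" using assms by simp
    thus ?thesis using assms by (simp add: of_nat_diff algebra_simps)
  qed
  hence "(real M / real s) ^ s \<le> real (M - s + 1) ^ s"
    using assms by (intro power_mono) (auto simp: field_simps)
  also have "\<dots> = (\<Prod>i\<in>{M - s + 1..M}. real (M - s + 1))" using assms by simp
  also have "\<dots> \<le> (\<Prod>i\<in>{M - s + 1..M}. real i)" by (rule prod_mono) auto
  also have "\<dots> = real (card {l. length l = s \<and> distinct l \<and> set l \<subseteq> {..<M}})"
    using assms card_lists_distinct_length_eq[of "{..<M}" s] by simp
  finally show ?thesis .
qed

context factor_tree begin

text \<open>The factor \<open>s\<close> counts the possible numbers of new rows,
  \<open>(2 s) ^ s\<close> comes from encoding overlapping lists, and the last factor is the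
  constant for connectivity of at most \<open>2 s\<close> rows.\<close>

definition overlap_const :: real where
  "overlap_const = real s * (2 * real s) ^ s * (2 * real s * ((real k)\<^sup>2 * (2 * real s))) ^ (2 * s)"

lemma overlap_const_pos: "0 < overlap_const"
  using s_pos k1 unfolding overlap_const_def by (intro mult_pos_pos zero_less_power) auto

end

context tree_in_random_system begin

text \<open>Both copies are connected and share a row, so their union is a connected set of
  \<open>s + t\<close> rows, where \<open>t\<close> is the number of new ones. The way in which they
  overlap need not be examined.\<close>

lemma Pr_copies_overlap:
  assumes l: "length l = s" "set l \<subseteq> {..<m}" and l': "length l' = s" "set l' \<subseteq> {..<m}"
    and dist: "distinct l" and meet: "set l \<inter> set l' \<noteq> {}"
  shows "Pr (copies k T h l \<inter> copies k T h l') \<le>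
    (2 * real s * ((real k)\<^sup>2 * (2 * real s))) ^ (2 * s) / (real n ^ (s - 1) * real n ^ card (set l' - set l))"
proof -
  let ?U = "set l \<union> set l'" and ?t = "card (set l' - set l)" and ?D = "(real k)\<^sup>2 * (2 * real s)"
  have D1: "1 \<le> ?D"
  proof -
    have "1 \<le> k\<^sup>2 * (2 * s)" using k1 s_pos by simp
    hence "real 1 \<le> real (k\<^sup>2 * (2 * s))" by (simp only: of_nat_le_iff)
    thus ?thesis by simp
  qed
  have cl: "card (set l) = s" using l dist by (simp add: distinct_card)
  have "?U = set l \<union> (set l' - set l)" by auto
  hence cU: "card ?U = s + ?t" using cl card_Un_disjoint[of "set l" "set l' - set l"] by auto
  have "?t \<le> card (set l')" by (rule card_mono) auto
  hence ts: "?t \<le> s" using card_length[of l'] l' by simp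
  have "Pr (copies k T h l \<inter> copies k T h l') \<le> Pr {w. conn (cols w) ?U}"
    by (rule measure_pmf.finite_measure_mono)
       (use conn_Un[OF copies_conn[OF _ l(1)] copies_conn[OF _ l'(1)] meet] in auto)
  also have "\<dots> \<le> real (2 * s) ^ (2 * s) * ((real k)\<^sup>2 * real (2 * s) / real n) ^ (card ?U - 1)"
    by (rule Pr_conn) (use l l' meet cU ts in auto)
  also have "\<dots> = (2 * real s) ^ (2 * s) * (?D ^ (s + ?t - 1) / real n ^ (s - 1 + ?t))"
    using s_pos by (simp add: cU power_divide)
  also have "\<dots> \<le> (2 * real s) ^ (2 * s) * (?D ^ (2 * s) / real n ^ (s - 1 + ?t))"
    by (intro mult_left_mono divide_right_mono power_increasing D1) (use ts in auto)
  also have "\<dots> = (2 * real s * ?D) ^ (2 * s) / (real n ^ (s - 1) * real n ^ ?t)"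
    by (simp only: power_mult_distrib power_add times_divide_eq_right)
  finally show ?thesis .
qed

text \<open>With \<open>\<mu> = M ^ s / n ^ (s - 1)\<close>, disjoint pairs of lists contribute at
  most the square of the first moment and overlapping ones at most a constant times
  \<open>\<mu>\<close>. The first moment is itself at least a constant times
  \<open>\<mu>\<close>.\<close>

lemma sat_prob_le_second_moment:
  assumes M: "s \<le> M" "M \<le> m" "M \<le> n"
  shows "sat_prob k (product_dist k P) Q m n \<le>
    overlap_const / ((copy_const / real s ^ s)\<^sup>2 * (real M ^ s / real n ^ (s - 1)) + overlap_const)"
proof -
  define h where "h = n div card (vars T)"
  define I where "I = {l. length l = s \<and> distinct l \<and> set l \<subseteq> {..<M}}"
  let ?A = "copies k T h" and ?\<mu> = "real M ^ s / real n ^ (s - 1)"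
  let ?F = "(2 * real s * ((real k)\<^sup>2 * (2 * real s))) ^ (2 * s)"
  have n0: "0 < real n" using n_pos by simp
  have M0: "0 < real M" using M s_pos by simp
  have subI: "I \<subseteq> {l. set l \<subseteq> {..<M} \<and> length l = s}" by (auto simp: I_def)
  have finI: "finite I" by (rule finite_subset[OF subI finite_lists_length_eq]) simp
  have "card I \<le> M ^ s"
    using card_mono[OF finite_lists_length_eq subI] card_lists_length_eq[of "{..<M}" s] by simp
  hence cI: "real (card I) \<le> real M ^ s" by (metis of_nat_le_iff of_nat_power)
  have I: "length l = s" "distinct l" "set l \<subseteq> {..<m}" "set l \<subseteq> {..<M}" if "l \<in> I" for l
    using that M by (auto simp: I_def)
  define S1 where "S1 = (\<Sum>l\<in>I. Pr (?A l))"
  define S2 where "S2 = (\<Sum>l\<in>I. \<Sum>l'\<in>I. Pr (?A l \<inter> ?A l'))"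
  have overlap: "(\<Sum>l'\<in>{l'\<in>I. set l \<inter> set l' \<noteq> {}}. Pr (?A l \<inter> ?A l')) \<le> overlap_const / real n ^ (s - 1)"
    if l: "l \<in> I" for l
  proof -
    let ?J = "{l'\<in>I. set l \<inter> set l' \<noteq> {}}" and ?d = "\<lambda>l'. card (set l' - set l)"
    have fJ: "finite ?J" using finI by simp
    \<comment> \<open>Lists that meet have fewer than \<open>s\<close> new rows, so \<open>t\<close>
      takes at most \<open>s\<close> values.\<close>
    have img: "?d ` ?J \<subseteq> {..<s}"
    proof (rule image_subsetI)
      fix l' assume l': "l' \<in> ?J"
      hence "card (set l' - set l) < card (set l')" by (intro psubset_card_mono) auto
      thus "card (set l' - set l) \<in> {..<s}" using I[of l'] l' by (simp add: distinct_card)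
    qed
    have "(\<Sum>l'\<in>?J. Pr (?A l \<inter> ?A l')) \<le> (\<Sum>l'\<in>?J. ?F / (real n ^ (s - 1) * real n ^ ?d l'))"
      by (intro sum_mono Pr_copies_overlap) (use I l in auto)
    also have "\<dots> = (\<Sum>t<s. \<Sum>l'\<in>{l'\<in>?J. ?d l' = t}. ?F / (real n ^ (s - 1) * real n ^ ?d l'))"
      by (rule sum.group[symmetric, OF fJ _ img]) simp
    also have "\<dots> \<le> (\<Sum>t<s. (2 * real s) ^ s * ?F / real n ^ (s - 1))"
    proof (rule sum_mono)
      fix t
      let ?K = "{l'. set l' \<subseteq> {..<M} \<and> length l' = s \<and> card (set l' - set l) = t}"
      have "finite ?K" by (rule finite_subset[OF _ finite_lists_length_eq[of "{..<M}" s]]) auto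
      hence "card {l'\<in>?J. ?d l' = t} \<le> card ?K" by (rule card_mono) (use subI in auto)
      also have "\<dots> \<le> M ^ t * (2 * s) ^ s" by (rule card_overlapping_lists_le) (use I l in auto)
      finally have "real (card {l'\<in>?J. ?d l' = t}) \<le> real (M ^ t * (2 * s) ^ s)" by (simp only: of_nat_le_iff)
      also have "\<dots> = real M ^ t * (2 * real s) ^ s" by simp
      \<comment> \<open>This is the purpose of \<open>M \<le> n\<close>: the \<open>M ^ t\<close>
        choices of new rows cancel against the factor \<open>n ^ t\<close> in the probability, so
        all overlap sizes obey the same bound.\<close>
      also have "\<dots> \<le> real n ^ t * (2 * real s) ^ s"
        using M by (intro mult_right_mono power_mono) auto
      finally have c: "real (card {l'\<in>?J. ?d l' = t}) \<le> real n ^ t * (2 * real s) ^ s" .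
      have "(\<Sum>l'\<in>{l'\<in>?J. ?d l' = t}. ?F / (real n ^ (s - 1) * real n ^ ?d l'))
          = real (card {l'\<in>?J. ?d l' = t}) * (?F / (real n ^ (s - 1) * real n ^ t))" by simp
      also have "\<dots> \<le> (real n ^ t * (2 * real s) ^ s) * (?F / (real n ^ (s - 1) * real n ^ t))"
        by (rule mult_right_mono[OF c]) simp
      also have "\<dots> = (2 * real s) ^ s * ?F / real n ^ (s - 1)" using n0 by (simp del: power_mult_distrib)
      finally show "(\<Sum>l'\<in>{l'\<in>?J. ?d l' = t}. ?F / (real n ^ (s - 1) * real n ^ ?d l'))
          \<le> (2 * real s) ^ s * ?F / real n ^ (s - 1)" .
    qed
    also have "\<dots> = overlap_const / real n ^ (s - 1)" by (simp add: overlap_const_def)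
    finally show ?thesis .
  qed
  have indep: "Pr (?A l \<inter> ?A l') = Pr (?A l) * Pr (?A l')" if "set l \<inter> set l' = {}" for l l'
    unfolding rows_def by (rule prob_Pi_pmf_indep[OF _ depends_on_copies depends_on_copies that]) simp
  have "S2 \<le> (\<Sum>l\<in>I. (\<Sum>l'\<in>I. Pr (?A l) * Pr (?A l')) + overlap_const / real n ^ (s - 1))"
    unfolding S2_def
  proof (rule sum_mono)
    fix l assume l: "l \<in> I"
    have "(\<Sum>l'\<in>I. Pr (?A l \<inter> ?A l')) =
        (\<Sum>l'\<in>{l'\<in>I. set l \<inter> set l' = {}} \<union> {l'\<in>I. set l \<inter> set l' \<noteq> {}}. Pr (?A l \<inter> ?A l'))"
      by (rule sum.cong) auto
    also have "\<dots> = (\<Sum>l'\<in>{l'\<in>I. set l \<inter> set l' = {}}. Pr (?A l \<inter> ?A l'))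
        + (\<Sum>l'\<in>{l'\<in>I. set l \<inter> set l' \<noteq> {}}. Pr (?A l \<inter> ?A l'))"
      by (rule sum.union_disjoint) (use finI in auto)
    also have "(\<Sum>l'\<in>{l'\<in>I. set l \<inter> set l' = {}}. Pr (?A l \<inter> ?A l')) =
        (\<Sum>l'\<in>{l'\<in>I. set l \<inter> set l' = {}}. Pr (?A l) * Pr (?A l'))"
      by (rule sum.cong[OF refl]) (simp add: indep)
    also have "\<dots> \<le> (\<Sum>l'\<in>I. Pr (?A l) * Pr (?A l'))"
      by (rule sum_mono2[OF finI]) auto
    finally show "(\<Sum>l'\<in>I. Pr (?A l \<inter> ?A l')) \<le> (\<Sum>l'\<in>I. Pr (?A l) * Pr (?A l')) + overlap_const / real n ^ (s - 1)"
      using overlap[OF l] by linarith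
  qed
  also have "\<dots> = S1\<^sup>2 + real (card I) * (overlap_const / real n ^ (s - 1))"
    by (simp add: sum.distrib S1_def power2_eq_square sum_product)
  also have "\<dots> \<le> S1\<^sup>2 + real M ^ s * (overlap_const / real n ^ (s - 1))"
    using overlap_const_pos by (intro add_left_mono mult_right_mono cI) auto
  finally have S2: "S2 \<le> S1\<^sup>2 + overlap_const * ?\<mu>" by (simp add: mult.commute)
  have \<mu>0: "0 < ?\<mu>" using M0 n0 by simp
  have S1: "(copy_const / real s ^ s) * ?\<mu> \<le> S1"
  proof -
    have "(copy_const / real s ^ s) * ?\<mu> = (real M / real s) ^ s * (copy_const / real n ^ (s - 1))"
      by (simp add: power_divide)
    also have "\<dots> \<le> real (card I) * (copy_const / real n ^ (s - 1))"
      using card_distinct_lists_ge[OF s_pos M(1)] copy_const_pos unfolding I_def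
      by (intro mult_right_mono) auto
    also have "\<dots> = (\<Sum>l\<in>I. copy_const / real n ^ (s - 1))" by simp
    also have "\<dots> \<le> S1" unfolding S1_def h_def by (intro sum_mono Pr_copies_ge) (use I in auto)
    finally show ?thesis .
  qed
  have B: "0 < S1\<^sup>2 + overlap_const * ?\<mu>" by (intro add_nonneg_pos mult_pos_pos overlap_const_pos \<mu>0) simp
  have "S1\<^sup>2 / (S1\<^sup>2 + overlap_const * ?\<mu>) \<le> Pr (\<Union>l\<in>I. ?A l)"
    unfolding S1_def by (rule second_moment_bound[OF finI]) (use S2 B in \<open>auto simp: S1_def S2_def\<close>)
  also have "\<dots> \<le> Pr (- {w. fg_satisfiable (fgraph k w {..<m})})"
    by (rule measure_pmf.finite_measure_mono) (use copies_unsat I in auto)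
  also have "\<dots> = 1 - sat_prob k (product_dist k P) Q m n"
    using measure_pmf.prob_compl[of "{w. fg_satisfiable (fgraph k w {..<m})}" rows]
    by (simp add: Compl_eq_Diff_UNIV sat_prob_eq)
  finally have "sat_prob k (product_dist k P) Q m n \<le> 1 - S1\<^sup>2 / (S1\<^sup>2 + overlap_const * ?\<mu>)" by simp
  also have "\<dots> = overlap_const * ?\<mu> / (S1\<^sup>2 + overlap_const * ?\<mu>)"
  proof -
    have "1 - x / (x + y) = y / (x + y)" if "0 < x + y" for x y :: real
      using that by (simp add: field_simps)
    thus ?thesis using B by blast
  qed
  \<comment> \<open>The bound decreases in the first moment, which may therefore be replaced by its
    lower estimate.\<close>
  also have "\<dots> \<le> overlap_const * ?\<mu> / (((copy_const / real s ^ s) * ?\<mu>)\<^sup>2 + overlap_const * ?\<mu>)"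
  proof (rule divide_left_mono)
    show "((copy_const / real s ^ s) * ?\<mu>)\<^sup>2 + overlap_const * ?\<mu> \<le> S1\<^sup>2 + overlap_const * ?\<mu>"
      by (intro add_right_mono power_mono S1) (use copy_const_pos \<mu>0 in auto)
    show "0 < (S1\<^sup>2 + overlap_const * ?\<mu>) * (((copy_const / real s ^ s) * ?\<mu>)\<^sup>2 + overlap_const * ?\<mu>)"
      by (intro mult_pos_pos[OF B] add_nonneg_pos mult_pos_pos overlap_const_pos \<mu>0) simp
  qed (use overlap_const_pos \<mu>0 in auto)
  also have "\<dots> = overlap_const / ((copy_const / real s ^ s)\<^sup>2 * ?\<mu> + overlap_const)"
  proof -
    have "d * u / ((c * u)\<^sup>2 + d * u) = d / (c\<^sup>2 * u + d)" if "0 < u" for c d u :: real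
    proof -
      have "(c * u)\<^sup>2 + d * u = (c\<^sup>2 * u + d) * u" by (simp add: power2_eq_square algebra_simps)
      thus ?thesis using that by simp
    qed
    thus ?thesis using \<mu>0 by blast
  qed
  finally show ?thesis .
qed

end

section \<open>Limits\<close>

lemma tendsto_1_sandwich:
  fixes f :: "nat \<Rightarrow> real"
  assumes "eventually (\<lambda>n. 1 - g n \<le> f n) sequentially" "\<And>n. f n \<le> 1" "g \<longlonglongrightarrow> 0"
  shows "f \<longlonglongrightarrow> 1"
proof (rule tendsto_sandwich[OF assms(1)])
  show "(\<lambda>n. 1 - g n) \<longlonglongrightarrow> 1" using tendsto_diff[OF tendsto_const assms(3), of 1] by simp
qed (use assms(2) in auto)

lemma sat_prob_bounds: "0 \<le> sat_prob k Phat Q m n" "sat_prob k Phat Q m n \<le> 1"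
  by (simp_all add: sat_prob_def)

lemma eventually_sparse:
  assumes "(\<lambda>n. real (m n) / real n) \<longlonglongrightarrow> 0"
  shows "eventually (\<lambda>n. 4 * k\<^sup>2 * m n \<le> n) sequentially"
proof -
  have "eventually (\<lambda>n. real (m n) / real n < 1 / (4 * (real k)\<^sup>2 + 1)) sequentially"
    by (rule order_tendstoD(2)[OF assms]) (simp add: add_nonneg_pos)
  thus ?thesis using eventually_gt_at_top[of 0]
  proof eventually_elim
    case (elim n)
    have "0 < 4 * (real k)\<^sup>2 + 1" by (simp add: add_nonneg_pos)
    hence "(4 * (real k)\<^sup>2 + 1) * real (m n) < real n" using elim by (simp add: field_simps)
    hence "4 * (real k)\<^sup>2 * real (m n) \<le> real n" by (simp add: algebra_simps)
    hence "real (4 * k\<^sup>2 * m n) \<le> real n" by simp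
    thus ?case by (simp only: of_nat_le_iff)
  qed
qed

lemma cycle_term_tendsto_0:
  assumes "(\<lambda>n. real (m n) / real n) \<longlonglongrightarrow> 0"
  shows "(\<lambda>n. 2 * (2 * (real k)\<^sup>2 * real (m n) / real n)\<^sup>2) \<longlonglongrightarrow> 0"
proof -
  have "(\<lambda>n. 2 * (2 * (real k)\<^sup>2 * (real (m n) / real n))\<^sup>2) \<longlonglongrightarrow> 2 * (2 * (real k)\<^sup>2 * 0)\<^sup>2"
    by (intro tendsto_intros assms)
  thus ?thesis by simp
qed

lemma sat_prob_tendsto_1_no_trees:
  fixes P Q :: "'r::{finite,comm_ring_1} pmf"
  assumes "2 \<le> k" "unsat_trees k P Q = {}" "(\<lambda>n. real (m n) / real n) \<longlonglongrightarrow> 0"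
  shows "(\<lambda>n. sat_prob k (product_dist k P) Q (m n) n) \<longlonglongrightarrow> 1"
proof (rule tendsto_1_sandwich[OF _ sat_prob_bounds(2) cycle_term_tendsto_0[OF assms(3), of k]])
  show "eventually (\<lambda>n. 1 - 2 * (2 * (real k)\<^sup>2 * real (m n) / real n)\<^sup>2
      \<le> sat_prob k (product_dist k P) Q (m n) n) sequentially"
    using eventually_sparse[OF assms(3), of k] eventually_ge_at_top[of k]
  proof eventually_elim
    case (elim n)
    interpret random_system k "m n" n P Q by unfold_locales (use assms elim in auto)
    show ?case by (rule Pr_sat_ge_acyclic[OF elim(1) assms(2)])
  qed
qed

lemma sat_prob_tendsto_1_small_trees:
  fixes P Q :: "'r::{finite,comm_ring_1} pmf"
  assumes k: "2 \<le> k" and s: "1 \<le> s" "\<And>T. T \<in> unsat_trees k P Q \<Longrightarrow> s \<le> card (constrs T)"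
    and m: "(\<lambda>n. real (m n) / real n) \<longlonglongrightarrow> 0" and \<mu>: "(\<lambda>n. real (m n) ^ s / real n ^ (s - 1)) \<longlonglongrightarrow> 0"
  shows "(\<lambda>n. sat_prob k (product_dist k P) Q (m n) n) \<longlonglongrightarrow> 1"
proof (rule tendsto_1_sandwich[OF _ sat_prob_bounds(2)])
  let ?g = "\<lambda>n. ((real k)\<^sup>2 * real s) ^ (s - 1) * (real (m n) ^ s / real n ^ (s - 1))
     + 2 * (2 * (real k)\<^sup>2 * real (m n) / real n)\<^sup>2"
  show "?g \<longlonglongrightarrow> 0"
    using tendsto_add[OF tendsto_mult[OF tendsto_const \<mu>] cycle_term_tendsto_0[OF m]] by simp
  show "eventually (\<lambda>n. 1 - ?g n \<le> sat_prob k (product_dist k P) Q (m n) n) sequentially"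
    using eventually_sparse[OF m, of k] eventually_ge_at_top[of k]
  proof eventually_elim
    case (elim n)
    interpret random_system k "m n" n P Q by unfold_locales (use k elim in auto)
    let ?B = "{w. \<exists>K\<subseteq>{..<m n}. conn (cols w) K \<and> s \<le> card K}"
    have "Pr (- ?B) - 2 * (2 * (real k)\<^sup>2 * real (m n) / real n)\<^sup>2 \<le> sat_prob k (product_dist k P) Q (m n) n"
      by (rule Pr_sat_ge_no_conn[OF elim(1) s(2)])
    moreover have "Pr (- ?B) = 1 - Pr ?B"
      using measure_pmf.prob_compl[of ?B rows] by (simp add: Compl_eq_Diff_UNIV)
    moreover have "Pr ?B \<le> ((real k)\<^sup>2 * real s) ^ (s - 1) * (real (m n) ^ s / real n ^ (s - 1))"
      using Pr_large_conn[OF s(1)] by (simp add: power_divide mult.commute)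
    ultimately show ?case by linarith
  qed
qed

text \<open>The \<open>|R| ^ n\<close> assignments lose against \<open>(1 - \<delta>) ^ m\<close>
  because \<open>m\<close> outgrows every multiple of \<open>n\<close>.\<close>

lemma sat_prob_tendsto_0_dense:
  fixes P Q :: "'r::{finite,comm_ring_1} pmf"
  assumes k: "2 \<le> k" and A2: "cond_A2 k (product_dist k P) Q" and m: "(\<lambda>n. real n) \<in> o(\<lambda>n. real (m n))"
  shows "(\<lambda>n. sat_prob k (product_dist k P) Q (m n) n) \<longlonglongrightarrow> 0"
proof -
  let ?r = "CARD('r)"
  obtain \<rho> where \<rho>: "0 < \<rho>" "\<rho> \<le> 1"
    "\<And>s. \<exists>a b. \<rho> \<le> pmf (product_dist k P) a * pmf Q b \<and> (\<Sum>i<k. a i * s) \<noteq> b"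
    using cond_A2_uniform[OF A2] by blast
  define \<delta> where "\<delta> = (1 / (2 * real ?r)) ^ k * \<rho>"
  have r1: "1 \<le> real ?r" by (simp add: Suc_leI)
  have \<delta>0: "0 < \<delta>" using r1 \<rho> by (simp add: \<delta>_def)
  have "1 / (2 * real ?r) \<le> 1" using r1 by (subst divide_le_eq_1_pos) linarith+
  hence "(1 / (2 * real ?r)) ^ k \<le> 1" by (intro power_le_one) auto
  hence \<delta>1: "\<delta> \<le> 1" unfolding \<delta>_def using \<rho> by (intro mult_le_one) auto
  \<comment> \<open>Chosen so that \<open>n ln |R|\<close> is at most half of
    \<open>\<delta> m\<close>; the summand 1 keeps the denominator positive.\<close>
  define \<epsilon> where "\<epsilon> = \<delta> / (2 * (ln (real ?r) + 1))"
  have lnr: "0 \<le> ln (real ?r)" using r1 by simp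
  hence ln1: "0 < ln (real ?r) + 1" by linarith
  have \<epsilon>0: "0 < \<epsilon>" unfolding \<epsilon>_def by (intro divide_pos_pos mult_pos_pos \<delta>0 ln1) simp
  have "eventually (\<lambda>n. norm (real n) \<le> \<epsilon> * norm (real (m n))) sequentially"
    by (rule landau_o.smallD[OF m \<epsilon>0])
  moreover have "eventually (\<lambda>n. norm (real n) \<le> 1 * norm (real (m n))) sequentially"
    by (rule landau_o.smallD[OF m]) simp
  ultimately have le: "eventually (\<lambda>n. sat_prob k (product_dist k P) Q (m n) n \<le> exp (- (\<delta> / 2) * real n)) sequentially"
    using eventually_ge_at_top[of k] eventually_ge_at_top[of "2 * ?r * k"]
  proof eventually_elim
    case (elim n)
    interpret random_system k "m n" n P Q by unfold_locales (use k elim in auto)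
    have "sat_prob k (product_dist k P) Q (m n) n \<le> real ?r ^ n * (1 - \<delta>) ^ m n"
      unfolding \<delta>_def by (rule sat_prob_le_union_bound[OF \<rho>(1,3) elim(4)])
    also have "\<dots> \<le> exp (ln (real ?r)) ^ n * exp (- \<delta>) ^ m n"
      using \<delta>1 r1 exp_ge_add_one_self[of "- \<delta>"] by (intro mult_mono power_mono) auto
    also have "\<dots> = exp (real n * ln (real ?r) - \<delta> * real (m n))"
      unfolding exp_of_nat_mult[symmetric] exp_add[symmetric] by (simp add: mult.commute)
    also have "\<dots> \<le> exp (- (\<delta> / 2) * real n)"
    proof -
      have "real n * ln (real ?r) \<le> (\<epsilon> * real (m n)) * (ln (real ?r) + 1)"
        using elim(1) lnr \<epsilon>0 by (intro mult_mono) auto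
      also have "\<dots> = \<delta> / 2 * real (m n)" 
      proof -
        have "\<delta> / (2 * y) * x * y = \<delta> / 2 * x" if "0 < y" for x y using that by simp
        thus ?thesis unfolding \<epsilon>_def using ln1 by blast
      qed
      finally have "real n * ln (real ?r) - \<delta> * real (m n) \<le> - (\<delta> / 2 * real (m n))" by linarith
      moreover have "\<delta> / 2 * real n \<le> \<delta> / 2 * real (m n)" using elim(2) \<delta>0 by (intro mult_left_mono) auto
      ultimately show ?thesis by simp
    qed
    finally show ?case .
  qed
  have lim: "(\<lambda>n. exp (- (\<delta> / 2) * real n)) \<longlonglongrightarrow> 0" using \<delta>0 by real_asymp
  show ?thesis
    by (rule tendsto_sandwich[OF _ le tendsto_const lim]) (simp add: sat_prob_bounds)
qed

text \<open>The constants and the required size of \<open>n\<close> depend only on \<open>T\<close>,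
  \<open>k\<close>, \<open>P\<close> and \<open>Q\<close>. Uniformity in \<open>m\<close> permits
  the use of one bound both for arbitrary sequences above the threshold and at the
  threshold.\<close>

lemma sat_prob_le_tree:
  fixes P Q :: "'r::{finite,comm_ring_1} pmf"
  assumes k: "2 \<le> k" and T: "T \<in> unsat_trees k P Q"
  defines "s \<equiv> card (constrs T)"
  shows "\<exists>c>0. \<exists>d>0. \<forall>\<^sub>F n in sequentially. \<forall>m. s \<le> min m n \<longrightarrow>
    sat_prob k (product_dist k P) Q m n \<le> d / (c * (real (min m n) ^ s / real n ^ (s - 1)) + d)"
proof -
  interpret factor_tree k T P Q by unfold_locales (use T k in auto)
  have "\<forall>\<^sub>F n in sequentially. \<forall>m. s \<le> min m n \<longrightarrow>
    sat_prob k (product_dist k P) Q m n \<le>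
      overlap_const / ((copy_const / real s ^ s)\<^sup>2 * (real (min m n) ^ s / real n ^ (s - 1)) + overlap_const)"
    using eventually_ge_at_top[of k] eventually_ge_at_top[of "card (vars T)"]
  proof (eventually_elim, intro allI impI)
    fix n m :: nat assume n: "k \<le> n" "card (vars T) \<le> n" "s \<le> min m n"
    interpret tree_in_random_system k m n T P Q by unfold_locales (use k n in auto)
    show "sat_prob k (product_dist k P) Q m n \<le>
      overlap_const / ((copy_const / real s ^ s)\<^sup>2 * (real (min m n) ^ s / real n ^ (s - 1)) + overlap_const)"
      unfolding s_def by (rule sat_prob_le_second_moment) (use n in \<open>auto simp: s_def\<close>)
  qed
  moreover have "0 < (copy_const / real s ^ s)\<^sup>2" using copy_const_pos s_pos by (simp add: s_def)
  ultimately show ?thesis using overlap_const_pos by blast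
qed

lemma eventually_ge_half_minus_vanishing:
  fixes f :: "nat \<Rightarrow> real"
  assumes "eventually (\<lambda>n. c - g n \<le> f n) sequentially" "g \<longlonglongrightarrow> 0" "0 < c"
  shows "eventually (\<lambda>n. c / 2 \<le> f n) sequentially"
proof -
  have "eventually (\<lambda>n. g n < c / 2) sequentially"
    by (rule order_tendstoD(2)[OF assms(2)]) (use assms in simp)
  with assms(1) show ?thesis by eventually_elim linarith
qed

text \<open>At the threshold \<open>q m ^ s\<close> remains bounded, so the local lemma leaves a
  positive constant, while \<open>s \<ge> 2\<close> and \<open>m / n\<close> tending to 0 fulfil its
  conditions and make the cycle term vanish.\<close>

lemma sat_prob_bounded_below:
  fixes P Q :: "'r::{finite,comm_ring_1} pmf"
  assumes k: "2 \<le> k" and s: "2 \<le> s" "\<And>T. T \<in> unsat_trees k P Q \<Longrightarrow> s \<le> card (constrs T)"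
    and m: "(\<lambda>n. real (m n) / real n) \<longlonglongrightarrow> 0"
    and \<mu>: "eventually (\<lambda>n. real (m n) ^ s / real n ^ (s - 1) \<le> D) sequentially"
  shows "\<exists>c>0. eventually (\<lambda>n. c \<le> sat_prob k (product_dist k P) Q (m n) n) sequentially"
proof -
  define H where "H = real s ^ s * ((real k)\<^sup>2 * real s) ^ (s - 1)"
  define q where "q n = real s ^ s * ((real k)\<^sup>2 * real s / real n) ^ (s - 1)" for n
  have H0: "0 \<le> H" by (simp add: H_def)
  have q: "q n = H / real n ^ (s - 1)" for n by (simp add: q_def H_def power_divide)
  have "(\<lambda>n. H * (1 / real n) ^ (s - 1)) \<longlonglongrightarrow> H * 0 ^ (s - 1)"
    by (intro tendsto_intros lim_1_over_n)
  hence "(\<lambda>n. q n) \<longlonglongrightarrow> 0" using s(1) by (simp add: q power_divide power_0_left)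
  hence ev1: "eventually (\<lambda>n. q n < 1/4) sequentially" by (rule order_tendstoD(2)) simp
  have "(\<lambda>n. 4 * H * real s * (real (m n) / real n) ^ (s - 1)) \<longlonglongrightarrow> 4 * H * real s * 0 ^ (s - 1)"
    by (intro tendsto_intros m)
  hence "(\<lambda>n. 4 * q n * (real s * real (m n) ^ (s - 1))) \<longlonglongrightarrow> 0"
    using s(1) by (simp add: q power_divide power_0_left mult_ac)
  hence ev2: "eventually (\<lambda>n. 4 * q n * (real s * real (m n) ^ (s - 1)) < 1) sequentially"
    by (rule order_tendstoD(2)) simp
  have "eventually (\<lambda>n. exp (- 4 * H * D) - 2 * (2 * (real k)\<^sup>2 * real (m n) / real n)\<^sup>2
      \<le> sat_prob k (product_dist k P) Q (m n) n) sequentially"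
    using eventually_sparse[OF m, of k] eventually_ge_at_top[of k] ev1 ev2 \<mu>
  proof eventually_elim
    case (elim n)
    interpret random_system k "m n" n P Q by unfold_locales (use k elim in auto)
    let ?B = "{w. \<exists>K\<subseteq>{..<m n}. conn (cols w) K \<and> s \<le> card K}"
    have "H * (real (m n) ^ s / real n ^ (s - 1)) \<le> H * D" by (rule mult_left_mono[OF elim(5) H0])
    hence "exp (- 4 * H * D) \<le> exp (- 4 * q n * real (m n) ^ s)" by (simp add: q)
    also have "\<dots> \<le> Pr (- ?B)"
      unfolding q_def by (rule Pr_no_large_conn_ge) (use s elim in \<open>auto simp: q_def\<close>)
    finally show ?case using Pr_sat_ge_no_conn[OF elim(1) s(2)] by linarith
  qed
  from eventually_ge_half_minus_vanishing[OF this cycle_term_tendsto_0[OF m]]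
  show ?thesis by (intro exI[of _ "exp (- 4 * H * D) / 2"]) auto
qed

text \<open>For \<open>s = 1\<close> the exponent is 0 and the number of rows is eventually
  constant, so the main term is a fixed positive number and the probability that two rows meet tends
  to 0.\<close>

lemma sat_prob_bounded_below_fixed:
  fixes P Q :: "'r::{finite,comm_ring_1} pmf"
  assumes k: "2 \<le> k" and A1: "cond_A1 k (product_dist k P) Q" and m: "eventually (\<lambda>n. m n = m0) sequentially"
  shows "\<exists>c>0. eventually (\<lambda>n. c \<le> sat_prob k (product_dist k P) Q (m n) n) sequentially"
proof -
  obtain a b where ab: "a \<in> set_pmf (product_dist k P)" "b \<in> set_pmf Q" "b \<in> module.span (*) (a ` {..<k})"
    using A1 unfolding cond_A1_def by blast
  let ?d = "pmf (product_dist k P) a * pmf Q b"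
  have d0: "0 < ?d ^ m0" using ab by (simp add: pmf_positive)
  have "eventually (\<lambda>n. ?d ^ m0 - (real m0)\<^sup>2 * ((real k)\<^sup>2 * 2 / real n)
      \<le> sat_prob k (product_dist k P) Q (m n) n) sequentially"
    using m eventually_ge_at_top[of k]
  proof eventually_elim
    case (elim n)
    interpret random_system k "m n" n P Q by unfold_locales (use k elim in auto)
    show ?case using sat_prob_ge_disjoint_rows[OF ab] elim by simp
  qed
  moreover have "(\<lambda>n. (real m0)\<^sup>2 * ((real k)\<^sup>2 * 2 / real n)) \<longlonglongrightarrow> 0" by real_asymp
  ultimately have "eventually (\<lambda>n. ?d ^ m0 / 2 \<le> sat_prob k (product_dist k P) Q (m n) n) sequentially"
    by (rule eventually_ge_half_minus_vanishing[OF _ _ d0])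
  thus ?thesis using d0 by (intro exI[of _ "?d ^ m0 / 2"]) auto
qed

section \<open>The threshold exponent\<close>

text \<open>The expected number of copies is, up to constants, the \<open>s\<close>-th power of the
  ratio of \<open>m\<close> to the threshold; this identity is the origin of the exponent
  \<open>1 - 1 / s\<close>.\<close>

lemma threshold_power:
  assumes "1 \<le> s" "0 < n"
  shows "x ^ s / real n ^ (s - 1) = (x / real n powr (1 - 1 / real s)) ^ s"
proof -
  have "(real n powr (1 - 1 / real s)) ^ s = real n powr (real s - 1)"
    using assms by (simp add: powr_realpow[symmetric] powr_powr algebra_simps diff_divide_distrib)
  also have "\<dots> = real n ^ (s - 1)"
    using assms by (simp add: powr_realpow[symmetric] of_nat_diff)
  finally show ?thesis by (simp add: power_divide)
qed

lemma unsat_trees_obtain_min: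
  assumes "unsat_trees k P Q \<noteq> {}"
  obtains T where "T \<in> unsat_trees k P Q" "threshold_exp k P Q = 1 - 1 / real (card (constrs T))"
    "1 \<le> card (constrs T)" "\<And>T'. T' \<in> unsat_trees k P Q \<Longrightarrow> card (constrs T) \<le> card (constrs T')"
proof -
  let ?C = "(\<lambda>T. card (constrs T)) ` unsat_trees k P Q"
  have "Inf ?C \<in> ?C" by (rule Inf_nat_def1) (use assms in simp)
  then obtain T where T: "T \<in> unsat_trees k P Q" "Inf ?C = card (constrs T)" by auto
  have "finite (constrs T)" using T(1) by (simp add: unsat_trees_def factor_graph_def)
  hence "1 \<le> card (constrs T)"
    using unsat_tree_card_vars(1)[OF T(1)] by (simp add: Suc_le_eq card_gt_0_iff)
  moreover have "card (constrs T) \<le> card (constrs T')" if "T' \<in> unsat_trees k P Q" for T'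
    unfolding T(2)[symmetric] by (rule cInf_lower) (use that in auto)
  ultimately show ?thesis using that T assms by (simp add: threshold_exp_def)
qed

theorem theorem1p8:
  fixes k :: nat and P Q :: "'r::{finite,comm_ring_1} pmf"
  assumes "k \<ge> 3"
    and "cond_A1 k (product_dist k P) Q"
    and "cond_A2 k (product_dist k P) Q"
  defines "\<alpha> \<equiv> threshold_exp k P Q"
    and "p \<equiv> sat_prob k (product_dist k P) Q"
  shows "(\<forall>m :: nat \<Rightarrow> nat.
            ((\<lambda>n. real (m n)) \<lless> (\<lambda>n. real n powr \<alpha>) \<longrightarrow> (\<lambda>n. p (m n) n) \<longlonglongrightarrow> 1) \<and>
            ((\<lambda>n. real n powr \<alpha>) \<lless> (\<lambda>n. real (m n)) \<longrightarrow> (\<lambda>n. p (m n) n) \<longlonglongrightarrow> 0)) \<and>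
         (\<alpha> < 1 \<longrightarrow>
            (\<forall>C>0. let q = (\<lambda>n. ereal (p (nat \<lceil>C * real n powr \<alpha>\<rceil>) n))
                    in 0 < liminf q \<and> liminf q \<le> limsup q \<and> limsup q < 1))"
proof (cases "unsat_trees k P Q = {}")
  case True
  hence \<alpha>: "\<alpha> = 1" by (simp add: \<alpha>_def threshold_exp_def)
  have k2: "2 \<le> k" using assms(1) by simp
  show ?thesis
  proof (intro conjI allI impI)
    fix m :: "nat \<Rightarrow> nat"
    assume "(\<lambda>n. real (m n)) \<lless> (\<lambda>n. real n powr \<alpha>)"
    hence "(\<lambda>n. real (m n)) \<in> o(\<lambda>n. real n)" by (simp add: much_less_def \<alpha>)
    thus "(\<lambda>n. p (m n) n) \<longlonglongrightarrow> 1"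
      unfolding p_def by (intro sat_prob_tendsto_1_no_trees k2 True smalloD_tendsto)
  next
    fix m :: "nat \<Rightarrow> nat"
    assume "(\<lambda>n. real n powr \<alpha>) \<lless> (\<lambda>n. real (m n))"
    hence "(\<lambda>n. real n) \<in> o(\<lambda>n. real (m n))" by (simp add: much_less_def \<alpha>)
    thus "(\<lambda>n. p (m n) n) \<longlonglongrightarrow> 0"
      unfolding p_def by (rule sat_prob_tendsto_0_dense[OF k2 assms(3)])
  qed (use \<alpha> in simp)
next
  case False
  then obtain T where T: "T \<in> unsat_trees k P Q" "\<alpha> = 1 - 1 / real (card (constrs T))"
    "1 \<le> card (constrs T)" "\<And>T'. T' \<in> unsat_trees k P Q \<Longrightarrow> card (constrs T) \<le> card (constrs T')"
    unfolding \<alpha>_def by (rule unsat_trees_obtain_min) blast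
  define s where "s = card (constrs T)"
  note s1 = T(3)[folded s_def] and \<alpha> = T(2)[folded s_def] and min = T(4)[folded s_def]
  have k2: "2 \<le> k" using assms(1) by simp
  have \<alpha>0: "0 \<le> \<alpha>" and \<alpha>1: "\<alpha> < 1" using s1 by (auto simp: \<alpha>)
  define y where "y m n = real m / real n powr \<alpha>" for m n :: nat
  have \<mu>: "real m ^ s / real n ^ (s - 1) = y m n ^ s" if "0 < n" for m n :: nat
    using threshold_power[OF s1 that] by (simp add: y_def \<alpha>)
  have powr_le: "real n powr \<alpha> \<le> real n" if "0 < n" for n :: nat
    using powr_mono[of \<alpha> 1 "real n"] \<alpha>1 that by simp
  have powr_ge: "1 \<le> real n powr \<alpha>" if "0 < n" for n :: nat
    using that \<alpha>0 by (intro ge_one_powr_ge_zero) auto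
  obtain c d where cd: "0 < c" "0 < d" and upper: "\<forall>\<^sub>F n in sequentially. \<forall>m. s \<le> min m n \<longrightarrow>
    sat_prob k (product_dist k P) Q m n \<le> d / (c * (real (min m n) ^ s / real n ^ (s - 1)) + d)"
    using sat_prob_le_tree[OF k2 T(1)] unfolding s_def by blast
  have upper': "\<forall>\<^sub>F n in sequentially. \<forall>m. s \<le> min m n \<longrightarrow> p m n \<le> d / (c * y (min m n) n ^ s + d)"
    using upper eventually_gt_at_top[of 0] by eventually_elim (simp only: \<mu> p_def)
  \<comment> \<open>Truncating \<open>m\<close> at \<open>n\<close> caps the ratio \<open>y\<close>
    at \<open>n powr (1 - \<alpha>)\<close>. Since \<open>\<alpha> < 1\<close> this cap tends to
    infinity, so above the threshold the truncated ratio still diverges.\<close>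
  have y_min: "min (y m n) (real n powr (1 - \<alpha>)) = y (min m n) n" if "0 < n" for m n :: nat
  proof -
    have "real n powr (1 - \<alpha>) = real n / real n powr \<alpha>" using that by (simp add: powr_diff)
    thus ?thesis using powr_ge[OF that] unfolding y_def
      by (simp add: min_def divide_right_mono divide_le_cancel)
  qed
  have n_powr: "filterlim (\<lambda>n. real n powr (1 - \<alpha>)) at_top sequentially" using \<alpha>1 by real_asymp
  show ?thesis
  proof (intro conjI allI impI)
    fix m :: "nat \<Rightarrow> nat"
    assume "(\<lambda>n. real (m n)) \<lless> (\<lambda>n. real n powr \<alpha>)"
    hence y0: "(\<lambda>n. y (m n) n) \<longlonglongrightarrow> 0" unfolding y_def much_less_def by (rule smalloD_tendsto)
    show "(\<lambda>n. p (m n) n) \<longlonglongrightarrow> 1" unfolding p_def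
    proof (rule sat_prob_tendsto_1_small_trees[OF k2 s1 min])
      have "eventually (\<lambda>n. real (m n) / real n \<le> y (m n) n) sequentially"
        using eventually_gt_at_top[of 0]
      proof eventually_elim
        case (elim n)
        thus ?case unfolding y_def using powr_le[OF elim] powr_ge[OF elim] by (intro divide_left_mono) auto
      qed
      thus "(\<lambda>n. real (m n) / real n) \<longlonglongrightarrow> 0"
        by (rule tendsto_sandwich[OF _ _ tendsto_const y0, rotated]) simp
      have "(\<lambda>n. y (m n) n ^ s) \<longlonglongrightarrow> 0 ^ s" by (rule tendsto_power[OF y0])
      hence "(\<lambda>n. y (m n) n ^ s) \<longlonglongrightarrow> 0" using s1 by (simp add: power_0_left)
      moreover have "eventually (\<lambda>n. y (m n) n ^ s = real (m n) ^ s / real n ^ (s - 1)) sequentially"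
        using eventually_gt_at_top[of 0] by eventually_elim (simp only: \<mu>)
      ultimately show "(\<lambda>n. real (m n) ^ s / real n ^ (s - 1)) \<longlonglongrightarrow> 0" by (rule Lim_transform_eventually)
    qed
  next
    fix m :: "nat \<Rightarrow> nat"
    assume m: "(\<lambda>n. real n powr \<alpha>) \<lless> (\<lambda>n. real (m n))"
    have "filterlim (\<lambda>n. y (m n) n) at_top sequentially"
      unfolding filterlim_at_top
    proof
      fix Z :: real
      let ?Z = "max Z 1"
      have "eventually (\<lambda>n. norm (real n powr \<alpha>) \<le> inverse ?Z * norm (real (m n))) sequentially"
        using m unfolding much_less_def by (rule landau_o.smallD) simp
      thus "eventually (\<lambda>n. Z \<le> y (m n) n) sequentially" using eventually_gt_at_top[of 0]
      proof eventually_elim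
        case (elim n)
        have "?Z * real n powr \<alpha> \<le> ?Z * (inverse ?Z * real (m n))"
          by (rule mult_left_mono) (use elim in auto)
        also have "\<dots> = real (m n)" by (simp add: max_def)
        finally have "?Z \<le> y (m n) n" unfolding y_def using powr_ge[OF elim(2)]
          by (subst pos_le_divide_eq) linarith+
        thus ?case by simp
      qed
    qed
    hence "filterlim (\<lambda>n. min (y (m n) n) (real n powr (1 - \<alpha>))) at_top sequentially"
      using n_powr unfolding filterlim_at_top by (auto simp: eventually_conj_iff)
    moreover have "eventually (\<lambda>n. min (y (m n) n) (real n powr (1 - \<alpha>)) = y (min (m n) n) n) sequentially"
      using eventually_gt_at_top[of 0] by eventually_elim (rule y_min)
    ultimately have lim: "filterlim (\<lambda>n. y (min (m n) n) n) at_top sequentially"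
      by (rule filterlim_cong[OF refl refl, THEN iffD1, rotated])
    have "eventually (\<lambda>n. real s \<le> y (min (m n) n) n) sequentially"
      using lim unfolding filterlim_at_top by blast
    hence "eventually (\<lambda>n. p (m n) n \<le> d / (c * y (min (m n) n) n ^ s + d)) sequentially"
      using upper' eventually_gt_at_top[of 0]
    proof eventually_elim
      case (elim n)
      \<comment> \<open>The threshold itself is at least 1, so the ratio is at most the number of
        rows; its divergence thus provides the \<open>s\<close> rows that a copy requires.\<close>
      have "y (min (m n) n) n \<le> real (min (m n) n)" unfolding y_def
        using powr_ge[OF elim(3)] by (simp add: divide_le_eq mult_le_cancel_left1)
      hence "s \<le> min (m n) n" using elim(1) by linarith
      thus ?case using elim(2) by blast
    qed
    moreover have "(\<lambda>n. d / (c * y (min (m n) n) n ^ s + d)) \<longlonglongrightarrow> 0"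
    proof (rule tendsto_divide_0[OF tendsto_const])
      have "filterlim (\<lambda>n. y (min (m n) n) n ^ s) at_top sequentially"
        by (rule filterlim_pow_at_top[OF _ lim]) (use s1 in simp)
      hence "filterlim (\<lambda>n. c * y (min (m n) n) n ^ s) at_top sequentially"
        by (rule filterlim_tendsto_pos_mult_at_top[OF tendsto_const cd(1)])
      hence "filterlim (\<lambda>n. d + c * y (min (m n) n) n ^ s) at_top sequentially"
        by (rule filterlim_tendsto_add_at_top[OF tendsto_const])
      thus "filterlim (\<lambda>n. c * y (min (m n) n) n ^ s + d) at_infinity sequentially"
        by (simp add: add.commute filterlim_at_top_imp_at_infinity)
    qed
    ultimately show "(\<lambda>n. p (m n) n) \<longlonglongrightarrow> 0"
      by (rule tendsto_sandwich[OF _ _ tendsto_const, rotated]) (simp add: p_def sat_prob_bounds)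
  next
    fix C :: real
    assume C: "0 < C"
    define m where "m n = nat \<lceil>C * real n powr \<alpha>\<rceil>" for n :: nat
    have m_ge: "C * real n powr \<alpha> \<le> real (m n)" for n unfolding m_def by linarith
    have m_le: "real (m n) \<le> (C + 1) * real n powr \<alpha>" if "0 < n" for n
    proof -
      have "0 \<le> C * real n powr \<alpha>" using C by simp
      hence "real (m n) \<le> C * real n powr \<alpha> + 1" unfolding m_def by linarith
      thus ?thesis using powr_ge[OF that] by (simp add: algebra_simps)
    qed
    have "\<exists>c>0. eventually (\<lambda>n. c \<le> p (m n) n) sequentially"
    proof (cases "s = 1")
      case True
      hence a0: "\<alpha> = 0" by (simp add: \<alpha>)
      have "eventually (\<lambda>n. m n = nat \<lceil>C\<rceil>) sequentially"
        using eventually_gt_at_top[of 0] by eventually_elim (simp add: m_def a0)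
      thus ?thesis unfolding p_def by (rule sat_prob_bounded_below_fixed[OF k2 assms(2)])
    next
      case False
      hence s2: "2 \<le> s" using s1 by simp
      show ?thesis unfolding p_def
      proof (rule sat_prob_bounded_below[OF k2 s2 min])
        have "eventually (\<lambda>n. real (m n) / real n \<le> (C + 1) * real n powr (\<alpha> - 1)) sequentially"
          using eventually_gt_at_top[of 0]
        proof eventually_elim
          case (elim n)
          thus ?case using m_le[OF elim] by (simp add: powr_diff field_simps)
        qed
        moreover have "(\<lambda>n. (C + 1) * real n powr (\<alpha> - 1)) \<longlonglongrightarrow> 0" using \<alpha>1 by real_asymp
        ultimately show "(\<lambda>n. real (m n) / real n) \<longlonglongrightarrow> 0"
          by (rule tendsto_sandwich[OF _ _ tendsto_const, rotated]) simp
        show "eventually (\<lambda>n. real (m n) ^ s / real n ^ (s - 1) \<le> (C + 1) ^ s) sequentially"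
          using eventually_gt_at_top[of 0]
        proof eventually_elim
          case (elim n)
          have "y (m n) n \<le> C + 1" unfolding y_def
            using m_le[OF elim] powr_ge[OF elim] by (subst pos_divide_le_eq) linarith+
          moreover have "0 \<le> y (m n) n" by (simp add: y_def)
          ultimately show ?case unfolding \<mu>[OF elim] by (rule power_mono)
        qed
      qed
    qed
    then obtain \<epsilon> where \<epsilon>: "0 < \<epsilon>" "eventually (\<lambda>n. \<epsilon> \<le> p (m n) n) sequentially" by blast
    \<comment> \<open>Rounding up gives ratio at least \<open>C\<close> before truncation, and the
      cap is at least 1; so the truncated ratio is at least \<open>min C 1\<close>.\<close>
    define \<kappa> where "\<kappa> = d / (c * min C 1 ^ s + d)"
    have "eventually (\<lambda>n. s \<le> min (m n) n) sequentially"
    proof (cases "s = 1")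
      case True
      show ?thesis using eventually_gt_at_top[of 0]
      \<comment> \<open>For exponent 0 the row count does not grow, but rounding up a positive
        number yields the one row that is required.\<close>
      proof eventually_elim
        case (elim n)
        have "0 < C * real n powr \<alpha>" using C elim by simp
        hence "0 < real (m n)" using m_ge[of n] by linarith
        thus ?case using elim True by simp
      qed
    next
      case False
      hence "0 < \<alpha>" using s1 by (simp add: \<alpha>)
      hence "filterlim (\<lambda>n. C * real n powr \<alpha>) at_top sequentially" using C by real_asymp
      hence "eventually (\<lambda>n. real s \<le> C * real n powr \<alpha>) sequentially" unfolding filterlim_at_top by blast
      thus ?thesis using eventually_ge_at_top[of s]
      proof eventually_elim
        case (elim n)
        have "real s \<le> real (m n)" using elim(1) m_ge[of n] by linarith
        thus ?case using elim by simp
      qed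
    qed
    hence \<kappa>: "eventually (\<lambda>n. p (m n) n \<le> \<kappa>) sequentially"
      using upper' eventually_gt_at_top[of 0]
    proof eventually_elim
      case (elim n)
      have "C \<le> y (m n) n" unfolding y_def using m_ge[of n] powr_ge[OF elim(3)]
        by (subst pos_le_divide_eq) linarith+
      moreover have "1 \<le> real n powr (1 - \<alpha>)" using elim(3) \<alpha>1 by (intro ge_one_powr_ge_zero) auto
      ultimately have "min C 1 \<le> y (min (m n) n) n" unfolding y_min[OF elim(3), symmetric] by auto
      hence "min C 1 ^ s \<le> y (min (m n) n) n ^ s" using C by (intro power_mono) auto
      hence "c * min C 1 ^ s + d \<le> c * y (min (m n) n) n ^ s + d" using cd by simp
      moreover have "0 < c * min C 1 ^ s + d" using cd C by (intro add_nonneg_pos) auto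
      ultimately have "d / (c * y (min (m n) n) n ^ s + d) \<le> \<kappa>"
        unfolding \<kappa>_def using cd by (intro divide_left_mono mult_pos_pos) linarith+
      thus ?case using elim(1,2) order_trans by blast
    qed
    have "0 < c * min C 1 ^ s" using cd C by simp
    hence \<kappa>1: "\<kappa> < 1" unfolding \<kappa>_def using cd by (subst divide_less_eq_1_pos) auto
    let ?q = "\<lambda>n. ereal (p (m n) n)"
    have "ereal \<epsilon> \<le> liminf ?q" by (rule Liminf_bounded) (use \<epsilon>(2) in simp)
    moreover have "limsup ?q \<le> ereal \<kappa>" by (rule Limsup_bounded) (use \<kappa> in simp)
    ultimately have "0 < liminf ?q \<and> liminf ?q \<le> limsup ?q \<and> limsup ?q < 1"
      using \<epsilon>(1) \<kappa>1 Liminf_le_Limsup[OF sequentially_bot, of ?q]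
      by (metis ereal_less(2) ereal_less(3) less_le_trans le_less_trans)
    thus "let q = (\<lambda>n. ereal (p (nat \<lceil>C * real n powr \<alpha>\<rceil>) n))
                    in 0 < liminf q \<and> liminf q \<le> limsup q \<and> limsup q < 1"
      by (simp add: m_def Let_def)
  qed
qed

end
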